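(* Let $R$ be a complete discrete valuation ring of equal characteristic with maximal ideal $\mathfrak{p}$ and finite residue field $k=R/\mathfrak{p}$ with $|k|>9$, and let $n\ge2$. Let $H$ be a closed subgroup of $\mathrm{GL}_n(R)$ such that the image of $H$ in $\mathrm{GL}_n(k)$ contains $\mathrm{SL}_n(k)$ and such that the set $\mathrm{Tr}\,\mathrm{Ad}(H)=\{\mathrm{Tr}\,\mathrm{Ad}(h)\mid h\in H\}$ topologically generates the ring $R$. Then $H^{\mathrm{der}}=\mathrm{SL}_n(R)$.
   Context: $\mathrm{Ad}$ is the adjoint representation of $\mathrm{GL}_n$ on $\mathfrak{gl}_n$, $X\mapsto hXh^{-1}$, so $\mathrm{Tr}\,\mathrm{Ad}(h)\in R$. "Topologically generates" means the smallest closed subring of $R$ containing the set is $R$. $H^{\mathrm{der}}$ is the closure of the derived group of $H$. *)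

theory Defs
  imports "HOL-Analysis.Analysis"
begin

text \<open>pi is a uniformizer of the integral domain R: R is then a DVR with maximal ideal (pi).\<close>
definition uniformizer :: "'a::idom \<Rightarrow> bool" where
  "uniformizer \<pi> \<longleftrightarrow> \<pi> \<noteq> 0 \<and> \<not> \<pi> dvd 1 \<and>
     (\<forall>x. x \<noteq> 0 \<longrightarrow> (\<exists>u k. u dvd 1 \<and> x = u * \<pi> ^ k))"

definition padic_lim :: "'a::idom \<Rightarrow> (nat \<Rightarrow> 'a) \<Rightarrow> 'a \<Rightarrow> bool" where
  "padic_lim \<pi> x L \<longleftrightarrow> (\<forall>m. \<exists>N. \<forall>i\<ge>N. \<pi> ^ m dvd (x i - L))"

definition padic_cauchy :: "'a::idom \<Rightarrow> (nat \<Rightarrow> 'a) \<Rightarrow> bool" where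
  "padic_cauchy \<pi> x \<longleftrightarrow> (\<forall>m. \<exists>N. \<forall>i\<ge>N. \<forall>j\<ge>N. \<pi> ^ m dvd (x i - x j))"

definition padic_complete :: "'a::idom \<Rightarrow> bool" where
  "padic_complete \<pi> \<longleftrightarrow> (\<forall>x. padic_cauchy \<pi> x \<longrightarrow> (\<exists>L. padic_lim \<pi> x L))"

definition complete_dvr :: "'a::idom \<Rightarrow> bool" where
  "complete_dvr \<pi> \<longleftrightarrow> uniformizer \<pi> \<and> padic_complete \<pi>"

definition residue_rel :: "'a::idom \<Rightarrow> ('a \<times> 'a) set" where
  "residue_rel \<pi> = {(x, y). \<pi> dvd (x - y)}"

definition residue_field :: "'a::idom \<Rightarrow> 'a set set" where
  "residue_field \<pi> = UNIV // residue_rel \<pi>"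

definition residue_char :: "'a::idom \<Rightarrow> nat" where
  "residue_char \<pi> = Gcd {n. \<pi> dvd (of_nat n :: 'a)}"

definition equal_characteristic :: "'a::idom \<Rightarrow> bool" where
  "equal_characteristic \<pi> \<longleftrightarrow> CHAR('a) = residue_char \<pi>"

definition GL :: "('a::comm_ring_1^'n^'n) set" where
  "GL = {A. invertible A}"

definition SL :: "('a::comm_ring_1^'n^'n) set" where
  "SL = {A. det A = 1}"

definition mat_padic_lim :: "'a::idom \<Rightarrow> (nat \<Rightarrow> 'a^'n^'n) \<Rightarrow> 'a^'n^'n \<Rightarrow> bool" where
  "mat_padic_lim \<pi> X L \<longleftrightarrow> (\<forall>i j. padic_lim \<pi> (\<lambda>k. X k $ i $ j) (L $ i $ j))"

definition mat_closure :: "'a::idom \<Rightarrow> ('a^'n^'n) set \<Rightarrow> ('a^'n^'n) set" where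
  "mat_closure \<pi> S = {L. \<exists>X. (\<forall>k. X k \<in> S) \<and> mat_padic_lim \<pi> X L}"

definition closed_subgroup_GL :: "'a::idom \<Rightarrow> ('a^'n^'n) set \<Rightarrow> bool" where
  "closed_subgroup_GL \<pi> H \<longleftrightarrow> H \<subseteq> GL \<and> mat 1 \<in> H \<and>
     (\<forall>g\<in>H. \<forall>h\<in>H. g ** h \<in> H) \<and> (\<forall>h\<in>H. matrix_inv h \<in> H) \<and>
     mat_closure \<pi> (GL \<inter> H) \<inter> GL \<subseteq> H"

text \<open>The image of H in GL_n(k) contains SL_n(k): every matrix over R whose reduction
  mod pi lies in SL_n(k) (i.e. det = 1 mod pi) agrees mod pi with some element of H.
  (Every element of SL_n(k) lifts to such a matrix.)\<close>
definition image_contains_SL_residue :: "'a::idom \<Rightarrow> ('a^'n^'n) set \<Rightarrow> bool" where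
  "image_contains_SL_residue \<pi> H \<longleftrightarrow>
     (\<forall>M::'a^'n^'n. \<pi> dvd (det M - 1) \<longrightarrow> (\<exists>h\<in>H. \<forall>i j. \<pi> dvd (h $ i $ j - M $ i $ j)))"

text \<open>Adjoint representation and its trace (trace of the linear map X |-> h X h^-1
  on gl_n, computed in the basis of elementary matrices E_ij).\<close>
definition elem_mat :: "'n \<Rightarrow> 'n \<Rightarrow> 'a::comm_ring_1^'n^'n" where
  "elem_mat i j = (\<chi> a b. if a = i \<and> b = j then 1 else 0)"

definition Ad :: "'a::comm_ring_1^'n^'n \<Rightarrow> 'a^'n^'n \<Rightarrow> 'a^'n^'n" where
  "Ad h X = h ** X ** matrix_inv h"

definition trace_Ad :: "'a::comm_ring_1^'n^'n \<Rightarrow> 'a" where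
  "trace_Ad h = (\<Sum>i\<in>UNIV. \<Sum>j\<in>UNIV. Ad h (elem_mat i j) $ i $ j)"

definition closed_subring :: "'a::idom \<Rightarrow> 'a set \<Rightarrow> bool" where
  "closed_subring \<pi> T \<longleftrightarrow> 0 \<in> T \<and> 1 \<in> T \<and>
     (\<forall>x\<in>T. \<forall>y\<in>T. x + y \<in> T \<and> x - y \<in> T \<and> x * y \<in> T) \<and>
     (\<forall>x L. (\<forall>k. x k \<in> T) \<longrightarrow> padic_lim \<pi> x L \<longrightarrow> L \<in> T)"

definition top_generates :: "'a::idom \<Rightarrow> 'a set \<Rightarrow> bool" where
  "top_generates \<pi> S \<longleftrightarrow> \<Inter>{T. closed_subring \<pi> T \<and> S \<subseteq> T} = UNIV"

inductive_set derived_subgroup :: "('a::comm_ring_1^'n^'n) set \<Rightarrow> ('a^'n^'n) set"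
  for H where
  one: "mat 1 \<in> derived_subgroup H"
| comm: "g \<in> H \<Longrightarrow> h \<in> H \<Longrightarrow> g ** h ** matrix_inv g ** matrix_inv h \<in> derived_subgroup H"
| mult: "a \<in> derived_subgroup H \<Longrightarrow> b \<in> derived_subgroup H \<Longrightarrow> a ** b \<in> derived_subgroup H"
| inv: "a \<in> derived_subgroup H \<Longrightarrow> matrix_inv a \<in> derived_subgroup H"

definition H_der :: "'a::idom \<Rightarrow> ('a^'n^'n) set \<Rightarrow> ('a^'n^'n) set" where
  "H_der \<pi> H = mat_closure \<pi> (derived_subgroup H)"

end

(* Let D be the derived group of H, and let L_m be the set of trace zero matrices X over the residue
   field k such that 1 + pi^m X lies in D modulo pi^(m+1). Each L_m is an additive group stable under
   conjugation by SL_n(k), hence all of sl_n(k) as soon as it contains a nonscalar matrix. If L_1 is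
   all of sl_n(k), commutators show the same for every L_m (with a separate argument for n = p = 2),
   and D is dense in SL_n(R).

   Otherwise L_1 is scalar, and D modulo pi^2 is up to scalars a lift of SL_n(k). With the field K of
   Teichmueller representatives in R (equal characteristic), such a lift is conjugate to SL_n(K):
   averaging over the diagonal torus T(K) makes the lift of T(K) standard, T(K)-equivariance then
   restricts the lifts of the root elements to x_ij((1 + pi y_ij) a), which is where |k| > 9 enters,
   and the relations between root elements give y_ij = g_i - g_j, so that a diagonal conjugation removes
   y. As H normalizes D, also H modulo pi^2 is conjugate into scalars times GL_n(K); so Tr Ad(H) lies in
   the proper closed subring K + pi^2 R, a contradiction. *)

theory Submission
  imports Defs "HOL-Computational_Algebra.Polynomial"
begin


section \<open>Matrix congruences and transvections\<close>

text \<open>The rings k and R/pi^2 never appear as types: equality in them is \<open>mcong\<close>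
  on matrices over R, and groups over them are unions of congruence classes. The obstacle is that
  the identity matrix lies in sl_n(k) when p divides n, so a scalar L_1 need not vanish and lifts
  are unique only up to factors 1 + pi e. All these factors are therefore adjoined to the group
  modulo pi^2, each comparison of two lifts carries an unknown scalar that must be eliminated, and
  adjoint traces are blind to it in the end. The bound 9 comes from the entry (j,i) in a lift of
  x_ij(a): it is an additive function f of a with f(t^2 a) = t^(-2) f(a). For |k| = 9 the map f(a) =
  a^3 is such a function and is not zero; for larger k some polynomial of degree at most 9 has a
  non-root, which forces f = 0.\<close>

definition mcong :: "'a::comm_ring_1 \<Rightarrow> 'a^'n^'m \<Rightarrow> 'a^'n^'m \<Rightarrow> bool" where
  "mcong d A B \<longleftrightarrow> (\<forall>i j. d dvd A $ i $ j - B $ i $ j)"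

definition smul :: "'a::comm_ring_1 \<Rightarrow> 'a^'n^'m \<Rightarrow> 'a^'n^'m" where
  "smul c A = (\<chi> i j. c * A $ i $ j)"

lemma smul_nth [simp]: "smul c A $ i $ j = c * A $ i $ j"
  by (simp add: smul_def)

lemma mat_nth: "mat c $ i $ j = (if i = j then c else 0)"
  by (simp add: mat_def)

lemma matrix_mult_nth: "(A ** B) $ i $ j = (\<Sum>k\<in>UNIV. A $ i $ k * B $ k $ j)"
  by (simp add: matrix_matrix_mult_def)

lemma matrix_eqI: "(\<And>i j. A $ i $ j = B $ i $ j) \<Longrightarrow> A = B"
  by (simp add: vec_eq_iff)

lemma smul_mult_left: "smul c A ** B = smul c (A ** B)"
  by (rule matrix_eqI) (simp add: matrix_mult_nth sum_distrib_left mult.assoc)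

lemma smul_mult_right: "A ** smul c B = smul c (A ** B)"
  by (rule matrix_eqI) (simp add: matrix_mult_nth sum_distrib_left mult.left_commute)

lemma smul_smul: "smul c (smul d A) = smul (c * d) A"
  by (rule matrix_eqI) (simp add: mult.assoc)

lemma smul_add: "smul c (A + B) = smul c A + smul c B"
  by (rule matrix_eqI) (simp add: algebra_simps)

lemma smul_diff: "smul c (A - B) = smul c A - smul c B"
  by (rule matrix_eqI) (simp add: algebra_simps)

lemma smul_add_left: "smul (c + d) A = smul c A + smul d A"
  by (rule matrix_eqI) (simp add: algebra_simps)

lemma smul_uminus: "smul c (- A) = - smul c A"
  by (rule matrix_eqI) simp

lemma smul_one [simp]: "smul 1 A = A"
  by (rule matrix_eqI) simp

lemma matrix_add_rdistrib': "((B::'a::comm_ring_1^'n^'m) + C) ** A = B ** A + C ** A"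
  by (rule matrix_eqI) (simp add: matrix_mult_nth sum.distrib algebra_simps)

lemma matrix_diff_ldistrib: "(A::'a::comm_ring_1^'n^'m) ** (B - C) = A ** B - A ** C"
  by (rule matrix_eqI) (simp add: matrix_mult_nth sum_subtractf algebra_simps)

lemma matrix_diff_rdistrib: "((B::'a::comm_ring_1^'n^'m) - C) ** A = B ** A - C ** A"
  by (rule matrix_eqI) (simp add: matrix_mult_nth sum_subtractf algebra_simps)

lemma matrix_uminus_left: "(- (A::'a::comm_ring_1^'n^'m)) ** B = - (A ** B)"
  by (rule matrix_eqI) (simp add: matrix_mult_nth sum_negf)

lemma matrix_uminus_right: "(A::'a::comm_ring_1^'n^'m) ** (- B) = - (A ** B)"
  by (rule matrix_eqI) (simp add: matrix_mult_nth sum_negf)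

lemmas matrix_ring_simps = matrix_add_ldistrib matrix_add_rdistrib' matrix_diff_ldistrib
  matrix_diff_rdistrib smul_mult_left smul_mult_right smul_smul smul_add smul_diff
  matrix_mul_assoc[symmetric] matrix_uminus_left matrix_uminus_right smul_uminus

lemma mcongI: "(\<And>i j. d dvd A $ i $ j - B $ i $ j) \<Longrightarrow> mcong d A B"
  by (simp add: mcong_def)

lemma mcongD: "mcong d A B \<Longrightarrow> d dvd A $ i $ j - B $ i $ j"
  by (simp add: mcong_def)

lemma mcong_refl [simp]: "mcong d A A"
  by (simp add: mcong_def)

lemma mcong_sym: "mcong d A B \<Longrightarrow> mcong d B A"
  by (metis mcong_def dvd_minus_iff minus_diff_eq)

lemma dvd_diff_trans: "(d::'a::comm_ring_1) dvd a - b \<Longrightarrow> d dvd b - c \<Longrightarrow> d dvd a - c"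
  using dvd_add[of d "a - b" "b - c"] by simp

lemma mcong_trans [trans]: "mcong d A B \<Longrightarrow> mcong d B C \<Longrightarrow> mcong d A C"
  unfolding mcong_def using dvd_diff_trans by blast

lemma mcong_add:
  assumes "mcong d A A'" "mcong d B B'"
  shows "mcong d (A + B) (A' + B')"
proof (rule mcongI)
  fix i j
  show "d dvd (A + B) $ i $ j - (A' + B') $ i $ j"
    using dvd_add[OF mcongD[OF assms(1), of i j] mcongD[OF assms(2), of i j]] by (simp add: algebra_simps)
qed

lemma mcong_diff:
  assumes "mcong d A A'" "mcong d B B'"
  shows "mcong d (A - B) (A' - B')"
proof (rule mcongI)
  fix i j
  show "d dvd (A - B) $ i $ j - (A' - B') $ i $ j"
    using dvd_diff[OF mcongD[OF assms(1), of i j] mcongD[OF assms(2), of i j]] by (simp add: algebra_simps)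
qed

lemma mcong_smul: "mcong d A A' \<Longrightarrow> mcong d (smul c A) (smul c A')"
  unfolding mcong_def by (simp flip: right_diff_distrib)

lemma mcong_smul_scale: "mcong d A A' \<Longrightarrow> mcong (c * d) (smul c A) (smul c A')"
  unfolding mcong_def by (simp flip: right_diff_distrib add: mult_dvd_mono)

lemma mcong_mono: "mcong d A B \<Longrightarrow> e dvd d \<Longrightarrow> mcong e A B"
  unfolding mcong_def using dvd_trans by blast

lemma mcong_mult: 
  assumes "mcong d A A'" "mcong d B B'"
  shows "mcong d (A ** B) (A' ** B')"
proof (rule mcongI)
  fix i j
  have "(A ** B) $ i $ j - (A' ** B') $ i $ j = 
    (\<Sum>k\<in>UNIV. A $ i $ k * (B $ k $ j - B' $ k $ j) + (A $ i $ k - A' $ i $ k) * B' $ k $ j)"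
    by (simp add: matrix_mult_nth flip: sum_subtractf) (simp add: algebra_simps)
  also have "d dvd \<dots>"
    using assms by (intro dvd_sum dvd_add dvd_mult dvd_mult2) (auto simp: mcong_def)
  finally show "d dvd (A ** B) $ i $ j - (A' ** B') $ i $ j" .
qed

lemma mcong_mult_left: "mcong d B B' \<Longrightarrow> mcong d (A ** B) (A ** B')"
  by (simp add: mcong_mult)

lemma mcong_mult_right: "mcong d A A' \<Longrightarrow> mcong d (A ** B) (A' ** B)"
  by (simp add: mcong_mult)

lemma mcong_sum: "(\<And>x. x \<in> S \<Longrightarrow> mcong d (f x) (g x)) \<Longrightarrow> mcong d (sum f S) (sum g S)"
  unfolding mcong_def by (auto simp flip: sum_subtractf intro: dvd_sum)

lemma mcong_iff_ex: "mcong d A B \<longleftrightarrow> (\<exists>C. A = B + smul d C)"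
proof
  assume "mcong d A B"
  then have "\<forall>i j. \<exists>c. A $ i $ j - B $ i $ j = d * c"
    by (auto simp: mcong_def dvd_def)
  then obtain c where "\<And>i j. A $ i $ j - B $ i $ j = d * c i j"
    by metis
  then have "A = B + smul d (\<chi> i j. c i j)"
    by (intro matrix_eqI) (simp add: algebra_simps diff_eq_eq)
  then show "\<exists>C. A = B + smul d C" ..
qed (auto simp: mcong_def)

lemma mcong_smul_cancel:
  fixes A B :: "'a::idom^'n^'m"
  shows "c \<noteq> 0 \<Longrightarrow> mcong (c * d) (smul c A) (smul c B) \<longleftrightarrow> mcong d A B"
  by (auto simp: mcong_def simp flip: right_diff_distrib)

lemma mcong_trace: "mcong d A B \<Longrightarrow> d dvd trace A - trace B"
  by (auto simp: trace_def mcong_def simp flip: sum_subtractf intro: dvd_sum)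

lemma dvd_prod_diff:
  fixes f g :: "'i \<Rightarrow> 'a::comm_ring_1"
  assumes "\<And>x. x \<in> S \<Longrightarrow> d dvd f x - g x"
  shows "d dvd prod f S - prod g S"
  using assms
proof (induction S rule: infinite_finite_induct)
  case (insert x F)
  have "prod f (insert x F) - prod g (insert x F) = f x * (prod f F - prod g F) + (f x - g x) * prod g F"
    using insert by (simp add: algebra_simps)
  then show ?case using insert by (auto intro!: dvd_add dvd_mult dvd_mult2)
qed auto

lemma mcong_det:
  assumes "mcong d A B"
  shows "d dvd det A - det B"
proof -
  have "d dvd (\<Sum>p\<in>{p. p permutes UNIV}. of_int (sign p) * (prod (\<lambda>i. A $ i $ p i) UNIV - prod (\<lambda>i. B $ i $ p i) UNIV))"
    using assms by (intro dvd_sum dvd_mult dvd_prod_diff) (auto simp: mcong_def)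
  then show ?thesis by (simp add: det_def sum_subtractf right_diff_distrib)
qed

lemma det_smul: "det (smul c (A::'a::comm_ring_1^'n^'n)) = c ^ CARD('n) * det A"
  by (simp add: det_def prod.distrib sum_distrib_left mult.left_commute)

section \<open>Transvections, elementary and diagonal matrices\<close>

definition transvection :: "'n \<Rightarrow> 'n \<Rightarrow> 'a \<Rightarrow> 'a::comm_ring_1^'n^'n" where
  "transvection i j a = (\<chi> k l. (if k = l then 1 else 0) + (if k = i \<and> l = j then a else 0))"

definition diag_matrix :: "('n \<Rightarrow> 'a) \<Rightarrow> 'a::comm_ring_1^'n^'n" where
  "diag_matrix t = (\<chi> k l. if k = l then t k else 0)"

lemma transvection_nth: "transvection i j a $ k $ l = (if k = l then 1 else 0) + (if k = i \<and> l = j then a else 0)"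
  by (simp add: transvection_def)

lemma diag_matrix_nth: "diag_matrix t $ k $ l = (if k = l then t k else 0)"
  by (simp add: diag_matrix_def)

lemma elem_mat_nth: "elem_mat i j $ k $ l = (if k = i \<and> l = j then 1 else 0)"
  by (simp add: elem_mat_def)

lemma transvection_mult_nth:
  "(transvection i j a ** M) $ k $ l = M $ k $ l + (if k = i then a * M $ j $ l else 0)"
proof -
  have "(transvection i j a ** M) $ k $ l = (\<Sum>m\<in>UNIV. (if m = k then M $ m $ l else 0) + (if m = j then (if k = i then a * M $ m $ l else 0) else 0))"
    unfolding matrix_mult_nth by (intro sum.cong) (auto simp: transvection_nth algebra_simps)
  then show ?thesis by (simp add: sum.distrib)
qed

lemma mult_transvection_nth:
  "(M ** transvection i j a) $ k $ l = M $ k $ l + (if l = j then M $ k $ i * a else 0)"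
proof -
  have "(M ** transvection i j a) $ k $ l = (\<Sum>m\<in>UNIV. (if m = l then M $ k $ m else 0) + (if m = i then (if l = j then M $ k $ m * a else 0) else 0))"
    unfolding matrix_mult_nth by (intro sum.cong) (auto simp: transvection_nth algebra_simps)
  then show ?thesis by (simp add: sum.distrib)
qed

lemma elem_mat_mult_nth: "(elem_mat i j ** M) $ k $ l = (if k = i then M $ j $ l else 0)"
proof -
  have "(elem_mat i j ** M) $ k $ l = (\<Sum>m\<in>UNIV. (if m = j then (if k = i then M $ m $ l else 0) else 0))"
    unfolding matrix_mult_nth by (intro sum.cong) (auto simp: elem_mat_nth)
  then show ?thesis by simp
qed

lemma mult_elem_mat_nth: "(M ** elem_mat i j) $ k $ l = (if l = j then M $ k $ i else 0)"
proof -
  have "(M ** elem_mat i j) $ k $ l = (\<Sum>m\<in>UNIV. (if m = i then (if l = j then M $ k $ m else 0) else 0))"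
    unfolding matrix_mult_nth by (intro sum.cong) (auto simp: elem_mat_nth)
  then show ?thesis by simp
qed

lemma diag_mult_nth: "(diag_matrix t ** M) $ k $ l = t k * M $ k $ l"
proof -
  have "(diag_matrix t ** M) $ k $ l = (\<Sum>m\<in>UNIV. (if m = k then t m * M $ m $ l else 0))"
    unfolding matrix_mult_nth by (intro sum.cong) (auto simp: diag_matrix_nth)
  then show ?thesis by simp
qed

lemma mult_diag_nth: "(M ** diag_matrix t) $ k $ l = M $ k $ l * t l"
proof -
  have "(M ** diag_matrix t) $ k $ l = (\<Sum>m\<in>UNIV. (if m = l then M $ k $ m * t m else 0))"
    unfolding matrix_mult_nth by (intro sum.cong) (auto simp: diag_matrix_nth)
  then show ?thesis by simp
qed

lemmas entry_simps = transvection_mult_nth mult_transvection_nth elem_mat_mult_nth mult_elem_mat_nth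
  diag_mult_nth mult_diag_nth transvection_nth diag_matrix_nth elem_mat_nth mat_nth

lemma transvection_0 [simp]: "transvection i j 0 = mat 1"
  by (rule matrix_eqI) (simp add: entry_simps)

lemma transvection_add: "i \<noteq> j \<Longrightarrow> transvection i j a ** transvection i j b = transvection i j (a + b)"
  by (rule matrix_eqI) (auto simp: entry_simps)

lemma diag_matrix_mult: "diag_matrix s ** diag_matrix t = diag_matrix (\<lambda>i. s i * t i)"
  by (rule matrix_eqI) (auto simp: entry_simps)

lemma det_diag_matrix: "det (diag_matrix t) = prod t UNIV"
  by (subst det_diagonal) (auto simp: entry_simps)

lemma det_transvection: "i \<noteq> j \<Longrightarrow> det (transvection i j a :: 'a::comm_ring_1^'n^'n) = 1"
proof -
  assume "i \<noteq> j"
  have "(\<chi> k. if k = i then row i (mat 1) + a *s row j (mat 1) else row k (mat 1)) = (transvection i j a :: 'a^'n^'n)"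
    using \<open>i \<noteq> j\<close> by (auto simp: vec_eq_iff entry_simps row_def)
  then show ?thesis using det_row_operation[OF \<open>i \<noteq> j\<close>, of "mat 1 :: 'a^'n^'n" a] by simp
qed

lemma transvection_mcong: "d dvd a - b \<Longrightarrow> mcong d (transvection i j a) (transvection i j b)"
  by (auto simp: mcong_def entry_simps)

section \<open>Elimination over a local ring\<close>

lemma dvd_det_row:
  fixes A :: "'a::comm_ring_1^'n^'n"
  assumes "\<And>j. d dvd A $ i $ j"
  shows "d dvd det A"
  unfolding det_def
proof (intro dvd_sum dvd_mult)
  fix p :: "'n \<Rightarrow> 'n"
  have "(\<Prod>i\<in>UNIV. A $ i $ p i) = A $ i $ p i * (\<Prod>i\<in>UNIV - {i}. A $ i $ p i)"
    by (rule prod.remove) auto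
  then show "d dvd (\<Prod>i\<in>UNIV. A $ i $ p i)" using assms by simp
qed

lemma uniformizer_unit_iff:
  assumes "uniformizer (\<pi>::'a::idom)"
  shows "x dvd 1 \<longleftrightarrow> \<not> \<pi> dvd x"
proof
  show "x dvd 1 \<Longrightarrow> \<not> \<pi> dvd x" using assms dvd_trans by (auto simp: uniformizer_def)
  assume a: "\<not> \<pi> dvd x"
  then have "x \<noteq> 0" by auto
  then obtain u k where "u dvd 1" "x = u * \<pi> ^ k" using assms by (auto simp: uniformizer_def)
  moreover from this a have "k = 0" by (cases k) auto
  ultimately show "x dvd 1" by simp
qed

text \<open>Gaussian elimination over a local ring. The rows and columns indexed by J are already
  those of the identity matrix; as long as two indices are left, the pivot can be made 1.\<close>
lemma SL_subset_if_transvections: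
  fixes \<pi> :: "'a::idom" and S :: "('a^'n^'n) set"
  assumes unif: "uniformizer \<pi>"
    and mult: "\<And>A B. A \<in> S \<Longrightarrow> B \<in> S \<Longrightarrow> A ** B \<in> S"
    and tv: "\<And>i j a. i \<noteq> j \<Longrightarrow> transvection i j a \<in> S"
    and two: "CARD('n) \<ge> 2"
  shows "SL \<subseteq> S"
proof -
  obtain i0 j0 :: 'n where "i0 \<noteq> j0"
    using two by (metis card_le_Suc0_iff_eq finite_class.finite_UNIV UNIV_I not_less_eq_eq numeral_2_eq_2)
  \<comment> \<open>\<open>S\<close> may contain matrices of other determinants, while the induction
    below needs determinant 1 after every clearing step; so products of transvections are tracked in
    \<open>S'\<close>.\<close>
  define S' where "S' = {A \<in> S. det A = 1}"
  have one: "mat 1 \<in> S'" using tv[of i0 j0 0] \<open>i0 \<noteq> j0\<close> by (simp add: S'_def)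
  have tv': "i \<noteq> j \<Longrightarrow> transvection i j a \<in> S'" for i j a
    using tv det_transvection by (auto simp: S'_def)
  have mult': "A \<in> S' \<Longrightarrow> B \<in> S' \<Longrightarrow> A ** B \<in> S'" for A B
    using mult by (auto simp: S'_def det_mul)
  have rtv: "A \<in> S" if "i \<noteq> j" "A ** transvection i j a \<in> S" for A i j a
  proof -
    have "A ** transvection i j a ** transvection i j (-a) \<in> S" using that mult tv by blast
    then show ?thesis using that(1) by (simp add: transvection_add flip: matrix_mul_assoc)
  qed
  \<comment> \<open>Transvections with the same row index o' do not interact, so one matrix with a
    whole row of parameters is a product of them; \<open>colm\<close> is the column version.\<close>
  have rowm: "(\<chi> k l. (if k = l then 1 else 0) + (if k = o' \<and> l \<in> L then v l else 0)) \<in> S'" (is "?R L \<in> S'")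
    if "o' \<notin> L" for o' :: 'n and L and v :: "'n \<Rightarrow> 'a"
  proof -
    have "finite L" by simp
    then show ?thesis using that
    proof (induction L)
      case empty
      have "?R {} = mat 1" by (rule matrix_eqI) (simp add: entry_simps)
      then show ?case using one by simp
    next
      case (insert l L)
      have "?R (insert l L) = ?R L ** transvection o' l (v l)"
        using insert by (intro matrix_eqI) (auto simp: entry_simps)
      then show ?case using insert mult' tv' by auto
    qed
  qed
  have colm: "(\<chi> k l. (if k = l then 1 else 0) + (if l = o' \<and> k \<in> L then v k else 0)) \<in> S'" (is "?C L \<in> S'")
    if "o' \<notin> L" for o' :: 'n and L and v :: "'n \<Rightarrow> 'a"
  proof -
    have "finite L" by simp
    then show ?thesis using that
    proof (induction L)
      case empty
      have "?C {} = mat 1" by (rule matrix_eqI) (simp add: entry_simps)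
      then show ?case using one by simp
    next
      case (insert l L)
      have "?C (insert l L) = transvection l o' (v l) ** ?C L"
        using insert by (intro matrix_eqI) (auto simp: entry_simps)
      then show ?case using insert mult' tv' by auto
    qed
  qed
  have main: "det A = 1 \<longrightarrow> (\<forall>k l. k \<in> J \<or> l \<in> J \<longrightarrow> A $ k $ l = (if k = l then 1 else 0)) \<longrightarrow> A \<in> S" for J A
  proof (induction "card (- J)" arbitrary: J A rule: less_induct)
    case less
    show ?case
    proof (intro impI)
      assume det: "det A = 1" and inv: "\<forall>k l. k \<in> J \<or> l \<in> J \<longrightarrow> A $ k $ l = (if k = l then 1 else 0)"
      show "A \<in> S"
      proof (cases "\<exists>o' j. o' \<notin> J \<and> j \<notin> J \<and> j \<noteq> o'")
        case True
        then obtain o' j where oj: "o' \<notin> J" "j \<notin> J" "j \<noteq> o'" by blast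
        \<comment> \<open>With the pivot equal to 1, \<open>C (-1)\<close> and \<open>R (-1)\<close>
          clear its column and its row at once, and the result agrees with the identity on one more
          index.\<close>
        have step3: "A \<in> S" if det: "det A = 1" 
          and inv: "\<forall>k l. k \<in> J \<or> l \<in> J \<longrightarrow> A $ k $ l = (if k = l then 1 else 0)"
          and oo: "A $ o' $ o' = 1" for A
        proof -
          define R where "R s = (\<chi> k l. (if k = l then 1 else 0) + (if k = o' \<and> l \<in> - {o'} then s * A $ o' $ l else 0))" for s
          define C where "C s = (\<chi> k l. (if k = l then 1 else 0) + (if l = o' \<and> k \<in> - {o'} then s * A $ k $ o' else 0))" for s
          have RS: "R s \<in> S'" and CS: "C s \<in> S'" for s
            unfolding R_def C_def by (rule rowm, simp, rule colm, simp)
          have R: "(M ** R s) $ k $ l = M $ k $ l + (if l = o' then 0 else M $ k $ o' * (s * A $ o' $ l))" for M s k l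
          proof -
            have "(M ** R s) $ k $ l = (\<Sum>m\<in>UNIV. (if m = l then M $ k $ m else 0) + (if m = o' then (if l = o' then 0 else M $ k $ m * (s * A $ o' $ l)) else 0))"
              unfolding matrix_mult_nth by (intro sum.cong) (auto simp: R_def algebra_simps)
            then show ?thesis by (simp add: sum.distrib)
          qed
          have C: "(C s ** M) $ k $ l = M $ k $ l + (if k = o' then 0 else s * A $ k $ o' * M $ o' $ l)" for M s k l
          proof -
            have "(C s ** M) $ k $ l = (\<Sum>m\<in>UNIV. (if m = k then M $ m $ l else 0) + (if m = o' then (if k = o' then 0 else s * A $ k $ o' * M $ m $ l) else 0))"
              unfolding matrix_mult_nth by (intro sum.cong) (auto simp: C_def algebra_simps)
            then show ?thesis by (simp add: sum.distrib)
          qed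
          define B where "B = C (-1) ** A ** R (-1)"
          have "C 1 ** C (-1) = mat 1"
            by (rule matrix_eqI) (auto simp: C mat_nth, auto simp: C_def)
          moreover have "R (-1) ** R 1 = mat 1"
            by (rule matrix_eqI) (auto simp: R mat_nth, auto simp: R_def)
          ultimately have A: "A = C 1 ** B ** R 1"
            unfolding B_def matrix_mul_assoc[symmetric] by (simp add: matrix_mul_assoc)
          have "det B = 1" using det RS CS by (simp add: B_def det_mul S'_def)
          moreover have "\<forall>k l. k \<in> insert o' J \<or> l \<in> insert o' J \<longrightarrow> B $ k $ l = (if k = l then 1 else 0)"
            using inv oo oj by (auto simp: B_def R C)
          moreover have "card (- insert o' J) < card (- J)"
            using oj(1) by (intro psubset_card_mono) auto
          ultimately have "B \<in> S" using less by blast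
          moreover have "C 1 \<in> S" "R 1 \<in> S" using RS[of 1] CS[of 1] by (auto simp: S'_def)
          ultimately show ?thesis using mult[OF mult[of "C 1" B], of "R 1"] \<open>B \<in> S\<close> by (subst A) blast
        qed
        \<comment> \<open>A unit beside the pivot position lets one column operation turn the entry
          (o',o') into 1 itself. This avoids rescaling by diagonal matrices, which are not among the
          generators.\<close>
        have step2: "A \<in> S" if det: "det A = 1" 
          and inv: "\<forall>k l. k \<in> J \<or> l \<in> J \<longrightarrow> A $ k $ l = (if k = l then 1 else 0)"
          and u: "A $ o' $ j dvd 1" for A
        proof -
          from u obtain v where v: "A $ o' $ j * v = 1" by (metis dvdE)
          have "A ** transvection j o' (v * (1 - A $ o' $ o')) \<in> S"
          proof (rule step3)
            show "det (A ** transvection j o' (v * (1 - A $ o' $ o'))) = 1"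
              using det oj by (simp add: det_mul det_transvection)
            show "\<forall>k l. k \<in> J \<or> l \<in> J \<longrightarrow> (A ** transvection j o' (v * (1 - A $ o' $ o'))) $ k $ l = (if k = l then 1 else 0)"
              using inv oj by (auto simp: entry_simps)
            show "(A ** transvection j o' (v * (1 - A $ o' $ o'))) $ o' $ o' = 1"
              using v by (simp add: entry_simps flip: mult.assoc)
          qed
          then show ?thesis using rtv oj(3) by blast
        qed
        show "A \<in> S"
        proof (cases "A $ o' $ j dvd 1")
          case True
          then show ?thesis using step2 det inv by blast
        next
          case False
          \<comment> \<open>Row o' contains a unit because the determinant is one. Adding its column
            to column j, whose entry is a non-unit, makes that entry a unit since R is
            local.\<close>
          have "\<not> \<pi> dvd det A" using det unif by (simp add: uniformizer_def)
          then obtain j' where j': "\<not> \<pi> dvd A $ o' $ j'" using dvd_det_row by blast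
          have jj: "j' \<noteq> j" using False j' uniformizer_unit_iff[OF unif] by auto
          have "j' \<notin> J" using j' inv oj by (metis dvd_0_right)
          have "A ** transvection j' j 1 \<in> S"
          proof (rule step2)
            show "det (A ** transvection j' j 1) = 1"
              using det jj by (simp add: det_mul det_transvection)
            show "\<forall>k l. k \<in> J \<or> l \<in> J \<longrightarrow> (A ** transvection j' j 1) $ k $ l = (if k = l then 1 else 0)"
              using inv oj \<open>j' \<notin> J\<close> by (auto simp: entry_simps)
            show "(A ** transvection j' j 1) $ o' $ j dvd 1"
              using False j' by (simp add: entry_simps uniformizer_unit_iff[OF unif] dvd_add_right_iff)
          qed
          then show ?thesis using rtv jj by blast
        qed
      next
        case False
        \<comment> \<open>At most one index is left outside J: the matrix is diagonal with at most
          one unknown entry, which the determinant fixes.\<close>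
        have diag: "A $ k $ l = 0" if "k \<noteq> l" for k l using False inv that by metis
        then have "(\<Prod>k\<in>UNIV. A $ k $ k) = 1" using det det_diagonal[of A] by metis
        have "A $ k $ k = 1" for k
        proof (cases "k \<in> J")
          case kJ: False
          have "(\<Prod>k\<in>UNIV. A $ k $ k) = A $ k $ k * (\<Prod>k\<in>UNIV - {k}. A $ k $ k)"
            by (rule prod.remove) auto
          also have "(\<Prod>k\<in>UNIV - {k}. A $ k $ k) = 1"
            using False kJ inv by (intro prod.neutral) (metis DiffD2 singletonI)
          finally show ?thesis using \<open>(\<Prod>k\<in>UNIV. A $ k $ k) = 1\<close> by simp
        qed (use inv in auto)
        then have "A = mat 1" using diag by (intro matrix_eqI) (auto simp: mat_nth)
        then show ?thesis using one by (simp add: S'_def)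
      qed
    qed
  qed
  show ?thesis using main[of _ "{}"] by (auto simp: SL_def)
qed


section \<open>The Teichmueller field of a complete discrete valuation ring of equal characteristic\<close>

locale equichar_cdvr =
  fixes \<pi> :: "'a::idom"
  assumes cdvr: "complete_dvr \<pi>"
    and eqchar: "equal_characteristic \<pi>"
    and fin_res: "finite (residue_field \<pi>)"
    and card_res: "card (residue_field \<pi>) > 9"
begin

section \<open>Divisibility by the uniformizer and residue classes\<close>

lemma unif: "uniformizer \<pi>"
  using cdvr by (simp add: complete_dvr_def)

lemma pi_nz: "\<pi> \<noteq> 0" and pi_ndvd_1: "\<not> \<pi> dvd 1"
  using unif by (auto simp: uniformizer_def)

lemmas unit_iff = uniformizer_unit_iff[OF unif]

lemma unit_ex: "\<not> \<pi> dvd x \<Longrightarrow> \<exists>y. x * y = 1"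
  using unit_iff by (metis dvdE)

lemma pi_prime: "\<pi> dvd x * y \<Longrightarrow> \<pi> dvd x \<or> \<pi> dvd y"
  unfolding unit_iff[symmetric, THEN arg_cong[where f = Not], simplified]
  using mult_dvd_mono[of x 1 y 1] unit_iff by auto

lemma pi_dvd_mult_iff: "\<pi> dvd x * y \<longleftrightarrow> \<pi> dvd x \<or> \<pi> dvd y"
  using pi_prime by auto

lemma pi_dvd_power: "\<pi> dvd x ^ n \<Longrightarrow> \<pi> dvd x"
  by (induction n) (use pi_ndvd_1 pi_prime in auto)

lemma separated: "(\<And>m. \<pi> ^ m dvd x) \<Longrightarrow> x = 0"
proof (rule ccontr)
  assume a: "\<And>m. \<pi> ^ m dvd x" "x \<noteq> 0"
  then obtain u k where u: "u dvd 1" "x = u * \<pi> ^ k" using unif by (auto simp: uniformizer_def)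
  have "\<pi> ^ k * \<pi> dvd \<pi> ^ k * u" using a(1)[of "Suc k"] u(2) by (simp add: mult.commute)
  then have "\<pi> dvd u" using pi_nz by simp
  then show False using u(1) unit_iff by blast
qed

definition res_class :: "'a \<Rightarrow> 'a set" where
  "res_class x = residue_rel \<pi> `` {x}"

lemma dvd_diff_sym: "(d::'a) dvd a - b \<Longrightarrow> d dvd b - a"
  by (metis dvd_minus_iff minus_diff_eq)

lemma res_class_eq_iff: "res_class x = res_class y \<longleftrightarrow> \<pi> dvd x - y"
proof -
  have "res_class x = {z. \<pi> dvd x - z}" for x by (auto simp: res_class_def residue_rel_def)
  moreover have "{z. \<pi> dvd x - z} = {z. \<pi> dvd y - z}" if "\<pi> dvd x - y"
    using dvd_diff_trans[OF that] dvd_diff_trans[OF dvd_diff_sym[OF that]] by blast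
  moreover have "\<pi> dvd x - y" if "{z. \<pi> dvd x - z} = {z. \<pi> dvd y - z}"
  proof -
    have "y \<in> {z. \<pi> dvd y - z}" by simp
    then show ?thesis using that by blast
  qed
  ultimately show ?thesis by auto
qed

lemma residue_field_eq: "residue_field \<pi> = range res_class"
  by (auto simp: residue_field_def quotient_def res_class_def)

text \<open>Two natural numbers collide in the finite residue field, so the residue characteristic
  is positive; equal characteristic carries this over to R, and a positive characteristic of a
  domain is prime.\<close>

lemma CHAR_prime: "prime CHAR('a)"
proof -
  have "\<not> inj (\<lambda>n::nat. res_class (of_nat n))"
  proof
    assume "inj (\<lambda>n::nat. res_class (of_nat n))"
    moreover have "range (\<lambda>n::nat. res_class (of_nat n)) \<subseteq> residue_field \<pi>" by (auto simp: residue_field_eq)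
    ultimately show False using fin_res finite_imageD finite_subset infinite_UNIV_nat by metis
  qed
  then obtain i j :: nat where "i < j" "res_class (of_nat i) = res_class (of_nat j)"
    by (metis injI linorder_neqE_nat)
  then have "j - i > 0" "\<pi> dvd of_nat (j - i)"
    by (auto simp: res_class_eq_iff of_nat_diff intro: dvd_diff_sym)
  then have "Gcd {n. \<pi> dvd (of_nat n :: 'a)} \<noteq> 0" by (metis (mono_tags) Gcd_0_iff mem_Collect_eq singletonD subsetD less_numeral_extra(3))
  then have "CHAR('a) > 0" using eqchar unfolding equal_characteristic_def residue_char_def by (metis gr0I)
  then show ?thesis by (rule prime_CHAR_semidom)
qed

text \<open>Pigeonhole on the iterates of Frobenius as self-maps of the finite residue field: two of
  them agree, and powers of Frobenius can be cancelled because they are injective modulo pi.\<close>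

lemma frobenius_ex: "\<exists>d>0. \<forall>x. \<pi> dvd x ^ (CHAR('a) ^ d) - x"
proof -
  define p where "p = CHAR('a)"
  define f where "f n = (\<lambda>c\<in>residue_field \<pi>. res_class ((SOME x. res_class x = c) ^ (p ^ n)))" for n
  have "range f \<subseteq> residue_field \<pi> \<rightarrow>\<^sub>E residue_field \<pi>" by (auto simp: f_def residue_field_eq)
  then have "finite (range f)" using fin_res finite_PiE finite_subset by metis
  then have "\<not> inj f" using finite_imageD infinite_UNIV_nat by blast
  then obtain m n where mn: "m < n" "f m = f n" by (metis injI linorder_neqE_nat)
  define d where "d = n - m"
  have "\<pi> dvd x ^ (p ^ d) - x" for x
  proof -
    define y where "y = (SOME y. res_class y = res_class x)"
    have y: "\<pi> dvd y - x" unfolding y_def by (metis (mono_tags) res_class_eq_iff someI)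
    have "res_class (y ^ (p ^ m)) = res_class (y ^ (p ^ n))"
      using fun_cong[OF mn(2), of "res_class x"] by (simp add: f_def y_def residue_field_eq)
    then have "\<pi> dvd y ^ (p ^ n) - y ^ (p ^ m)" by (metis res_class_eq_iff)
    also have "y ^ (p ^ n) = (y ^ (p ^ d)) ^ (p ^ m)"
      using mn(1) by (simp add: d_def flip: power_mult power_add)
    also have "(y ^ (p ^ d)) ^ (p ^ m) = (y ^ (p ^ d) - y) ^ (p ^ m) + y ^ (p ^ m)"
      using freshmans_dream'[OF CHAR_prime, of "p ^ m" m "y ^ (p ^ d) - y" y] by (simp add: p_def)
    finally have "\<pi> dvd y ^ (p ^ d) - y" using pi_dvd_power by auto
    moreover have "\<pi> dvd x ^ (p ^ d) - y ^ (p ^ d)"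
      using dvd_diff_sym[OF y] power_diff_sumr2[of x "p ^ d" y] by simp
    ultimately have "\<pi> dvd (x ^ (p ^ d) - y ^ (p ^ d)) + (y ^ (p ^ d) - y) + (y - x)" using y by (intro dvd_add) auto
    then show ?thesis by simp
  qed
  moreover have "d > 0" using mn by (simp add: d_def)
  ultimately show ?thesis by (auto simp: p_def)
qed

text \<open>A power of |k|, possibly larger than |k| itself, whose power map is trivial on the
  residue field.\<close>

definition Q :: nat where
  "Q = CHAR('a) ^ (SOME d. d > 0 \<and> (\<forall>x::'a. \<pi> dvd x ^ (CHAR('a) ^ d) - x))"

lemma Q_cong: "\<pi> dvd x ^ Q - x" and Q_ge_2: "Q \<ge> 2" and Q_eq: "\<exists>d. Q = CHAR('a) ^ d"
proof -
  define d where "d = (SOME d. d > 0 \<and> (\<forall>x::'a. \<pi> dvd x ^ (CHAR('a) ^ d) - x))"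
  have d: "d > 0 \<and> (\<forall>x::'a. \<pi> dvd x ^ (CHAR('a) ^ d) - x)"
    unfolding d_def by (rule someI_ex) (use frobenius_ex in blast)
  have "CHAR('a) ^ 1 \<le> CHAR('a) ^ d" using d prime_ge_2_nat[OF CHAR_prime] by (intro power_increasing) auto
  then show "Q \<ge> 2" using prime_ge_2_nat[OF CHAR_prime] by (simp add: Q_def flip: d_def)
  show "\<pi> dvd x ^ Q - x" using d by (simp add: Q_def flip: d_def)
  show "\<exists>d. Q = CHAR('a) ^ d" by (auto simp: Q_def)
qed

lemma frobenius_add: "(x + y :: 'a) ^ Q ^ n = x ^ Q ^ n + y ^ Q ^ n"
proof -
  obtain d where "Q = CHAR('a) ^ d" using Q_eq by blast
  then show ?thesis by (intro freshmans_dream'[OF CHAR_prime, of _ "d * n"]) (simp add: power_mult)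
qed

lemma frobenius_diff: "(x - y :: 'a) ^ Q ^ n = x ^ Q ^ n - y ^ Q ^ n"
  using frobenius_add[of "x - y" y n] by (simp add: algebra_simps)

text \<open>The Teichmueller representatives as fixed points of a power of Frobenius. In
  characteristic p that power is a ring endomorphism of R, so K is closed under addition and becomes
  a field.\<close>

definition K :: "'a set" where "K = {x. x ^ Q = x}"

lemma K_0: "0 \<in> K" and K_1: "1 \<in> K"
  using Q_ge_2 by (auto simp: K_def power_0_left)

lemma K_add: "x \<in> K \<Longrightarrow> y \<in> K \<Longrightarrow> x + y \<in> K"
  using frobenius_add[of x y 1] by (simp add: K_def)

lemma K_diff: "x \<in> K \<Longrightarrow> y \<in> K \<Longrightarrow> x - y \<in> K"
  using frobenius_diff[of x y 1] by (simp add: K_def)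

lemma K_uminus: "x \<in> K \<Longrightarrow> - x \<in> K"
  using K_diff[OF K_0] by simp

lemma K_mult: "x \<in> K \<Longrightarrow> y \<in> K \<Longrightarrow> x * y \<in> K"
  by (simp add: K_def power_mult_distrib)

lemma K_power: "x \<in> K \<Longrightarrow> x ^ n \<in> K"
  by (induction n) (auto intro: K_mult K_1)

lemma K_sum: "(\<And>i. i \<in> S \<Longrightarrow> f i \<in> K) \<Longrightarrow> sum f S \<in> K"
  by (induction S rule: infinite_finite_induct) (auto intro: K_add K_0)

lemma K_prod: "(\<And>i. i \<in> S \<Longrightarrow> f i \<in> K) \<Longrightarrow> prod f S \<in> K"
  by (induction S rule: infinite_finite_induct) (auto intro: K_mult K_1)

lemmas K_intros = K_0 K_1 K_add K_diff K_uminus K_mult K_power K_sum K_prod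

text \<open>Since $x^{Q-1} = 1$, this is the inverse on the nonzero elements of K.\<close>
definition K_inv :: "'a \<Rightarrow> 'a" where "K_inv x = x ^ (Q - 2)"

lemma K_inv_right: "x \<in> K \<Longrightarrow> x \<noteq> 0 \<Longrightarrow> x * K_inv x = 1"
proof -
  assume "x \<in> K" "x \<noteq> 0"
  have "x * (x * x ^ (Q - 2)) = x ^ (Suc (Suc (Q - 2)))" by simp
  also have "Suc (Suc (Q - 2)) = Q" using Q_ge_2 by simp
  also have "x ^ Q = x * 1" using \<open>x \<in> K\<close> by (simp add: K_def)
  finally show ?thesis unfolding K_inv_def mult_left_cancel[OF \<open>x \<noteq> 0\<close>] .
qed

lemma K_inv_mem: "x \<in> K \<Longrightarrow> K_inv x \<in> K"
  by (simp add: K_inv_def K_power)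

lemma K_inv_mult: "K_inv (x * y) = K_inv x * K_inv y"
  by (simp add: K_inv_def power_mult_distrib)

lemma K_inv_nz: "x \<in> K \<Longrightarrow> x \<noteq> 0 \<Longrightarrow> K_inv x \<noteq> 0"
  using K_inv_right by fastforce

lemma K_dvd_iff: "x \<in> K \<Longrightarrow> \<pi> dvd x \<longleftrightarrow> x = 0"
  using K_inv_right unit_iff by (metis dvd_0_right dvdI)

lemma K_cong_iff: "x \<in> K \<Longrightarrow> y \<in> K \<Longrightarrow> \<pi> dvd x - y \<longleftrightarrow> x = y"
  using K_dvd_iff[OF K_diff] by simp

text \<open>The representative is the limit of x^(Q^n): by additivity of Frobenius, consecutive
  terms differ by (x^Q - x)^(Q^n), and pi divides x^Q - x.\<close>

lemma teichmueller_ex: "\<exists>y\<in>K. \<pi> dvd y - x"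
proof -
  define s where "s n = x ^ Q ^ n" for n
  have Qn: "n \<le> Q ^ n" for n using Q_ge_2 power_gt_expt[of Q n] by simp
  have step: "\<pi> ^ Q ^ n dvd s (Suc n) - s n" for n
  proof -
    have "s (Suc n) - s n = (x ^ Q - x) ^ Q ^ n"
      by (simp add: s_def frobenius_diff flip: power_mult)
    then show ?thesis using Q_cong[of x] by (simp add: dvd_power_same)
  qed
  have tail: "\<pi> ^ n dvd s (n + k) - s n" for n k
  proof (induction k)
    case (Suc k)
    have "\<pi> ^ n dvd \<pi> ^ Q ^ (n + k)" using Qn[of "n + k"] by (intro le_imp_power_dvd) simp
    also note step
    finally have "\<pi> ^ n dvd (s (Suc (n + k)) - s (n + k)) + (s (n + k) - s n)"
      using Suc by (intro dvd_add)
    then show ?case by simp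
  qed simp
  have "padic_cauchy \<pi> s"
    unfolding padic_cauchy_def
  proof (intro allI exI impI)
    fix m i j :: nat assume "i \<ge> m" "j \<ge> m"
    then have "\<pi> ^ m dvd (s i - s m) - (s j - s m)"
      using dvd_diff[OF tail[of m "i - m"] tail[of m "j - m"]] by simp
    then show "\<pi> ^ m dvd s i - s j" by simp
  qed
  then obtain L where "padic_lim \<pi> s L" using cdvr by (auto simp: complete_dvr_def padic_complete_def)
  then have lim: "\<exists>N. \<forall>i\<ge>N. \<pi> ^ m dvd s i - L" for m by (auto simp: padic_lim_def)
  have "L ^ Q - L = 0"
  proof (rule separated)
    fix m
    obtain N where N: "\<And>i. i \<ge> N \<Longrightarrow> \<pi> ^ m dvd s i - L" using lim by blast
    have "\<pi> ^ m dvd s N ^ Q - L ^ Q" using N[of N] power_diff_sumr2[of "s N" Q L] by simp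
    also have "s N ^ Q = s (Suc N)" by (simp add: s_def mult.commute flip: power_mult)
    finally have "\<pi> ^ m dvd s (Suc N) - L ^ Q" .
    from dvd_diff[OF N[of "Suc N"] this] show "\<pi> ^ m dvd L ^ Q - L" by simp
  qed
  then have "L \<in> K" by (simp add: K_def)
  moreover have "\<pi> dvd L - x"
  proof -
    obtain N where N: "\<And>i. i \<ge> N \<Longrightarrow> \<pi> ^ 1 dvd s i - L" using lim by blast
    have "\<pi> ^ 1 dvd s (Suc N) - L" by (rule N) simp
    moreover have "\<pi> dvd s i - s 0" for i
    proof (induction i)
      case (Suc i)
      have "\<pi> dvd \<pi> ^ Q ^ i" using Q_ge_2 by (intro dvd_power) auto
      also note step
      finally have "\<pi> dvd (s (Suc i) - s i) + (s i - s 0)" using Suc by (intro dvd_add)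
      then show ?case by simp
    qed simp
    ultimately have "\<pi> dvd (s (Suc N) - s 0) - (s (Suc N) - L)" using dvd_diff[of \<pi> "s (Suc N) - s 0" "s (Suc N) - L"] by simp
    then show ?thesis by (simp add: s_def)
  qed
  ultimately show ?thesis by blast
qed

definition teich :: "'a \<Rightarrow> 'a" where "teich x = (SOME y. y \<in> K \<and> \<pi> dvd y - x)"

lemma teich_mem: "teich x \<in> K" and teich_cong: "\<pi> dvd teich x - x"
proof -
  have "teich x \<in> K \<and> \<pi> dvd teich x - x"
    unfolding teich_def by (rule someI_ex) (use teichmueller_ex in blast)
  then show "teich x \<in> K" "\<pi> dvd teich x - x" by auto
qed

lemma card_K: "card K > 9" and finite_K: "finite K"
proof -
  have "bij_betw res_class K (residue_field \<pi>)"
  proof (rule bij_betwI')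
    show "\<exists>x\<in>K. y = res_class x" if y: "y \<in> residue_field \<pi>" for y
    proof -
      obtain z where "y = res_class z" using y by (auto simp: residue_field_eq)
      then show ?thesis using teich_mem[of z] teich_cong[of z] res_class_eq_iff by metis
    qed
  qed (auto simp: res_class_eq_iff K_cong_iff residue_field_eq)
  then show "card K > 9" "finite K" using card_res fin_res bij_betw_same_card bij_betw_finite by metis+
qed

text \<open>Translation by 1 permutes K. Hence the number of nonzero elements of K is -1 in R, which
  makes the number of summands in the torus average invertible.\<close>

lemma of_nat_card_K: "of_nat (card K) = (0::'a)"
proof -
  have "(\<Sum>x\<in>K. x) = (\<Sum>x\<in>K. x + 1)"
    by (rule sum.reindex_bij_witness[of _ "\<lambda>x. x + 1" "\<lambda>x. x - 1"]) (auto intro: K_intros)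
  also have "\<dots> = (\<Sum>x\<in>K. x) + of_nat (card K)" by (simp add: sum.distrib)
  finally show ?thesis by simp
qed

text \<open>The form in which |k| > 9 is exploited; degree 9 is attained in
  \<open>inverse_square_weight_zero\<close>.\<close>

lemma K_nonroot:
  assumes "p \<noteq> 0" "degree p \<le> 9"
  shows "\<exists>x\<in>K. poly p x \<noteq> 0"
proof (rule ccontr)
  assume "\<not> ?thesis"
  then have "K \<subseteq> {x. poly p x = 0}" by auto
  then have "card K \<le> card {x. poly p x = 0}" using poly_roots_finite[OF assms(1)] by (intro card_mono) auto
  also have "\<dots> \<le> degree p" using assms by (intro card_poly_roots_bound)
  finally show False using card_K assms by simp
qed

text \<open>The excluded values are the torus weights that occur below: t^2 mostly for the rank-one
  torus of a root, t^3 for the torus element of \<open>K_tori_three\<close>.\<close>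

lemma K_generic: "\<exists>t\<in>K. t \<noteq> 0 \<and> t ^ 2 \<noteq> 1 \<and> t ^ 3 \<noteq> 1"
proof -
  define p where "p = [:0, 1:] * [:-1, 0, 1:] * [:-1, 0, 0, 1::'a:]"
  have "p \<noteq> 0" unfolding p_def by simp
  moreover have "degree p \<le> 9" unfolding p_def by (simp add: degree_mult_eq)
  ultimately obtain x where "x \<in> K" "poly p x \<noteq> 0" using K_nonroot by blast
  then show ?thesis by (intro bexI[of _ x]) (auto simp: p_def power2_eq_square power3_eq_cube algebra_simps)
qed

text \<open>In odd characteristic $2r = (r+1)^2 - r^2 - 1$; in characteristic 2 every element of K is a square.\<close>
lemma square_multiples:
  assumes sub: "\<And>x y. x \<in> S \<Longrightarrow> y \<in> S \<Longrightarrow> x - y \<in> S"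
    and cong: "\<And>x y. x \<in> S \<Longrightarrow> \<pi> dvd x - y \<Longrightarrow> y \<in> S"
    and sq: "\<And>t. t \<in> K \<Longrightarrow> c * t ^ 2 \<in> S"
  shows "c * r \<in> S"
proof (cases "CHAR('a) = 2")
  case True
  obtain d where d: "Q = 2 ^ d" using Q_eq True by auto
  then have "d > 0" using Q_ge_2 by (cases d) auto
  \<comment> \<open>The exponent is Q / 2, so the square of t is the Q-th power of an element of K,
    that is, the element itself.\<close>
  define t where "t = teich r ^ (2 ^ (d - 1))"
  have "t ^ 2 = teich r ^ (2 ^ d)" using \<open>d > 0\<close> by (simp add: t_def flip: power_mult power_Suc2)
  also have "\<dots> = teich r" using teich_mem[of r] d by (simp add: K_def)
  finally have "c * teich r \<in> S" using sq[of t] teich_mem by (simp add: t_def K_power)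
  then show ?thesis by (rule cong) (use teich_cong[of r] in \<open>simp flip: right_diff_distrib\<close>)
next
  case False
  have "of_nat 2 \<noteq> (0::'a)" 
    using False prime_ge_2_nat[OF CHAR_prime] by (metis of_nat_eq_0_iff_char_dvd dvd_imp_le zero_less_numeral le_antisym)
  then have two: "(2::'a) \<noteq> 0" by simp
  have K2: "(2::'a) \<in> K" using K_add[OF K_1 K_1] by simp
  define u where "u = teich r * K_inv 2"
  have uK: "u \<in> K" "2 * u = teich r"
    using K_inv_right[OF K2 two] K_inv_mem[OF K2] teich_mem by (auto simp: u_def K_mult mult.left_commute)
  have "c * (u + 1) ^ 2 - c * u ^ 2 - c * 1 ^ 2 \<in> S" using uK by (intro sub sq K_intros)
  moreover have "c * (u + 1) ^ 2 - c * u ^ 2 - c * 1 ^ 2 = c * (2 * u)"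
    by (simp add: algebra_simps power2_eq_square)
  ultimately have "c * teich r \<in> S" using uK(2) by simp
  then show ?thesis by (rule cong) (use teich_cong[of r] in \<open>simp flip: right_diff_distrib\<close>)
qed

end


section \<open>Congruence filtration\<close>

lemma prod_one_plus_cong:
  fixes d :: "'a::comm_ring_1"
  assumes "finite S"
  shows "d\<^sup>2 dvd (\<Prod>i\<in>S. 1 + d * f i) - (1 + d * (\<Sum>i\<in>S. f i))"
  using assms
proof (induction S)
  case (insert x F)
  have "(\<Prod>i\<in>insert x F. 1 + d * f i) - (1 + d * (\<Sum>i\<in>insert x F. f i))
      = (1 + d * f x) * ((\<Prod>i\<in>F. 1 + d * f i) - (1 + d * (\<Sum>i\<in>F. f i))) + d\<^sup>2 * (f x * (\<Sum>i\<in>F. f i))"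
    using insert by (simp add: algebra_simps power2_eq_square)
  then show ?case using insert by (auto intro: dvd_add)
qed simp

text \<open>The derivative of the determinant at the identity is the trace: a permutation other than
  the identity moves some i and also p i, so its product contains two off-diagonal entries, each
  divisible by d.\<close>

lemma det_one_plus_cong:
  fixes X :: "'a::comm_ring_1^'n^'n"
  shows "d\<^sup>2 dvd det (mat 1 + smul d X) - (1 + d * trace X)"
proof -
  define A where "A = mat 1 + smul d X"
  define P where "P = {p :: 'n \<Rightarrow> 'n. p permutes UNIV}"
  have fin: "finite P" by (simp add: P_def finite_permutations)
  have id: "id \<in> P" by (simp add: P_def permutes_id)
  have "det A = (\<Prod>i\<in>UNIV. A $ i $ i) + (\<Sum>p\<in>P - {id}. of_int (sign p) * (\<Prod>i\<in>UNIV. A $ i $ p i))"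
    unfolding det_def P_def[symmetric] by (subst sum.remove[OF fin id]) (simp add: sign_id)
  moreover have "d\<^sup>2 dvd (\<Sum>p\<in>P - {id}. of_int (sign p) * (\<Prod>i\<in>UNIV. A $ i $ p i))"
  proof (intro dvd_sum dvd_mult)
    fix p assume p: "p \<in> P - {id}"
    then obtain i where i: "p i \<noteq> i" by (metis DiffD2 eq_id_iff singletonI)
    have ppi: "p (p i) \<noteq> p i" using p i by (auto simp: P_def dest: permutes_inj injD)
    have "(\<Prod>i\<in>UNIV. A $ i $ p i) = A $ i $ p i * (A $ (p i) $ p (p i) * (\<Prod>i\<in>UNIV - {i} - {p i}. A $ i $ p i))"
      using i by (subst prod.remove[of _ i], simp, simp, subst prod.remove[of _ "p i"]) auto
    moreover have "d dvd A $ i $ p i" "d dvd A $ (p i) $ p (p i)"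
      using i ppi by (auto simp: A_def mat_nth)
    ultimately show "d\<^sup>2 dvd (\<Prod>i\<in>UNIV. A $ i $ p i)"
      by (simp add: power2_eq_square mult.assoc[symmetric] mult_dvd_mono dvd_mult2)
  qed
  moreover have "(\<Prod>i\<in>UNIV. A $ i $ i) = (\<Prod>i\<in>UNIV. 1 + d * X $ i $ i)" by (simp add: A_def mat_nth)
  ultimately have "det A - (1 + d * trace X) = ((\<Prod>i\<in>UNIV. 1 + d * X $ i $ i) - (1 + d * (\<Sum>i\<in>UNIV. X $ i $ i)))
      + (\<Sum>p\<in>P - {id}. of_int (sign p) * (\<Prod>i\<in>UNIV. A $ i $ p i))"
    by (simp only: trace_def) (simp only: algebra_simps)
  moreover have "d\<^sup>2 dvd \<dots>"
    using prod_one_plus_cong[of UNIV d "\<lambda>i. X $ i $ i"]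
      \<open>d\<^sup>2 dvd (\<Sum>p\<in>P - {id}. of_int (sign p) * (\<Prod>i\<in>UNIV. A $ i $ p i))\<close>
    by (intro dvd_add) auto
  ultimately have "d\<^sup>2 dvd det A - (1 + d * trace X)" by (simp only:)
  then show ?thesis by (simp only: A_def)
qed

lemma matrix_smul_mat: "mat c = smul c (mat 1)"
  by (rule matrix_eqI) (simp add: mat_nth)

lemma mat_commute: "mat c ** A = smul c A" "A ** mat c = smul c A"
  by (subst matrix_smul_mat, simp add: smul_mult_left smul_mult_right)+

lemma right_inverse_cong:
  assumes "A' ** A = mat 1" "B ** B' = mat 1" "mcong d B A"
  shows "mcong d B' A'"
proof -
  have "B' = A' ** A ** B'" using assms by simp
  also have "mcong d \<dots> (A' ** B ** B')" 
    by (intro mcong_mult mcong_refl mcong_sym[OF assms(3)])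
  also have "\<dots> = A'" using assms by (simp add: matrix_mul_assoc[symmetric])
  finally show ?thesis .
qed

text \<open>For \<open>t * u = 1\<close> this is the coroot of (i,j) evaluated at t; conjugation by
  it multiplies the entry (i,j) by t^2 and the entry (j,i) by u^2. The inverse is a separate
  argument since R has no division.\<close>

definition torus :: "'n \<Rightarrow> 'n \<Rightarrow> 'a \<Rightarrow> 'a \<Rightarrow> 'a::comm_ring_1^'n^'n" where
  "torus i j t u = diag_matrix (\<lambda>k. if k = i then t else if k = j then u else 1)"

lemma torus_inverse: "i \<noteq> j \<Longrightarrow> t * u = 1 \<Longrightarrow> torus i j t u ** torus i j u t = mat 1"
  by (rule matrix_eqI) (auto simp: torus_def entry_simps mult.commute)

lemma prod_two: 
  fixes t u :: "'a::comm_monoid_mult" and i j :: "'n::finite"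
  shows "i \<noteq> j \<Longrightarrow> (\<Prod>k\<in>UNIV. if k = i then t else if k = j then u else 1) = t * u"
  by (subst prod.remove[of _ i], simp, simp, subst prod.remove[of _ j]) (auto intro!: prod.neutral)

lemma det_torus: "i \<noteq> j \<Longrightarrow> t * u = 1 \<Longrightarrow> det (torus i j t u) = 1"
  by (simp add: torus_def det_diag_matrix prod_two)

lemma CARD_ge_2_other: "CARD('n::finite) \<ge> 2 \<Longrightarrow> \<exists>j. j \<noteq> (i::'n)"
  by (metis card_le_Suc0_iff_eq finite_class.finite_UNIV UNIV_I not_less_eq_eq numeral_2_eq_2)

context equichar_cdvr
begin

section \<open>Additive groups of matrices stable under conjugation by SL_n\<close>

definition scalar_mod :: "'a^'n^'n \<Rightarrow> bool" where
  "scalar_mod X \<longleftrightarrow> (\<forall>i j. i \<noteq> j \<longrightarrow> \<pi> dvd X $ i $ j \<and> \<pi> dvd X $ i $ i - X $ j $ j)"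

text \<open>Only differences of group conjugates occur, no Lie brackets, so that every
  characteristic is covered, including p dividing n and n = p = 2. Once a unit multiple of one
  elementary matrix lies in \<open>L\<close>, the torus yields all its multiples and transvections
  carry it to all positions.\<close>

lemma full_if_nonscalar:
  fixes L :: "('a^'n^'n) set"
  assumes two: "CARD('n) \<ge> 2"
    and diff: "\<And>X Y. X \<in> L \<Longrightarrow> Y \<in> L \<Longrightarrow> X - Y \<in> L"
    and cong: "\<And>X Y. X \<in> L \<Longrightarrow> mcong \<pi> X Y \<Longrightarrow> Y \<in> L"
    and ad: "\<And>A A' X. A ** A' = mat 1 \<Longrightarrow> A' ** A = mat 1 \<Longrightarrow> det A = 1 \<Longrightarrow> X \<in> L \<Longrightarrow> A ** X ** A' \<in> L"
    and X: "X \<in> L" "\<not> scalar_mod X"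
    and Y: "\<pi> dvd trace Y"
  shows "Y \<in> L"
proof -
  have zero: "0 \<in> L" using diff[OF X(1) X(1)] by simp
  have uminus: "- X \<in> L" if "X \<in> L" for X using diff[OF zero that] by simp
  have add: "X + Y \<in> L" if "X \<in> L" "Y \<in> L" for X Y using diff[OF that(1) uminus[OF that(2)]] by simp
  have tvL: "transvection i j a ** X ** transvection i j (-a) - X \<in> L" if "X \<in> L" "i \<noteq> j" for X i j a
    using that by (intro diff ad) (auto simp: transvection_add det_transvection)
  have tor: "torus i j t u ** X ** torus i j u t \<in> L" if "X \<in> L" "i \<noteq> j" "t * u = 1" for X i j t u
    using that by (intro ad) (auto simp: torus_inverse det_torus mult.commute)
  obtain t where t: "t \<in> K" "t \<noteq> 0" "t\<^sup>2 \<noteq> 1" using K_generic by blast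
  define u where "u = K_inv t"
  have u: "u \<in> K" "t * u = 1" using t by (auto simp: u_def K_inv_mem K_inv_right)
  have t2: "\<not> \<pi> dvd t\<^sup>2 - 1" using K_cong_iff[of "t\<^sup>2" 1] t by (auto intro: K_intros)
  have u2: "\<not> \<pi> dvd u\<^sup>2 - 1"
  proof
    assume "\<pi> dvd u\<^sup>2 - 1"
    then have "u\<^sup>2 = 1" using K_cong_iff[of "u\<^sup>2" 1] u by (auto intro: K_intros)
    moreover have "t\<^sup>2 * u\<^sup>2 = 1" using u by (simp flip: power_mult_distrib)
    ultimately show False using t by simp
  qed
  have t0: "\<not> \<pi> dvd t" using t K_dvd_iff by blast
  have t1: "\<not> \<pi> dvd 1 - t" using t K_cong_iff[of 1 t] K_1 by auto
  define full where "full i j \<longleftrightarrow> (\<forall>r. smul r (elem_mat i j) \<in> L)" for i j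
  \<comment> \<open>The torus changes the coefficient by squares only;
    \<open>square_multiples\<close> passes from squares to all multiples.\<close>
  have fullI: "full i j" if c: "smul c (elem_mat i j) \<in> L" "\<not> \<pi> dvd c" "i \<noteq> j" for c i j
  proof -
    have all: "c * r \<in> {c. smul c (elem_mat i j) \<in> L}" for r
    proof (rule square_multiples)
      fix x y assume "x \<in> {c. smul c (elem_mat i j) \<in> L}" "y \<in> {c. smul c (elem_mat i j) \<in> L}"
      then have "smul x (elem_mat i j) - smul y (elem_mat i j) \<in> L" by (intro diff) auto
      moreover have "smul x (elem_mat i j) - smul y (elem_mat i j) = smul (x - y) (elem_mat i j)"
        by (rule matrix_eqI) (simp add: algebra_simps)
      ultimately show "x - y \<in> {c. smul c (elem_mat i j) \<in> L}" by simp
    next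
      fix x y assume "x \<in> {c. smul c (elem_mat i j) \<in> L}" "\<pi> dvd x - y"
      then show "y \<in> {c. smul c (elem_mat i j) \<in> L}"
        by (auto elim!: cong simp: mcong_def elem_mat_nth)
    next
      fix s assume s: "s \<in> K"
      show "c * s\<^sup>2 \<in> {c. smul c (elem_mat i j) \<in> L}"
      proof (cases "s = 0")
        case True
        have "smul 0 (elem_mat i j) = (0 :: 'a^'n^'n)" by (rule matrix_eqI) simp
        then show ?thesis using True zero by simp
      next
        case False
        have "torus i j s (K_inv s) ** smul c (elem_mat i j) ** torus i j (K_inv s) s \<in> L"
          using tor c(1,3) K_inv_right[OF s False] by blast
        also have "torus i j s (K_inv s) ** smul c (elem_mat i j) ** torus i j (K_inv s) s = smul (c * s\<^sup>2) (elem_mat i j)"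
          using c(3) by (intro matrix_eqI) (auto simp: torus_def entry_simps power2_eq_square)
        finally show ?thesis by simp
      qed
    qed
    obtain c' where c': "c * c' = 1" using unit_ex c(2) by blast
    show ?thesis unfolding full_def using all[of "c' * r" for r] c' by (simp flip: mult.assoc)
  qed
  have "\<exists>i j c. i \<noteq> j \<and> \<not> \<pi> dvd c \<and> smul c (elem_mat i j) \<in> L"
  proof (cases "\<forall>i j. i \<noteq> j \<longrightarrow> \<pi> dvd X $ i $ j")
    case True
    then obtain i j where ij: "i \<noteq> j" "\<not> \<pi> dvd X $ i $ i - X $ j $ j" using X(2) by (auto simp: scalar_mod_def)
    \<comment> \<open>X is diagonal modulo pi here, and conjugation by x_ij(1) then changes only the
      entry (i,j), by the difference of two diagonal entries.\<close>
    have "smul (X $ j $ j - X $ i $ i) (elem_mat i j) \<in> L"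
    proof (rule cong)
      show "transvection i j 1 ** X ** transvection i j (-1) - X \<in> L" using tvL X ij by blast
      show "mcong \<pi> (transvection i j 1 ** X ** transvection i j (-1) - X) (smul (X $ j $ j - X $ i $ i) (elem_mat i j))"
        using True ij by (intro mcongI) (auto simp: entry_simps)
    qed
    moreover have "\<not> \<pi> dvd X $ j $ j - X $ i $ i" using ij(2) dvd_diff_sym by blast
    ultimately show ?thesis using ij by blast
  next
    case False
    then obtain i j where ij: "j \<noteq> i" "\<not> \<pi> dvd X $ j $ i" by blast
    show ?thesis
    proof (cases "\<exists>l. l \<noteq> i \<and> l \<noteq> j")
      case True
      then obtain l where l: "l \<noteq> i" "l \<noteq> j" by blast
      \<comment> \<open>Each difference with a conjugate strips entries: W lives in row i and column
        j, V in two entries of row i, and U is the single entry x_ji moved to (i,j). The third index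
        l is what makes this possible.\<close>
      define W where "W = transvection i j 1 ** X ** transvection i j (-1) - X"
      define V where "V = transvection i l 1 ** W ** transvection i l (-1) - W"
      define U where "U = transvection l j 1 ** V ** transvection l j (-1) - V"
      have "U \<in> L" unfolding U_def V_def W_def using ij l X by (intro tvL) auto
      moreover have W: "W $ a $ b = (if a = i then X $ j $ b else 0) - (if b = j then X $ a $ i else 0) - (if a = i \<and> b = j then X $ j $ i else 0)" for a b
        by (simp add: W_def entry_simps)
      have V: "V $ a $ b = (if a = i \<and> b = j then - X $ l $ i else 0) - (if a = i \<and> b = l then X $ j $ i else 0)" for a b
        using ij l by (simp add: V_def entry_simps W)
      have "U = smul (X $ j $ i) (elem_mat i j)"
        using ij l by (intro matrix_eqI) (simp add: U_def entry_simps V)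
      ultimately show ?thesis using ij by metis
    next
      case False
      then have UN: "a = i \<or> a = j" for a by blast
      \<comment> \<open>For n = 2 the entry (j,i) of W is 0 and the torus fixes its diagonal. The
        torus difference keeps only the entry (i,j), which is t^2 - 1 times a quadratic in
        a.\<close>
      have L: "smul ((t\<^sup>2 - 1) * (a * (X $ j $ j - X $ i $ i) - a\<^sup>2 * X $ j $ i)) (elem_mat i j) \<in> L" for a
      proof -
        define W where "W = transvection i j a ** X ** transvection i j (-a) - X"
        have "W \<in> L" unfolding W_def using ij X by (intro tvL) auto
        then have "torus i j t u ** W ** torus i j u t - W \<in> L" using tor ij u by (intro diff) auto
        also have "torus i j t u ** W ** torus i j u t - W = smul ((t\<^sup>2 - 1) * (a * (X $ j $ j - X $ i $ i) - a\<^sup>2 * X $ j $ i)) (elem_mat i j)"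
        proof (rule matrix_eqI)
          fix k l
          have [simp]: "t * u = 1" "u * t = 1" using u by (simp_all add: mult.commute)
          then have [simp]: "t * x * u = x" "u * x * t = x" for x 
            by (metis mult.commute mult.left_commute mult_1)+
          show "(torus i j t u ** W ** torus i j u t - W) $ k $ l = smul ((t\<^sup>2 - 1) * (a * (X $ j $ j - X $ i $ i) - a\<^sup>2 * X $ j $ i)) (elem_mat i j) $ k $ l"
            using UN[of k] UN[of l] ij 
            by (auto simp: torus_def entry_simps W_def power2_eq_square) (auto simp: algebra_simps)
        qed
        finally show ?thesis .
      qed
      \<comment> \<open>The leading coefficient of the quadratic is the unit x_ji up to sign, and t
        and 1 - t are units too, so it cannot vanish modulo pi both at a = 1 and at a = t.\<close>
      show ?thesis
      proof (cases "\<pi> dvd X $ j $ j - X $ i $ i - X $ j $ i")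
        case True
        have "\<not> \<pi> dvd (t\<^sup>2 - 1) * (t * (X $ j $ j - X $ i $ i) - t\<^sup>2 * X $ j $ i)"
        proof
          assume "\<pi> dvd (t\<^sup>2 - 1) * (t * (X $ j $ j - X $ i $ i) - t\<^sup>2 * X $ j $ i)"
          then have "\<pi> dvd t * (X $ j $ j - X $ i $ i) - t\<^sup>2 * X $ j $ i" using t2 pi_prime by blast
          then have "\<pi> dvd t * (X $ j $ j - X $ i $ i) - t\<^sup>2 * X $ j $ i - t * (X $ j $ j - X $ i $ i - X $ j $ i)"
            by (rule dvd_diff) (use True in simp)
          also have "\<dots> = t * ((1 - t) * X $ j $ i)" by (simp add: algebra_simps power2_eq_square)
          finally show False using t0 t1 ij by (simp add: pi_dvd_mult_iff)
        qed
        then show ?thesis using L ij by metis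
      next
        case False
        then have "\<not> \<pi> dvd (t\<^sup>2 - 1) * (1 * (X $ j $ j - X $ i $ i) - 1\<^sup>2 * X $ j $ i)"
          using t2 by (simp add: pi_dvd_mult_iff)
        then show ?thesis using L ij by metis
      qed
    qed
  qed
  then obtain i0 j0 where ij0: "i0 \<noteq> j0" "full i0 j0" using fullI by blast
  have flip: "full j i" if ij: "i \<noteq> j" "full i j" for i j
  proof (rule fullI)
    \<comment> \<open>Z equals E_jj - E_ii - E_ji, and the torus difference removes its diagonal
      part.\<close>
    define Z :: "'a^'n^'n" where "Z = transvection j i 1 ** smul 1 (elem_mat i j) ** transvection j i (-1) - smul 1 (elem_mat i j)"
    have "Z \<in> L" unfolding Z_def using ij by (intro tvL) (auto simp: full_def simp del: smul_one)
    then have "torus i j t u ** Z ** torus i j u t - Z \<in> L" using tor ij u by (intro diff) auto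
    also have "torus i j t u ** Z ** torus i j u t - Z = smul (-(u\<^sup>2 - 1)) (elem_mat j i)"
    proof (rule matrix_eqI)
      fix k l
      have [simp]: "t * u = 1" "u * t = 1" using u by (simp_all add: mult.commute)
      show "(torus i j t u ** Z ** torus i j u t - Z) $ k $ l = smul (-(u\<^sup>2 - 1)) (elem_mat j i) $ k $ l"
        using ij(1) by (auto simp: torus_def entry_simps Z_def power2_eq_square)
    qed
    finally show "smul (-(u\<^sup>2 - 1)) (elem_mat j i) \<in> L" .
    show "\<not> \<pi> dvd -(u\<^sup>2 - 1)" using u2 by (metis dvd_minus_iff)
  qed (use ij in auto)
  have right: "full i l" if ij: "i \<noteq> j" "full i j" "l \<noteq> i" "l \<noteq> j" for i j l
    unfolding full_def
  proof
    fix r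
    have "transvection j l 1 ** smul (-r) (elem_mat i j) ** transvection j l (-1) - smul (-r) (elem_mat i j) \<in> L"
      using ij by (intro tvL) (auto simp: full_def)
    also have "transvection j l 1 ** smul (-r) (elem_mat i j) ** transvection j l (-1) - smul (-r) (elem_mat i j) = smul r (elem_mat i l)"
      using ij by (intro matrix_eqI) (auto simp: entry_simps)
    finally show "smul r (elem_mat i l) \<in> L" .
  qed
  have left: "full l j" if ij: "i \<noteq> j" "full i j" "l \<noteq> i" "l \<noteq> j" for i j l
    unfolding full_def
  proof
    fix r
    have "transvection l i 1 ** smul r (elem_mat i j) ** transvection l i (-1) - smul r (elem_mat i j) \<in> L"
      using ij by (intro tvL) (auto simp: full_def)
    also have "transvection l i 1 ** smul r (elem_mat i j) ** transvection l i (-1) - smul r (elem_mat i j) = smul r (elem_mat l j)"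
      using ij by (intro matrix_eqI) (auto simp: entry_simps)
    finally show "smul r (elem_mat l j) \<in> L" .
  qed
  have all: "full k l" if "k \<noteq> l" for k l
  proof -
    have "full k j \<or> full k i" if "full i j" "i \<noteq> j" for i j
      using flip left that by metis
    then obtain m where "full k m" "m \<noteq> k" using ij0 flip left by metis
    then show ?thesis using right that by metis
  qed
  have diag: "smul r (elem_mat i i - elem_mat j j) \<in> L" if "i \<noteq> j" for i j r
  proof -
    have "(transvection i j 1 ** smul r (elem_mat j i) ** transvection i j (-1) - smul r (elem_mat j i)) + smul r (elem_mat i j) \<in> L"
      using that all by (intro add tvL) (auto simp: full_def)
    also have "(transvection i j 1 ** smul r (elem_mat j i) ** transvection i j (-1) - smul r (elem_mat j i)) + smul r (elem_mat i j) = smul r (elem_mat i i - elem_mat j j)"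
      using that by (intro matrix_eqI) (auto simp: entry_simps)
    finally show ?thesis .
  qed
  have sum: "sum f S \<in> L" if "\<And>i. i \<in> S \<Longrightarrow> f i \<in> L" for f and S :: "'n set"
    using that by (induction S rule: infinite_finite_induct) (auto intro: add zero)
  \<comment> \<open>Y is expanded in the E_ij and the differences of E_ii and the diagonal
    elementary matrix at i0. Only the entry (i0,i0) comes out wrong, by trace Y, which vanishes
    modulo pi.\<close>
  define T where "T i j = (if i \<noteq> j then smul (Y $ i $ j) (elem_mat i j) else if i = i0 then 0 else smul (Y $ i $ i) (elem_mat i i - elem_mat i0 i0))" for i j
  have "(\<Sum>i\<in>UNIV. \<Sum>j\<in>UNIV. T i j) \<in> L"
    by (intro sum) (use all diag zero in \<open>auto simp: T_def full_def\<close>)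
  then show "Y \<in> L"
  proof (rule cong)
    show "mcong \<pi> (\<Sum>i\<in>UNIV. \<Sum>j\<in>UNIV. T i j) Y"
    proof (rule mcongI)
      fix k l
      have e: "(\<Sum>i\<in>UNIV. \<Sum>j\<in>UNIV. T i j) $ k $ l = (\<Sum>i\<in>UNIV. \<Sum>j\<in>UNIV. T i j $ k $ l)"
        by simp
      show "\<pi> dvd (\<Sum>i\<in>UNIV. \<Sum>j\<in>UNIV. T i j) $ k $ l - Y $ k $ l"
      proof (cases "k = i0 \<and> l = i0")
        case False
        then have "T i j $ k $ l = (if i = k then if j = l then Y $ k $ l else 0 else 0)" for i j
          by (auto simp: T_def entry_simps)
        then have "(\<Sum>i\<in>UNIV. \<Sum>j\<in>UNIV. T i j $ k $ l) = (\<Sum>i\<in>UNIV. if i = k then \<Sum>j\<in>UNIV. if j = l then Y $ k $ l else 0 else 0)"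
          by (intro sum.cong) auto
        then show ?thesis using e by simp
      next
        case True
        then have "T i j $ k $ l = (if j = i then if i = i0 then 0 else - Y $ i $ i else 0)" for i j
          by (auto simp: T_def entry_simps)
        then have "(\<Sum>i\<in>UNIV. \<Sum>j\<in>UNIV. T i j $ k $ l) = (\<Sum>i\<in>UNIV. if i = i0 then 0 else - Y $ i $ i)"
          by simp
        also have "\<dots> = (\<Sum>i\<in>UNIV - {i0}. - Y $ i $ i)"
          by (subst sum.remove[of _ i0]) (auto intro!: sum.cong)
        also have "\<dots> = Y $ i0 $ i0 - trace Y"
          by (simp add: trace_def sum.remove[of UNIV i0] sum_negf)
        finally show ?thesis using e True Y by simp
      qed
    qed
  qed
qed

end


section \<open>The congruence filtration of a group that reduces onto SL_n(k)\<close>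

locale residually_full_group = equichar_cdvr \<pi> for \<pi> :: "'a::idom" +
  fixes D :: "('a^'n^'n) set"
  assumes two: "CARD('n) \<ge> 2"
    and mult: "\<And>g h. g \<in> D \<Longrightarrow> h \<in> D \<Longrightarrow> g ** h \<in> D"
    and inv: "\<And>g. g \<in> D \<Longrightarrow> \<exists>g'\<in>D. g ** g' = mat 1 \<and> g' ** g = mat 1"
    and det_1: "\<And>g. g \<in> D \<Longrightarrow> det g = 1"
    and residual: "\<And>M. det M = 1 \<Longrightarrow> \<exists>h\<in>D. mcong \<pi> h M"
begin

text \<open>This is L_m of the overview, pulled back to matrices over R and hence a union of classes
  modulo pi (\<open>level_cong\<close>). Its additive structure is established for m at least
  1.\<close>

definition level :: "nat \<Rightarrow> ('a^'n^'n) set" where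
  "level m = {X. \<exists>h\<in>D. mcong (\<pi> ^ Suc m) h (mat 1 + smul (\<pi> ^ m) X)}"

lemma level_cong: "X \<in> level m \<Longrightarrow> mcong \<pi> X Y \<Longrightarrow> Y \<in> level m"
proof -
  assume "X \<in> level m" "mcong \<pi> X Y"
  moreover from this(2) have "mcong (\<pi> ^ Suc m) (mat 1 + smul (\<pi> ^ m) X) (mat 1 + smul (\<pi> ^ m) Y)"
    using mcong_smul_scale[of \<pi> X Y "\<pi> ^ m"] by (intro mcong_add) (auto simp: mult.commute)
  ultimately show ?thesis unfolding level_def using mcong_trans by blast
qed

lemma levelI: "h \<in> D \<Longrightarrow> h = mat 1 + smul (\<pi> ^ m) A \<Longrightarrow> mcong \<pi> A X \<Longrightarrow> X \<in> level m"
proof -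
  assume h: "h \<in> D" "h = mat 1 + smul (\<pi> ^ m) A" "mcong \<pi> A X"
  then have "A \<in> level m" unfolding level_def by (auto intro!: bexI[of _ h])
  then show ?thesis using h(3) level_cong by blast
qed

lemma levelE:
  assumes "X \<in> level m"
  obtains h A where "h \<in> D" "h = mat 1 + smul (\<pi> ^ m) A" "mcong \<pi> A X"
proof -
  obtain h where h: "h \<in> D" "mcong (\<pi> ^ Suc m) h (mat 1 + smul (\<pi> ^ m) X)"
    using assms by (auto simp: level_def)
  then obtain C where C: "h = mat 1 + smul (\<pi> ^ m) X + smul (\<pi> ^ Suc m) C" by (auto simp: mcong_iff_ex)
  show ?thesis
  proof
    show "h \<in> D" by fact
    show "h = mat 1 + smul (\<pi> ^ m) (X + smul \<pi> C)" using C by (simp add: smul_add smul_smul mult.commute)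
    show "mcong \<pi> (X + smul \<pi> C) X" by (simp add: mcong_def)
  qed
qed

lemma inverse_one_mod:
  assumes "g ** g' = mat 1" "g' ** g = mat 1" "mcong d g (mat 1)"
  shows "mcong d g' (mat 1)"
  using right_inverse_cong[of "mat 1" "mat 1" g g' d] assms by simp

lemma mat_plus_mod:
  assumes "m \<ge> 1" "\<pi> dvd c - 1"
  shows "mcong \<pi> (mat c + smul (\<pi> ^ m) A) (mat 1)"
proof (rule mcongI)
  fix i j
  have "\<pi> dvd \<pi> ^ m * A $ i $ j" using assms by (simp add: dvd_mult2 dvd_power)
  from dvd_add[OF assms(2) this] this
  show "\<pi> dvd (mat c + smul (\<pi> ^ m) A) $ i $ j - mat 1 $ i $ j"
    by (auto simp: mat_nth algebra_simps)
qed

lemma one_plus_mod: "m \<ge> 1 \<Longrightarrow> mcong \<pi> (mat 1 + smul (\<pi> ^ m) A) (mat 1)"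
  by (auto simp: mcong_def dvd_mult2 dvd_power)

text \<open>The commutator of u and v is $1 + (uv - vu) (vu)^{-1}$.\<close>
lemma level_commutator:
  assumes m: "m \<ge> 1" "k \<ge> 1" and c: "\<pi> dvd c - 1"
    and u: "u \<in> D" "u = mat c + smul (\<pi> ^ m) A"
    and v: "v \<in> D" "v = mat 1 + smul (\<pi> ^ k) B"
  shows "A ** B - B ** A \<in> level (m + k)"
proof -
  obtain u' where u': "u' \<in> D" "u ** u' = mat 1" "u' ** u = mat 1" using inv u by blast
  obtain v' where v': "v' \<in> D" "v ** v' = mat 1" "v' ** v = mat 1" using inv v by blast
  have "mcong \<pi> u (mat 1)" using c m mat_plus_mod unfolding u by blast
  then have 1: "mcong \<pi> u' (mat 1)" using inverse_one_mod u' by blast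
  have 2: "mcong \<pi> v' (mat 1)" using inverse_one_mod v' one_plus_mod v m by blast
  \<comment> \<open>The scalar part c of u drops out of uv - vu. So an element that is merely scalar
    modulo pi^m acts in commutators as if it belonged to level m; the exceptional case exploits this
    with c = 1 + pi.\<close>
  have "u ** v = v ** u + smul (\<pi> ^ (m + k)) (A ** B - B ** A)"
    unfolding u v by (simp add: matrix_ring_simps mat_commute power_add mult.commute matrix_smul_mat[of c])
  then have "u ** v ** (u' ** v') = v ** (u ** u') ** v' + smul (\<pi> ^ (m + k)) ((A ** B - B ** A) ** (u' ** v'))"
    by (simp add: matrix_ring_simps)
  also have "v ** (u ** u') ** v' = mat 1" using u' v' by simp
  finally have eq: "u ** v ** (u' ** v') = mat 1 + smul (\<pi> ^ (m + k)) ((A ** B - B ** A) ** (u' ** v'))" .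
  have "mcong \<pi> ((A ** B - B ** A) ** (u' ** v')) ((A ** B - B ** A) ** (mat 1 ** mat 1))"
    by (intro mcong_mult mcong_refl 1 2)
  then have "mcong \<pi> ((A ** B - B ** A) ** (u' ** v')) (A ** B - B ** A)" by simp
  then show ?thesis using levelI[OF _ eq] mult u v u' v' by blast
qed

text \<open>The element of D behind this is the commutator of u with a lift of M. The scalar c
  cancels in it, so u itself may lie outside the m-th congruence subgroup.\<close>

lemma level_conj_diff:
  assumes m: "m \<ge> 1" and c: "\<pi> dvd c - 1"
    and u: "u \<in> D" "u = mat c + smul (\<pi> ^ m) A"
    and AA: "M ** M' = mat 1" "M' ** M = mat 1" "det M = 1"
  shows "M ** A ** M' - A \<in> level m"
proof -
  obtain u' where u': "u' \<in> D" "u ** u' = mat 1" "u' ** u = mat 1" using inv u by blast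
  obtain h where h: "h \<in> D" "mcong \<pi> h M" using residual AA by blast
  obtain h' where h': "h' \<in> D" "h ** h' = mat 1" "h' ** h = mat 1" using inv h by blast
  have hM: "mcong \<pi> h' M'" using right_inverse_cong[of M' M h h' \<pi>] AA h h' by blast
  have "mcong \<pi> u (mat 1)" using c m mat_plus_mod unfolding u by blast
  then have 1: "mcong \<pi> u' (mat 1)" using inverse_one_mod u' by blast
  have "h ** u ** h' = smul c (h ** h') + smul (\<pi> ^ m) (h ** A ** h')"
    unfolding u by (simp add: matrix_ring_simps mat_commute)
  also have "\<dots> = u + smul (\<pi> ^ m) (h ** A ** h' - A)"
    unfolding u h' by (simp add: matrix_ring_simps) (rule matrix_eqI, simp add: mat_nth)
  finally have "h ** u ** h' ** u' = mat 1 + smul (\<pi> ^ m) ((h ** A ** h' - A) ** u')"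
    using u' by (simp add: matrix_add_rdistrib' smul_mult_left)
  moreover have "mcong \<pi> ((h ** A ** h' - A) ** u') ((M ** A ** M' - A) ** mat 1)"
    by (intro mcong_mult mcong_diff mcong_refl h hM 1)
  ultimately show ?thesis using levelI[OF mult[OF mult[OF mult[OF h(1) u(1)] h'(1)] u'(1)]] by simp
qed

lemma level_add: "m \<ge> 1 \<Longrightarrow> X \<in> level m \<Longrightarrow> Y \<in> level m \<Longrightarrow> X + Y \<in> level m"
proof -
  assume m: "m \<ge> 1" and "X \<in> level m" "Y \<in> level m"
  then obtain g A h B where g: "g \<in> D" "g = mat 1 + smul (\<pi> ^ m) A" "mcong \<pi> A X"
    and h: "h \<in> D" "h = mat 1 + smul (\<pi> ^ m) B" "mcong \<pi> B Y" by (metis levelE)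
  have "g ** h = mat 1 + smul (\<pi> ^ m) (A + B + smul (\<pi> ^ m) (A ** B))"
    unfolding g h by (simp add: matrix_ring_simps)
  moreover have "mcong \<pi> (A + B + smul (\<pi> ^ m) (A ** B)) (X + Y + 0)"
    using m by (intro mcong_add g h) (auto simp: mcong_def dvd_mult2 dvd_power)
  ultimately show ?thesis using levelI[OF mult[OF g(1) h(1)]] by simp
qed

lemma level_uminus: "m \<ge> 1 \<Longrightarrow> X \<in> level m \<Longrightarrow> - X \<in> level m"
proof -
  assume m: "m \<ge> 1" and "X \<in> level m"
  then obtain g A where g: "g \<in> D" "g = mat 1 + smul (\<pi> ^ m) A" "mcong \<pi> A X" by (metis levelE)
  obtain g' where g': "g' \<in> D" "g ** g' = mat 1" "g' ** g = mat 1" using inv g by blast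
  have 1: "mcong \<pi> g' (mat 1)" using inverse_one_mod[OF g'(2,3)] one_plus_mod m g by blast
  have "mat 1 = g' + smul (\<pi> ^ m) (A ** g')" using g'(2) unfolding g by (simp add: matrix_ring_simps)
  then have "g' = mat 1 + smul (\<pi> ^ m) (- (A ** g'))" by (simp add: smul_uminus algebra_simps)
  moreover have "mcong \<pi> (- (A ** g')) (- X)"
  proof -
    have "mcong \<pi> (0 - A ** g') (0 - X ** mat 1)" by (intro mcong_diff mcong_mult g 1 mcong_refl)
    then show ?thesis by simp
  qed
  ultimately show ?thesis using levelI g' by blast
qed

lemma level_ad:
  assumes m: "m \<ge> 1" and AA: "M ** M' = mat 1" "M' ** M = mat 1" "det M = 1" and X: "X \<in> level m"
  shows "M ** X ** M' \<in> level m"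
proof -
  obtain g A where g: "g \<in> D" "g = mat 1 + smul (\<pi> ^ m) A" "mcong \<pi> A X" using levelE X by blast
  have "M ** A ** M' - A \<in> level m" by (rule level_conj_diff[OF m _ g(1,2) AA]) simp
  moreover have "mcong \<pi> (M ** A ** M' - A) (M ** X ** M' - X)"
    by (intro mcong_diff mcong_mult mcong_refl g)
  ultimately have "M ** X ** M' - X \<in> level m" using level_cong by blast
  then show ?thesis using level_add[OF m _ X] by fastforce
qed

lemma level_full:
  assumes m: "m \<ge> 1" and X: "X \<in> level m" "\<not> scalar_mod X" and Y: "\<pi> dvd trace Y"
  shows "Y \<in> level m"
proof (rule full_if_nonscalar[OF two _ _ _ X Y])
  show "X - Y \<in> level m" if "X \<in> level m" "Y \<in> level m" for X Y
    using level_add[OF m that(1) level_uminus[OF m that(2)]] by simp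
qed (use level_cong level_ad[OF m] in auto)

definition full_level :: "nat \<Rightarrow> bool" where
  "full_level m \<longleftrightarrow> (\<forall>Y. \<pi> dvd trace Y \<longrightarrow> Y \<in> level m)"

lemma full_levelI: "m \<ge> 1 \<Longrightarrow> X \<in> level m \<Longrightarrow> \<not> scalar_mod X \<Longrightarrow> full_level m"
  using level_full by (auto simp: full_level_def)

lemma trace_elem_mat: "trace (elem_mat i j) = (if i = j then 1 else 0)"
proof -
  have "trace (elem_mat i j) = (\<Sum>k\<in>UNIV. if k = i then if i = j then 1 else 0 else 0)"
    unfolding trace_def by (intro sum.cong) (auto simp: entry_simps)
  then show ?thesis by simp
qed

lemma full_level_elem_mat: "full_level m \<Longrightarrow> i \<noteq> j \<Longrightarrow> elem_mat i j \<in> level m"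
  by (simp add: full_level_def trace_elem_mat)

text \<open>The bracket of E_ij and E_ji is E_ii - E_jj, which is nonscalar unless n = p = 2, and a
  single nonscalar element fills a level.\<close>

lemma full_level_Suc:
  assumes m: "m \<ge> 1" and full: "full_level 1" "full_level m"
    and ex: "(\<exists>i j l::'n. i \<noteq> j \<and> l \<noteq> i \<and> l \<noteq> j) \<or> \<not> \<pi> dvd 2"
  shows "full_level (Suc m)"
proof -
  obtain i j :: 'n where ij: "i \<noteq> j" "(\<exists>l. l \<noteq> i \<and> l \<noteq> j) \<or> \<not> \<pi> dvd 2"
    using ex CARD_ge_2_other[OF two] by metis
  obtain u A where u: "u \<in> D" "u = mat 1 + smul (\<pi> ^ 1) A" "mcong \<pi> A (elem_mat i j)"
    using levelE full_level_elem_mat[OF full(1) ij(1)] by blast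
  obtain v B where v: "v \<in> D" "v = mat 1 + smul (\<pi> ^ m) B" "mcong \<pi> B (elem_mat j i)"
    using levelE full_level_elem_mat[OF full(2) ij(1)[symmetric]] by blast
  have "A ** B - B ** A \<in> level (1 + m)"
    by (rule level_commutator[OF _ m _ u(1,2) v(1,2)]) auto
  moreover have "mcong \<pi> (A ** B - B ** A) (elem_mat i j ** elem_mat j i - elem_mat j i ** elem_mat i j)"
    by (intro mcong_diff mcong_mult u v)
  ultimately have "elem_mat i j ** elem_mat j i - elem_mat j i ** elem_mat i j \<in> level (Suc m)"
    using level_cong by simp
  then show ?thesis
  proof (rule full_levelI[rotated])
    show "\<not> scalar_mod (elem_mat i j ** elem_mat j i - elem_mat j i ** elem_mat i j)"
      using ij(2)
    proof
      assume "\<exists>l. l \<noteq> i \<and> l \<noteq> j"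
      then obtain l where l: "l \<noteq> i" "l \<noteq> j" by blast
      have "(elem_mat i j ** elem_mat j i - elem_mat j i ** elem_mat i j) $ i $ i
         - (elem_mat i j ** elem_mat j i - elem_mat j i ** elem_mat i j) $ l $ l = (1::'a)"
        using l ij(1) by (simp add: entry_simps)
      then show ?thesis using l pi_ndvd_1 unfolding scalar_mod_def by metis
    next
      assume "\<not> \<pi> dvd 2"
      moreover have "(elem_mat i j ** elem_mat j i - elem_mat j i ** elem_mat i j) $ i $ i
         - (elem_mat i j ** elem_mat j i - elem_mat j i ** elem_mat i j) $ j $ j = (2::'a)"
        using ij(1) by (simp add: entry_simps)
      ultimately show ?thesis using ij(1) unfolding scalar_mod_def by metis
    qed
  qed simp
qed

text \<open>For $2 \times 2$ matrices in characteristic 2 the commutators of trace zero matrices are scalar.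
  There the lift of the scalar $1 + \pi$ is used, whose second-order term has nonzero trace because
  the determinant is 1.\<close>
lemma exceptional_lift:
  fixes i j :: 'n
  assumes full: "full_level 1" and ij: "i \<noteq> j" "\<And>l. l = i \<or> l = j" and char2: "\<pi> dvd 2"
  shows "\<exists>u\<in>D. \<exists>S. u = mat (1 + \<pi>) + smul (\<pi>\<^sup>2) S \<and> \<not> \<pi> dvd S $ i $ i - S $ j $ j"
proof -
  have two: "(2::'a) = 0" using K_dvd_iff[of 2] K_add[OF K_1 K_1] char2 by simp
  have UN: "UNIV = {i, j}" using ij by auto
  have tr: "trace M = M $ i $ i + M $ j $ j" for M :: "'a^'n^'n" using ij(1) by (simp add: trace_def UN)
  have "trace (mat 1 :: 'a^'n^'n) = 0" using two by (simp add: tr mat_nth)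
  then have "mat 1 \<in> level 1" using full by (simp add: full_level_def)
  then obtain u A where u: "u \<in> D" "u = mat 1 + smul (\<pi> ^ 1) A" "mcong \<pi> A (mat 1)" using levelE by blast
  obtain S where S: "A = mat 1 + smul \<pi> S" using u(3) by (auto simp: mcong_iff_ex)
  have uS: "u = mat (1 + \<pi>) + smul (\<pi>\<^sup>2) S"
    unfolding u S by (rule matrix_eqI) (auto simp: mat_nth algebra_simps power2_eq_square)
  have "\<not> \<pi> dvd 1 + \<pi>" using pi_ndvd_1 by (simp add: dvd_add_left_iff)
  then obtain v where v: "(1 + \<pi>) * v = 1" using unit_ex by blast
  have "u = smul (1 + \<pi>) (mat 1 + smul (\<pi>\<^sup>2) (smul v S))"
  proof (rule matrix_eqI)
    fix k l
    have "\<pi>\<^sup>2 * S $ k $ l = \<pi>\<^sup>2 * (((1 + \<pi>) * v) * S $ k $ l)" using v by simp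
    also have "\<dots> = (1 + \<pi>) * (\<pi>\<^sup>2 * (v * S $ k $ l))" by (simp only: ac_simps)
    finally show "u $ k $ l = smul (1 + \<pi>) (mat 1 + smul (\<pi>\<^sup>2) (smul v S)) $ k $ l"
      by (simp only: uS mat_nth smul_nth vector_add_component distrib_left) simp
  qed
  then have "det u = (1 + \<pi>)\<^sup>2 * det (mat 1 + smul (\<pi>\<^sup>2) (smul v S))"
    using ij(1) by (simp add: det_smul UN power2_eq_square)
  moreover obtain w where "det (mat 1 + smul (\<pi>\<^sup>2) (smul v S)) = 1 + \<pi>\<^sup>2 * trace (smul v S) + (\<pi>\<^sup>2)\<^sup>2 * w"
    using det_one_plus_cong[of "\<pi>\<^sup>2" "smul v S"] by (auto simp: dvd_def algebra_simps)
  moreover have "(1 + \<pi>)\<^sup>2 = 1 + \<pi>\<^sup>2" using two by (simp add: power2_sum)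
  \<comment> \<open>Since (1 + pi)^2 = 1 + pi^2 in characteristic 2, comparing the terms of order
    pi^2 in det u = 1 forces the trace of v S to be -1 modulo pi.\<close>
  ultimately have "1 = (1 + \<pi>\<^sup>2) * (1 + \<pi>\<^sup>2 * trace (smul v S) + (\<pi>\<^sup>2)\<^sup>2 * w)" using det_1[OF u(1)] by simp
  then have "\<pi>\<^sup>2 * (1 + trace (smul v S) + \<pi>\<^sup>2 * (w + trace (smul v S) + \<pi>\<^sup>2 * w)) = 0"
    by (simp add: algebra_simps power2_eq_square)
  then have e: "1 + trace (smul v S) = - (\<pi>\<^sup>2 * (w + trace (smul v S) + \<pi>\<^sup>2 * w))"
    using pi_nz by (simp add: eq_neg_iff_add_eq_0)
  have "\<pi> dvd 1 + v * trace S"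
  proof -
    have "\<pi> dvd 1 + trace (smul v S)" unfolding e by (simp add: power2_eq_square mult.assoc)
    then show ?thesis by (simp add: tr distrib_left)
  qed
  moreover have "S $ i $ i - S $ j $ j = trace S"
  proof -
    have "S $ i $ i - S $ j $ j = trace S - 2 * S $ j $ j" by (simp add: tr)
    then show ?thesis using two by simp
  qed
  ultimately have "\<not> \<pi> dvd S $ i $ i - S $ j $ j"
    using pi_ndvd_1 by (metis dvd_add_left_iff dvd_mult)
  then show ?thesis using u uS by blast
qed

text \<open>In the exceptional case the lift of 1 + pi is scalar modulo pi^2, so bracketing with its
  second-order term S raises the level by two; hence the induction with base cases 1 and 2.\<close>

lemma full_level_all:
  assumes full: "full_level 1" and "m \<ge> 1"
  shows "full_level m"
proof (cases "(\<exists>i j l::'n. i \<noteq> j \<and> l \<noteq> i \<and> l \<noteq> j) \<or> \<not> \<pi> dvd 2")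
  case True
  show ?thesis using assms(2)
    by (induction m rule: dec_induct) (use full full_level_Suc True in auto)
next
  case False
  obtain i j :: 'n where ij: "i \<noteq> j" using CARD_ge_2_other[OF two] by metis
  then have UN: "l = i \<or> l = j" for l using False by blast
  obtain u S where u: "u \<in> D" "u = mat (1 + \<pi>) + smul (\<pi>\<^sup>2) S" and S: "\<not> \<pi> dvd S $ i $ i - S $ j $ j"
    using exceptional_lift[OF full ij UN] False by blast
  have "full_level (m + 2)" if m: "m \<ge> 1" "full_level m" for m
  proof -
    obtain v B where v: "v \<in> D" "v = mat 1 + smul (\<pi> ^ m) B" "mcong \<pi> B (elem_mat i j)"
      using levelE full_level_elem_mat[OF m(2) ij] by blast
    have "S ** B - B ** S \<in> level (2 + m)"
      by (rule level_commutator[OF _ m(1) _ u v(1,2)]) auto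
    moreover have "mcong \<pi> (S ** B - B ** S) (S ** elem_mat i j - elem_mat i j ** S)"
      by (intro mcong_diff mcong_mult v mcong_refl)
    ultimately have "S ** elem_mat i j - elem_mat i j ** S \<in> level (m + 2)"
      using level_cong by (simp add: add.commute)
    moreover have "(S ** elem_mat i j - elem_mat i j ** S) $ i $ j = S $ i $ i - S $ j $ j"
      by (simp add: entry_simps)
    ultimately show ?thesis using S ij by (intro full_levelI) (auto simp del: vector_minus_component simp: scalar_mod_def, metis)
  qed
  \<comment> \<open>Level 2 is reached by conjugating the same lift. The entry (i,j) of the
    difference is a quadratic in a whose values at 1 and t cannot both vanish modulo pi, because the
    diagonal entries of S differ.\<close>
  moreover have "full_level 2"
  proof -
    obtain t where t: "t \<in> K" "t \<noteq> 0" "t\<^sup>2 \<noteq> 1" using K_generic by blast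
    have t0: "\<not> \<pi> dvd t" using t K_dvd_iff by blast
    have t1: "\<not> \<pi> dvd 1 - t" using t K_cong_iff[of 1 t] K_1 by auto
    have L: "transvection i j a ** S ** transvection i j (-a) - S \<in> level 2" for a
      by (rule level_conj_diff[OF _ _ u]) (use ij in \<open>auto simp: transvection_add det_transvection\<close>)
    have e: "(transvection i j a ** S ** transvection i j (-a) - S) $ i $ j = a * (S $ j $ j - S $ i $ i) - a\<^sup>2 * S $ j $ i" for a
      by (simp add: entry_simps algebra_simps power2_eq_square)
    have "\<exists>a. \<not> \<pi> dvd a * (S $ j $ j - S $ i $ i) - a\<^sup>2 * S $ j $ i"
    proof (rule ccontr)
      assume "\<nexists>a. \<not> \<pi> dvd a * (S $ j $ j - S $ i $ i) - a\<^sup>2 * S $ j $ i"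
      then have "\<pi> dvd t\<^sup>2 * (1 * (S $ j $ j - S $ i $ i) - 1\<^sup>2 * S $ j $ i) - (t * (S $ j $ j - S $ i $ i) - t\<^sup>2 * S $ j $ i)"
        by (intro dvd_diff[where y = "t\<^sup>2 * _" and x = \<pi> and z = "t * _ - _"] dvd_mult) blast+
      also have "\<dots> = t * ((1 - t) * (S $ i $ i - S $ j $ j))" by (simp add: algebra_simps power2_eq_square)
      finally show False using t0 t1 S by (simp add: pi_dvd_mult_iff)
    qed
    then obtain a where "\<not> \<pi> dvd a * (S $ j $ j - S $ i $ i) - a\<^sup>2 * S $ j $ i" by blast
    then have "\<not> scalar_mod (transvection i j a ** S ** transvection i j (-a) - S)"
      using ij unfolding scalar_mod_def e[symmetric] by blast
    then show ?thesis using L[of a] by (intro full_levelI) auto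
  qed
  ultimately show ?thesis using full \<open>m \<ge> 1\<close>
  proof (induction m rule: less_induct)
    case (less m)
    show ?case
    proof (cases "m \<le> 2")
      case True
      then have "m = 1 \<or> m = 2" using less by auto
      then show ?thesis using less by auto
    next
      case False
      then have "full_level (m - 2)" using less by auto
      then have "full_level (m - 2 + 2)" using less.prems(1) False by auto
      moreover have "m - 2 + 2 = m" using False by simp
      ultimately show ?thesis by simp
    qed
  qed
qed

text \<open>Successive approximation: the error h^(-1) M = 1 + pi^m X has determinant 1, so the
  trace of X is divisible by pi and some element of D in level m corrects the error.\<close>

lemma dense_if_full_level:
  assumes full: "full_level 1" and M: "det M = 1" and "m \<ge> 1"
  shows "\<exists>h\<in>D. mcong (\<pi> ^ m) h M"
  using assms(3)
proof (induction m rule: dec_induct)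
  case base
  show ?case using residual[OF M] by simp
next
  case (step m)
  then obtain h where h: "h \<in> D" "mcong (\<pi> ^ m) h M" by blast
  obtain h' where h': "h' \<in> D" "h ** h' = mat 1" "h' ** h = mat 1" using inv h by blast
  have "mcong (\<pi> ^ m) (h' ** M) (h' ** h)" by (intro mcong_mult mcong_refl mcong_sym[OF h(2)])
  then obtain X where X: "h' ** M = mat 1 + smul (\<pi> ^ m) X" by (auto simp: h' mcong_iff_ex)
  have "det (h' ** M) = 1" using det_1 h' M by (simp add: det_mul)
  then have "(\<pi> ^ m)\<^sup>2 dvd \<pi> ^ m * trace X"
    using det_one_plus_cong[of "\<pi> ^ m" X] X by simp
  then have "\<pi> ^ m dvd trace X" using pi_nz by (simp add: power2_eq_square)
  then have "\<pi> dvd trace X" using step(1) dvd_trans[of \<pi> "\<pi> ^ m"] by (simp add: dvd_power)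
  then have "X \<in> level m" using full_level_all[OF full step(1)] by (simp add: full_level_def)
  then obtain g where g: "g \<in> D" "mcong (\<pi> ^ Suc m) g (h' ** M)" by (auto simp: level_def X)
  then have "mcong (\<pi> ^ Suc m) (h ** g) (h ** (h' ** M))" by (intro mcong_mult mcong_refl)
  also have "h ** (h' ** M) = M" using h' by (simp add: matrix_mul_assoc)
  finally show ?case using mult g h by blast
qed

text \<open>The quotient of two elements with the same reduction lies in level 1, and a level that
  is not full has only scalar elements.\<close>

lemma full_level_or_scalar:
  assumes "\<not> full_level 1" "g \<in> D" "h \<in> D" "mcong \<pi> g h"
  shows "\<exists>c. mcong (\<pi>\<^sup>2) h (smul (1 + \<pi> * c) g)"
proof -
  obtain g' where g': "g' \<in> D" "g ** g' = mat 1" "g' ** g = mat 1" using inv assms by blast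
  have "mcong \<pi> (h ** g') (g ** g')" by (intro mcong_mult mcong_refl mcong_sym[OF assms(4)])
  then obtain X where X: "h ** g' = mat 1 + smul \<pi> X" by (auto simp: g' mcong_iff_ex)
  then have "X \<in> level 1" using levelI[OF mult[OF assms(3) g'(1)], of 1 X X] by simp
  then have sc: "scalar_mod X" using full_levelI[of 1] assms by auto
  obtain i :: 'n where True by blast
  have "mcong \<pi> X (mat (X $ i $ i))"
    using sc by (auto simp: mcong_def mat_nth scalar_mod_def) (metis diff_self dvd_0_right)
  then have "mcong (\<pi> * \<pi>) (smul \<pi> X) (smul \<pi> (mat (X $ i $ i)))" by (rule mcong_smul_scale)
  then have "mcong (\<pi>\<^sup>2) (h ** g') (mat 1 + smul \<pi> (mat (X $ i $ i)))" unfolding X power2_eq_square by (intro mcong_add mcong_refl)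
  then have "mcong (\<pi>\<^sup>2) (h ** g' ** g) ((mat 1 + smul \<pi> (mat (X $ i $ i))) ** g)" by (rule mcong_mult_right)
  also have "h ** g' ** g = h" using g' by (simp add: matrix_mul_assoc[symmetric])
  also have "(mat 1 + smul \<pi> (mat (X $ i $ i))) ** g = smul (1 + \<pi> * X $ i $ i) g"
    by (simp add: matrix_add_rdistrib' smul_mult_left mat_commute smul_add_left smul_smul)
  finally show ?thesis by blast
qed

end


section \<open>Groups modulo $\pi^2$ that are an extension of the residual group by scalars\<close>

lemma mcong_smul_left: "d dvd a - b \<Longrightarrow> mcong d (smul a A) (smul b A)"
  by (auto simp: mcong_def simp flip: left_diff_distrib)

lemma sum_matrix_mult: "sum f S ** (A::'a::comm_ring_1^'n^'n) = (\<Sum>s\<in>S. f s ** A)"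
  by (induction S rule: infinite_finite_induct) (auto simp: matrix_add_rdistrib')

lemma matrix_mult_sum: "(A::'a::comm_ring_1^'n^'n) ** sum f S = (\<Sum>s\<in>S. A ** f s)"
  by (induction S rule: infinite_finite_induct) (auto simp: matrix_add_ldistrib)

context equichar_cdvr
begin

text \<open>Dividing one row by the determinant does not change the matrix modulo pi. This passes
  from determinant 1 in k to determinant 1 in R.\<close>

lemma normalize_det:
  fixes M :: "'a^'n^'n"
  assumes "\<pi> dvd det M - 1"
  shows "\<exists>N. det N = 1 \<and> mcong \<pi> N M"
proof -
  have "\<not> \<pi> dvd det M" using assms pi_ndvd_1 by (metis dvd_diff_left_iff dvd_diff_right_iff)
  then obtain v where v: "det M * v = 1" using unit_ex by blast
  obtain o' :: 'n where True by blast
  define t where "t = (\<lambda>k. if k = o' then v else 1)"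
  have "prod t UNIV = v" unfolding t_def by (subst prod.remove[of _ o']) (auto intro!: prod.neutral)
  then have "det (diag_matrix t ** M) = 1" using v by (simp add: det_mul det_diag_matrix mult.commute)
  moreover have "\<pi> dvd v - 1"
  proof -
    have "v - 1 = - (v * (det M - 1))" using v by (simp add: algebra_simps)
    then show ?thesis using assms by simp
  qed
  then have "mcong \<pi> (diag_matrix t) (mat 1)" by (auto simp: mcong_def entry_simps t_def)
  then have "mcong \<pi> (diag_matrix t ** M) (mat 1 ** M)" by (rule mcong_mult_right)
  ultimately show ?thesis by auto
qed

section \<open>Matrices and tori over the Teichmueller field\<close>

definition K_tori :: "('n \<Rightarrow> 'a) set" where
  "K_tori = {t. (\<forall>i. t i \<in> K - {0}) \<and> prod t UNIV = 1}"

definition over_K :: "'a^'n^'n \<Rightarrow> bool" where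
  "over_K A \<longleftrightarrow> (\<forall>i j. A $ i $ j \<in> K)"

lemma over_K_mult: "over_K A \<Longrightarrow> over_K B \<Longrightarrow> over_K (A ** B)"
  by (auto simp: over_K_def matrix_mult_nth intro!: K_intros)

lemma over_K_transvection: "a \<in> K \<Longrightarrow> over_K (transvection i j a)"
  by (auto simp: over_K_def entry_simps intro!: K_intros)

lemma over_K_cong: "over_K A \<Longrightarrow> over_K B \<Longrightarrow> mcong \<pi> A B \<Longrightarrow> A = B"
  by (intro matrix_eqI) (auto simp: over_K_def mcong_def K_cong_iff)

lemma over_K_ex: "\<exists>B. over_K B \<and> mcong \<pi> A B"
  by (rule exI[of _ "\<chi> i j. teich (A $ i $ j)"]) (auto simp: over_K_def mcong_def teich_mem intro: dvd_diff_sym teich_cong)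

lemma K_inv_1: "K_inv 1 = 1"
  by (simp add: K_inv_def)

lemma smul_one_plus_inverse: "mcong (\<pi>\<^sup>2) (smul (1 - \<pi> * e) (smul (1 + \<pi> * e) A)) A"
  unfolding mcong_def
proof (intro allI)
  fix i j
  have "smul (1 - \<pi> * e) (smul (1 + \<pi> * e) A) $ i $ j - A $ i $ j = \<pi>\<^sup>2 * (- e\<^sup>2 * A $ i $ j)"
    by (simp add: algebra_simps power2_eq_square)
  then show "\<pi>\<^sup>2 dvd smul (1 - \<pi> * e) (smul (1 + \<pi> * e) A) $ i $ j - A $ i $ j" by simp
qed

end

text \<open>By \<open>sat\<close>, G is a group over R/pi^2 in disguise; by \<open>scal\<close> and
  \<open>uniq\<close>, the fibres of its reduction onto SL_n(k) are exactly the orbits of the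
  scalars 1 + pi e.\<close>

locale scalar_extension = equichar_cdvr \<pi> for \<pi> :: "'a::idom" +
  fixes G :: "('a^'n^'n) set"
  assumes two: "CARD('n) \<ge> 2"
    and sat: "\<And>M M'. M \<in> G \<Longrightarrow> mcong (\<pi>\<^sup>2) M M' \<Longrightarrow> M' \<in> G"
    and mult: "\<And>g h. g \<in> G \<Longrightarrow> h \<in> G \<Longrightarrow> g ** h \<in> G"
    and scal: "\<And>M e. M \<in> G \<Longrightarrow> smul (1 + \<pi> * e) M \<in> G"
    and det_cong: "\<And>M. M \<in> G \<Longrightarrow> \<pi> dvd det M - 1"
    and residual: "\<And>M. \<pi> dvd det M - 1 \<Longrightarrow> \<exists>h\<in>G. mcong \<pi> h M"
    and uniq: "\<And>g h. g \<in> G \<Longrightarrow> h \<in> G \<Longrightarrow> mcong \<pi> g h \<Longrightarrow> \<exists>c. mcong (\<pi>\<^sup>2) h (smul (1 + \<pi> * c) g)"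
begin

lemma pi_dvd_sq: "\<pi> dvd \<pi>\<^sup>2"
  by (simp add: power2_eq_square)

lemma mcong_sq: "mcong (\<pi>\<^sup>2) A B \<Longrightarrow> mcong \<pi> A B"
  using mcong_mono pi_dvd_sq by blast

lemma descale: "smul (1 + \<pi> * e) M \<in> G \<Longrightarrow> M \<in> G"
  using scal[of "smul (1 + \<pi> * e) M" "- e"] sat[OF _ smul_one_plus_inverse] by simp

text \<open>The normal form is reached by two successive conjugations, the second one inside the
  group conjugated by the first. P' inverts P only modulo pi^2, the precision at which the averaging
  below produces an inverse.\<close>

lemma conj_locale:
  fixes P P' :: "'a^'n^'n"
  assumes P: "mcong (\<pi>\<^sup>2) (P ** P') (mat 1)" "mcong (\<pi>\<^sup>2) (P' ** P) (mat 1)"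
  shows "scalar_extension \<pi> {M. P ** M ** P' \<in> G}"
proof
  have PP: "mcong (\<pi>\<^sup>2) (P ** (P' ** A ** P) ** P') A" for A
  proof -
    have "mcong (\<pi>\<^sup>2) ((P ** P') ** A ** (P ** P')) (mat 1 ** A ** mat 1)" by (intro mcong_mult P mcong_refl)
    then show ?thesis by (simp add: matrix_mul_assoc)
  qed
  have PP': "mcong (\<pi>\<^sup>2) (P' ** (P ** A ** P') ** P) A" for A
  proof -
    have "mcong (\<pi>\<^sup>2) ((P' ** P) ** A ** (P' ** P)) (mat 1 ** A ** mat 1)" by (intro mcong_mult P mcong_refl)
    then show ?thesis by (simp add: matrix_mul_assoc)
  qed
  have detP: "\<pi> dvd det P * det P' - 1" using mcong_det[OF mcong_sq[OF P(1)]] by (simp add: det_mul)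
  have det_conj: "\<pi> dvd det (P ** M ** P') - det M" for M
  proof -
    have "det (P ** M ** P') - det M = det M * (det P * det P' - 1)" by (simp add: det_mul algebra_simps)
    then show ?thesis using detP by simp
  qed
  have det_conj': "\<pi> dvd det (P' ** M ** P) - det M" for M
  proof -
    have "det (P' ** M ** P) - det M = det M * (det P * det P' - 1)" by (simp add: det_mul algebra_simps)
    then show ?thesis using detP by simp
  qed
  show "2 \<le> CARD('n)" by (rule two)
  show "M' \<in> {M. P ** M ** P' \<in> G}" if "M \<in> {M. P ** M ** P' \<in> G}" "mcong (\<pi>\<^sup>2) M M'" for M M'
    using that sat[OF _ mcong_mult[OF mcong_mult[OF mcong_refl that(2)] mcong_refl]] by blast
  show "g ** h \<in> {M. P ** M ** P' \<in> G}" if "g \<in> {M. P ** M ** P' \<in> G}" "h \<in> {M. P ** M ** P' \<in> G}" for g h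
  proof -
    have "(P ** g ** P') ** (P ** h ** P') \<in> G" using mult that by blast
    moreover have "mcong (\<pi>\<^sup>2) (P ** g ** (P' ** P) ** h ** P') (P ** g ** mat 1 ** h ** P')" 
      by (intro mcong_mult P mcong_refl)
    ultimately show ?thesis using sat by (simp add: matrix_mul_assoc)
  qed
  show "smul (1 + \<pi> * e) M \<in> {M. P ** M ** P' \<in> G}" if "M \<in> {M. P ** M ** P' \<in> G}" for M e
    using scal that by (simp add: smul_mult_left smul_mult_right)
  show "\<pi> dvd det M - 1" if "M \<in> {M. P ** M ** P' \<in> G}" for M
    using det_cong[of "P ** M ** P'"] det_conj[of M] that dvd_diff_trans dvd_diff_sym by blast
  show "\<exists>h\<in>{M. P ** M ** P' \<in> G}. mcong \<pi> h M" if "\<pi> dvd det M - 1" for M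
  proof -
    have "\<pi> dvd det (P ** M ** P') - 1" using det_conj that dvd_diff_trans by blast
    then obtain h where h: "h \<in> G" "mcong \<pi> h (P ** M ** P')" using residual by blast
    have "P' ** h ** P \<in> {M. P ** M ** P' \<in> G}" using sat[OF h(1) mcong_sym[OF PP]] by simp
    moreover have "mcong \<pi> (P' ** h ** P) (P' ** (P ** M ** P') ** P)" by (intro mcong_mult h mcong_refl)
    then have "mcong \<pi> (P' ** h ** P) M" using mcong_sq[OF PP'] mcong_trans by blast
    ultimately show ?thesis by blast
  qed
  show "\<exists>c. mcong (\<pi>\<^sup>2) h (smul (1 + \<pi> * c) g)" 
    if gh: "g \<in> {M. P ** M ** P' \<in> G}" "h \<in> {M. P ** M ** P' \<in> G}" "mcong \<pi> g h" for g h
  proof -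
    have "mcong \<pi> (P ** g ** P') (P ** h ** P')" by (intro mcong_mult mcong_refl gh)
    then obtain c where "mcong (\<pi>\<^sup>2) (P ** h ** P') (smul (1 + \<pi> * c) (P ** g ** P'))" using uniq gh by blast
    then have "mcong (\<pi>\<^sup>2) (P' ** (P ** h ** P') ** P) (P' ** smul (1 + \<pi> * c) (P ** g ** P') ** P)"
      by (intro mcong_mult mcong_refl)
    then have "mcong (\<pi>\<^sup>2) h (smul (1 + \<pi> * c) (P' ** (P ** g ** P') ** P))"
      using mcong_trans[OF mcong_sym[OF PP']] by (simp add: smul_mult_left smul_mult_right)
    then have "mcong (\<pi>\<^sup>2) h (smul (1 + \<pi> * c) g)" using mcong_trans mcong_smul[OF PP'] by blast
    then show ?thesis by blast
  qed
qed

text \<open>The order of the torus is prime to p, so averaging over it produces a conjugating matrix. The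
  sum runs over all nonzero vectors over K, of which the coordinate o' is ignored and replaced by
  the value that makes the determinant 1; their number is $\pm 1$ in R.\<close>
lemma torus_conjugation:
  "\<exists>P P' :: 'a^'n^'n. mcong (\<pi>\<^sup>2) (P ** P') (mat 1) \<and> mcong (\<pi>\<^sup>2) (P' ** P) (mat 1) \<and>
    (\<forall>t\<in>K_tori. P ** diag_matrix t ** P' \<in> G)"
proof -
  obtain o' :: 'n where True by blast
  define A where "A = (UNIV :: 'n set) \<rightarrow>\<^sub>E (K - {0})"
  define th where "th s = (\<lambda>i. if i = o' then K_inv (\<Prod>j\<in>UNIV - {o'}. s j) else s i)" for s :: "'n \<Rightarrow> 'a"
  define iv where "iv t = (\<lambda>i. K_inv (t i))" for t :: "'n \<Rightarrow> 'a"
  have finA: "finite A" unfolding A_def using finite_K by (intro finite_PiE) auto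
  have th_T: "th s \<in> K_tori" if "s \<in> A" for s
  proof -
    have sK: "s i \<in> K - {0}" for i using that by (auto simp: A_def)
    have p: "(\<Prod>j\<in>UNIV - {o'}. s j) \<in> K - {0}" using sK by (auto intro: K_prod)
    have "prod (th s) UNIV = th s o' * (\<Prod>j\<in>UNIV - {o'}. th s j)" by (rule prod.remove) auto
    also have "(\<Prod>j\<in>UNIV - {o'}. th s j) = (\<Prod>j\<in>UNIV - {o'}. s j)" by (rule prod.cong) (auto simp: th_def)
    also have "th s o' * \<dots> = 1" using p K_inv_right by (simp add: th_def mult.commute)
    finally show ?thesis using sK p by (auto simp: K_tori_def th_def K_inv_mem K_inv_nz)
  qed
  have th_fix: "th t = t" "t \<in> A" if "t \<in> K_tori" for t
  proof -
    have tK: "t i \<in> K - {0}" for i using that by (auto simp: K_tori_def)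
    then show "t \<in> A" by (auto simp: A_def)
    have p: "(\<Prod>j\<in>UNIV - {o'}. t j) \<in> K - {0}" using tK by (auto intro: K_prod)
    have "t o' * (\<Prod>j\<in>UNIV - {o'}. t j) = 1" using that by (simp add: K_tori_def flip: prod.remove)
    then have "(\<Prod>j\<in>UNIV - {o'}. t j) * t o' = (\<Prod>j\<in>UNIV - {o'}. t j) * K_inv (\<Prod>j\<in>UNIV - {o'}. t j)"
      using K_inv_right p by (simp add: mult.commute)
    then have "t o' = K_inv (\<Prod>j\<in>UNIV - {o'}. t j)" using p by simp
    then show "th t = t" by (auto simp: th_def)
  qed
  have th_mult: "th (\<lambda>i. t i * s i) = (\<lambda>i. th t i * th s i)" for t s
    by (auto simp: th_def prod.distrib K_inv_mult)
  have iv: "diag_matrix (iv t) ** diag_matrix t = mat 1" "diag_matrix t ** diag_matrix (iv t) = mat 1" if "t \<in> K_tori" for t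
    using that K_inv_right by (auto simp: diag_matrix_mult iv_def K_tori_def mult.commute intro!: matrix_eqI simp: entry_simps)
  have "\<exists>h\<in>G. mcong \<pi> h (diag_matrix t)" if "t \<in> K_tori" for t
    using that by (intro residual) (simp add: det_diag_matrix K_tori_def)
  then obtain h where h: "\<And>t. t \<in> K_tori \<Longrightarrow> h t \<in> G" "\<And>t. t \<in> K_tori \<Longrightarrow> mcong \<pi> (h t) (diag_matrix t)" by metis
  \<comment> \<open>A lift of a torus element times the inverse of that element is congruent to 1.
    The sum P of these is an intertwiner, carrying the standard torus to its lift up to
    scalars.\<close>
  define B where "B s = h (th s) ** diag_matrix (iv (th s))" for s
  have B1: "mcong \<pi> (B s) (mat 1)" if "s \<in> A" for s
    unfolding B_def iv(2)[OF th_T[OF that], symmetric] by (intro mcong_mult h mcong_refl th_T that)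
  define P where "P = sum B A"
  define \<nu> where "\<nu> = (of_nat (card A) :: 'a)"
  have "mcong \<pi> P (\<Sum>s\<in>A. mat 1)" unfolding P_def by (rule mcong_sum) (use B1 in auto)
  also have "(\<Sum>s\<in>A. mat 1) = smul \<nu> (mat 1 :: 'a^'n^'n)" by (rule matrix_eqI) (simp only: sum_component smul_nth mat_nth, simp add: \<nu>_def)
  finally have P\<nu>: "mcong \<pi> P (smul \<nu> (mat 1))" .
  then obtain W where W: "P = smul \<nu> (mat 1) + smul \<pi> W" by (auto simp: mcong_iff_ex)
  \<comment> \<open>As \<nu>^2 = 1, the inverse of \<nu> + pi W to first order is \<nu> - pi
    W.\<close>
  define P' where "P' = smul \<nu> (mat 1) - smul \<pi> W"
  have "card A = (card K - 1) ^ CARD('n)" 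
    using K_0 finite_K by (simp add: A_def card_PiE card_Diff_singleton)
  moreover have "of_nat (card K - 1) = (-1 :: 'a)" using of_nat_card_K card_K by (simp add: of_nat_diff)
  ultimately have "\<nu> = (-1) ^ CARD('n)" by (simp add: \<nu>_def)
  then have \<nu>2: "\<nu> * \<nu> = 1" by (metis power_add mult_2 minus_one_power_iff even_add power_mult_distrib mult_minus_left mult_1 minus_minus power_one)
  have "P ** P' = mat 1 - smul (\<pi>\<^sup>2) (W ** W)" "P' ** P = mat 1 - smul (\<pi>\<^sup>2) (W ** W)"
    unfolding W P'_def by (simp_all add: matrix_ring_simps \<nu>2 power2_eq_square mult.commute)
  then have PP: "mcong (\<pi>\<^sup>2) (P ** P') (mat 1)" "mcong (\<pi>\<^sup>2) (P' ** P) (mat 1)"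
    by (simp_all add: mcong_def)
  have "P ** diag_matrix t ** P' \<in> G" if t: "t \<in> K_tori" for t
  proof -
    have tA: "(\<lambda>i. t i * s i) \<in> A" if "s \<in> A" for s
      using that t by (auto simp: A_def K_tori_def PiE_iff intro: K_mult)
    have thts: "th (\<lambda>i. t i * s i) = (\<lambda>i. t i * th s i)" for s using th_mult[of t s] th_fix[OF t] by simp
    have "\<exists>c. mcong (\<pi>\<^sup>2) (h t ** h (th s)) (smul (1 + \<pi> * c) (h (th (\<lambda>i. t i * s i))))" if "s \<in> A" for s
    proof (rule uniq)
      show "h (th (\<lambda>i. t i * s i)) \<in> G" using h th_T tA that by blast
      show "h t ** h (th s) \<in> G" using h th_T that t mult by blast
      have "mcong \<pi> (h t ** h (th s)) (diag_matrix t ** diag_matrix (th s))" using h th_T that t by (intro mcong_mult) auto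
      then show "mcong \<pi> (h (th (\<lambda>i. t i * s i))) (h t ** h (th s))"
        using h(2)[OF th_T[OF tA[OF that]]] unfolding thts diag_matrix_mult using mcong_trans mcong_sym by blast
    qed
    then obtain c where c: "\<And>s. s \<in> A \<Longrightarrow> mcong (\<pi>\<^sup>2) (h t ** h (th s)) (smul (1 + \<pi> * c s) (h (th (\<lambda>i. t i * s i))))" by metis
    \<comment> \<open>The summands of P are congruent to 1, so modulo pi^2 the unknown scalars
      contribute only their total pi C, and that is congruent to pi C \<nu> P. All errors together
      amount to one scalar factor.\<close>
    define C where "C = sum c A"
    have ivt: "diag_matrix (iv (th s)) = diag_matrix (iv (th (\<lambda>i. t i * s i))) ** diag_matrix t" for s
    proof -
      have "K_inv (t j) * t j = 1" for j using K_inv_right t by (simp add: K_tori_def mult.commute)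
      then have "K_inv (t j) * x * t j = x" for j x by (metis mult.assoc mult.commute mult_1)
      then show ?thesis
        by (intro matrix_eqI) (auto simp: thts diag_matrix_mult iv_def K_inv_mult entry_simps)
    qed
    have "h t ** P = (\<Sum>s\<in>A. h t ** h (th s) ** diag_matrix (iv (th s)))"
      unfolding P_def B_def by (simp add: matrix_mult_sum matrix_mul_assoc)
    also have "mcong (\<pi>\<^sup>2) \<dots> (\<Sum>s\<in>A. smul (1 + \<pi> * c s) (h (th (\<lambda>i. t i * s i))) ** diag_matrix (iv (th s)))"
      by (intro mcong_sum mcong_mult_right c)
    also have "\<dots> = (\<Sum>s\<in>A. B (\<lambda>i. t i * s i) + smul (\<pi> * c s) (B (\<lambda>i. t i * s i))) ** diag_matrix t"
      unfolding sum_matrix_mult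
    proof (intro sum.cong refl)
      fix s
      show "smul (1 + \<pi> * c s) (h (th (\<lambda>i. t i * s i))) ** diag_matrix (iv (th s))
          = (B (\<lambda>i. t i * s i) + smul (\<pi> * c s) (B (\<lambda>i. t i * s i))) ** diag_matrix t"
        unfolding ivt[of s] B_def by (simp add: matrix_ring_simps smul_add_left)
    qed
    also have "mcong (\<pi>\<^sup>2) \<dots> ((\<Sum>s\<in>A. B (\<lambda>i. t i * s i) + smul (\<pi> * c s) (mat 1)) ** diag_matrix t)"
    proof (intro mcong_mult_right mcong_sum mcong_add mcong_refl)
      fix s assume s: "s \<in> A"
      have "mcong (\<pi> * \<pi>) (smul \<pi> (smul (c s) (B (\<lambda>i. t i * s i)))) (smul \<pi> (smul (c s) (mat 1)))"
        by (intro mcong_smul_scale mcong_smul B1 tA s)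
      then show "mcong (\<pi>\<^sup>2) (smul (\<pi> * c s) (B (\<lambda>i. t i * s i))) (smul (\<pi> * c s) (mat 1))"
        by (simp add: smul_smul power2_eq_square)
    qed
    also have "(\<Sum>s\<in>A. B (\<lambda>i. t i * s i) + smul (\<pi> * c s) (mat 1)) = P + smul (\<pi> * C) (mat 1)"
    proof -
      have "(\<Sum>s\<in>A. B (\<lambda>i. t i * s i)) = P"
        unfolding P_def
      proof (rule sum.reindex_bij_witness[of _ "\<lambda>s i. K_inv (t i) * s i" "\<lambda>s i. t i * s i"])
        have tt: "t i * K_inv (t i) = 1" "t i \<in> K" "t i \<noteq> 0" for i using t K_inv_right by (auto simp: K_tori_def)
        show "(\<lambda>i. K_inv (t i) * (t i * s i)) = s" for s using tt by (auto simp: fun_eq_iff mult.commute mult.left_commute)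
        show "(\<lambda>i. t i * (K_inv (t i) * s i)) = s" for s using tt by (auto simp: fun_eq_iff mult.assoc[symmetric])
        show "(\<lambda>i. K_inv (t i) * s i) \<in> A" if "s \<in> A" for s
          using that tt K_inv_nz K_inv_mem by (auto simp: A_def PiE_iff intro!: K_mult)
      qed (use tA in auto)
      moreover have "(\<Sum>s\<in>A. smul (\<pi> * c s) (mat 1)) = smul (\<pi> * C) (mat 1 :: 'a^'n^'n)"
        by (rule matrix_eqI) (simp add: C_def mat_nth sum_distrib_left)
      ultimately show ?thesis by (simp add: sum.distrib)
    qed
    also have "mcong (\<pi>\<^sup>2) ((P + smul (\<pi> * C) (mat 1)) ** diag_matrix t) ((P + smul (\<pi> * C * \<nu>) P) ** diag_matrix t)"
    proof (intro mcong_mult_right mcong_add mcong_refl)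
      have "mcong (\<pi> * \<pi>) (smul \<pi> (smul (C * \<nu>) P)) (smul \<pi> (smul (C * \<nu>) (smul \<nu> (mat 1))))"
        by (intro mcong_smul_scale mcong_smul P\<nu>)
      then show "mcong (\<pi>\<^sup>2) (smul (\<pi> * C) (mat 1)) (smul (\<pi> * C * \<nu>) P)"
        using mcong_sym by (simp add: smul_smul power2_eq_square mult.assoc \<nu>2)
    qed
    also have "(P + smul (\<pi> * C * \<nu>) P) ** diag_matrix t = smul (1 + \<pi> * (C * \<nu>)) (P ** diag_matrix t)"
      by (simp add: matrix_ring_simps smul_add_left mult.assoc)
    finally have "mcong (\<pi>\<^sup>2) (h t ** P ** P') (smul (1 + \<pi> * (C * \<nu>)) (P ** diag_matrix t) ** P')"
      by (rule mcong_mult_right)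
    moreover have "mcong (\<pi>\<^sup>2) (h t ** (P ** P')) (h t ** mat 1)" by (intro mcong_mult_left PP)
    ultimately have "mcong (\<pi>\<^sup>2) (h t) (smul (1 + \<pi> * (C * \<nu>)) (P ** diag_matrix t ** P'))"
      using mcong_trans mcong_sym by (simp add: smul_mult_left matrix_mul_assoc) blast
    then show ?thesis using h(1)[OF t] sat descale by blast
  qed
  then show ?thesis using PP by blast
qed

end


subsection \<open>Lifts of root elements\<close>

context equichar_cdvr
begin

text \<open>As $(x+1)^2 + (x-1)^2 = 2x^2 + 2$, a nonzero value of z would give a polynomial of degree at most 9
  vanishing on K.\<close>
lemma inverse_square_weight_zero:
  assumes add: "\<And>a b. a \<in> K \<Longrightarrow> b \<in> K \<Longrightarrow> z (a + b) = z a + z b"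
    and weight: "\<And>t a. t \<in> K \<Longrightarrow> t \<noteq> 0 \<Longrightarrow> a \<in> K \<Longrightarrow> z (t\<^sup>2 * a) * t\<^sup>2 = z a"
    and a: "a \<in> K"
  shows "z a = 0"
proof (cases "(2::'a) = 0")
  case False
  \<comment> \<open>The first three factors give the coefficient of z a after clearing denominators;
    the factors x and x^2 - 1 keep x, x + 1 and x - 1 nonzero. The total degree is 9.\<close>
  define p where "p = [:2:] * [:1, 0, 1:] * [:-1, 0, 3, 0, -1:] * [:0, 1:] * [:-1, 0, 1::'a:]"
  have "p \<noteq> 0" using False unfolding p_def by simp
  moreover have "degree p \<le> 9" using False unfolding p_def by (simp add: degree_mult_eq)
  ultimately obtain x where x: "x \<in> K" "poly p x \<noteq> 0" using K_nonroot by blast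
  have "poly p x = 2 * (1 + x\<^sup>2) * (x\<^sup>2 - (x\<^sup>2 - 1)\<^sup>2) * x * (x\<^sup>2 - 1)"
    by (simp add: p_def algebra_simps power2_eq_square)
  then have nz: "2 * (1 + x\<^sup>2) * (x\<^sup>2 - (x\<^sup>2 - 1)\<^sup>2) \<noteq> 0" "x \<noteq> 0" "x\<^sup>2 \<noteq> 1" using x by auto
  then have nz': "x + 1 \<noteq> 0" "x - 1 \<noteq> 0"
    by (auto simp: add_eq_0_iff2 power2_eq_square)
  have xK: "x\<^sup>2 * a \<in> K" "(x + 1)\<^sup>2 * a \<in> K" "(x - 1)\<^sup>2 * a \<in> K" "x + 1 \<in> K" "x - 1 \<in> K" using x a by (auto intro!: K_intros)
  have "(x + 1)\<^sup>2 * a + (x - 1)\<^sup>2 * a = (x\<^sup>2 * a + x\<^sup>2 * a) + (a + a)" by (simp add: algebra_simps power2_eq_square)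
  then have "z ((x + 1)\<^sup>2 * a + (x - 1)\<^sup>2 * a) = z ((x\<^sup>2 * a + x\<^sup>2 * a) + (a + a))" by (rule arg_cong)
  then have e: "z ((x + 1)\<^sup>2 * a) + z ((x - 1)\<^sup>2 * a) = 2 * z (x\<^sup>2 * a) + 2 * z a"
    unfolding add[OF xK(2,3)] add[OF K_add[OF xK(1) xK(1)] K_add[OF a a]] add[OF xK(1) xK(1)] add[OF a a]
    by (simp only: mult_2)
  define u v w where "u = z ((x + 1)\<^sup>2 * a)" and "v = z ((x - 1)\<^sup>2 * a)" and "w = z (x\<^sup>2 * a)"
  have u: "u * (x + 1)\<^sup>2 = z a" and v: "v * (x - 1)\<^sup>2 = z a" and w: "w * x\<^sup>2 = z a"
    using weight[OF xK(4) nz'(1) a] weight[OF xK(5) nz'(2) a] weight[OF x(1) nz(2) a] by (auto simp: u_def v_def w_def)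
  have "u + v = 2 * w + 2 * z a" using e by (simp add: u_def v_def w_def)
  then have "(u + v) * (x\<^sup>2 * (x + 1)\<^sup>2 * (x - 1)\<^sup>2) = (2 * w + 2 * z a) * (x\<^sup>2 * (x + 1)\<^sup>2 * (x - 1)\<^sup>2)" by simp
  then have "x\<^sup>2 * (x - 1)\<^sup>2 * (u * (x + 1)\<^sup>2) + x\<^sup>2 * (x + 1)\<^sup>2 * (v * (x - 1)\<^sup>2)
      = (x + 1)\<^sup>2 * (x - 1)\<^sup>2 * (2 * (w * x\<^sup>2)) + 2 * z a * x\<^sup>2 * (x + 1)\<^sup>2 * (x - 1)\<^sup>2"
    by (simp only: algebra_simps)
  then have "2 * (1 + x\<^sup>2) * (x\<^sup>2 - (x\<^sup>2 - 1)\<^sup>2) * z a = 0"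
    unfolding u v w by (simp add: algebra_simps power2_eq_square)
  then show ?thesis using nz by simp
next
  case True
  \<comment> \<open>Here (1 + x)^2 = 1 + x^2 gives the relation directly, and the coefficient of z a
    becomes 1 + x^2 + x^4.\<close>
  define p where "p = [:1, 0, 1, 0, 1:] * [:0, 1:] * [:1, 1::'a:]"
  have "p \<noteq> 0" unfolding p_def by simp
  moreover have "degree p \<le> 9" unfolding p_def by (simp add: degree_mult_eq)
  ultimately obtain x where x: "x \<in> K" "poly p x \<noteq> 0" using K_nonroot by blast
  have "poly p x = (1 + x\<^sup>2 + x ^ 4) * x * (1 + x)"
    by (simp add: p_def algebra_simps power2_eq_square power4_eq_xxxx)
  also have "1 + x\<^sup>2 + x ^ 4 = (1 + x\<^sup>2) * (1 + x)\<^sup>2 - x\<^sup>2 - 2 * (x + x ^ 3)"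
    by (simp add: algebra_simps power2_eq_square power3_eq_cube power4_eq_xxxx)
  finally have nz: "(1 + x\<^sup>2) * (1 + x)\<^sup>2 - x\<^sup>2 \<noteq> 0" "x \<noteq> 0" "1 + x \<noteq> 0" using x True by auto
  have xK: "x\<^sup>2 * a \<in> K" "1 + x \<in> K" using x a by (auto intro!: K_intros)
  have "(1 + x)\<^sup>2 * a = a + x\<^sup>2 * a" using True by (simp add: power2_sum distrib_right)
  then have "z ((1 + x)\<^sup>2 * a) = z a + z (x\<^sup>2 * a)" using add[OF a xK(1)] by simp
  then have "z ((1 + x)\<^sup>2 * a) * (1 + x)\<^sup>2 * x\<^sup>2 = (z a + z (x\<^sup>2 * a)) * (1 + x)\<^sup>2 * x\<^sup>2" by simp
  then have "z ((1 + x)\<^sup>2 * a) * (1 + x)\<^sup>2 * x\<^sup>2 = z a * (1 + x)\<^sup>2 * x\<^sup>2 + z (x\<^sup>2 * a) * x\<^sup>2 * (1 + x)\<^sup>2"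
    by (simp only: algebra_simps)
  then have "((1 + x\<^sup>2) * (1 + x)\<^sup>2 - x\<^sup>2) * z a = 0"
    unfolding weight[OF xK(2) nz(3) a] weight[OF x(1) nz(2) a] by (simp add: algebra_simps power2_eq_square)
  then show ?thesis using nz by simp
qed

text \<open>Every a has the form (t^2 - 1) b for a fixed t with t^2 not 1, and z takes the same
  value at t^2 b and b.\<close>

lemma invariant_additive_zero:
  assumes add: "\<And>a b. a \<in> K \<Longrightarrow> b \<in> K \<Longrightarrow> z (a + b) = z a + z b"
    and weight: "\<And>t a. t \<in> K \<Longrightarrow> t \<noteq> 0 \<Longrightarrow> a \<in> K \<Longrightarrow> z (t\<^sup>2 * a) = z a"
    and a: "a \<in> K"
  shows "z a = (0::'a)"
proof -
  obtain t where t: "t \<in> K" "t \<noteq> 0" "t\<^sup>2 \<noteq> 1" using K_generic by blast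
  have s: "t\<^sup>2 - 1 \<in> K" "t\<^sup>2 - 1 \<noteq> 0" using t by (auto intro: K_intros)
  define b where "b = K_inv (t\<^sup>2 - 1) * a"
  have bK: "b \<in> K" using a s by (simp add: b_def K_mult K_inv_mem)
  have "(t\<^sup>2 - 1) * b = a" using K_inv_right[OF s] by (simp add: b_def flip: mult.assoc)
  then have "t\<^sup>2 * b = a + b" by (simp add: algebra_simps)
  then show ?thesis using weight[OF t(1,2) bK] add[OF a bK] by simp
qed

lemma teich_diff: "teich (x - y) = teich x - teich y"
proof -
  have "\<pi> dvd teich (x - y) - (x - y)" by (rule teich_cong)
  moreover have "\<pi> dvd (x - y) - (teich x - teich y)"
  proof -
    have "\<pi> dvd (teich y - y) - (teich x - x)" using teich_cong[of x] teich_cong[of y] by (rule dvd_diff[rotated])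
    then show ?thesis by (simp add: algebra_simps)
  qed
  ultimately have "\<pi> dvd teich (x - y) - (teich x - teich y)" by (rule dvd_diff_trans)
  then show ?thesis using K_cong_iff teich_mem K_diff by blast
qed

lemma teich_K: "x \<in> K \<Longrightarrow> teich x = x"
  using K_cong_iff[of "teich x" x] teich_mem teich_cong by blast

text \<open>The arguments where y agrees with its linear candidate are closed under differences and
  contain all squares, so \<open>square_multiples\<close> applies. The detour through
  \<open>teich\<close> turns them into a set of elements of R that is a union of residue
  classes.\<close>

lemma square_weight_linear:
  assumes add: "\<And>a b. a \<in> K \<Longrightarrow> b \<in> K \<Longrightarrow> y (a + b) = y a + (y b :: 'a)"
    and weight: "\<And>t a. t \<in> K \<Longrightarrow> t \<noteq> 0 \<Longrightarrow> a \<in> K \<Longrightarrow> y (t\<^sup>2 * a) = t\<^sup>2 * y a"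
    and a: "a \<in> K"
  shows "y a = a * y 1"
proof -
  have "y 0 = y 0 + y 0" using add[OF K_0 K_0] by (simp only: add_0)
  then have y0: "y 0 = 0" by (metis add_cancel_right_right)
  have ydiff: "y (a - b) = y a - y b" if "a \<in> K" "b \<in> K" for a b
    using add[of "a - b" b] that by (simp add: K_diff)
  have "1 * a \<in> {r. y (teich r) = teich r * y 1}"
  proof (rule square_multiples)
    fix r s assume "r \<in> {r. y (teich r) = teich r * y 1}" "s \<in> {r. y (teich r) = teich r * y 1}"
    then show "r - s \<in> {r. y (teich r) = teich r * y 1}" 
      by (simp add: teich_diff ydiff teich_mem left_diff_distrib)
  next
    fix r s assume "r \<in> {r. y (teich r) = teich r * y 1}" "\<pi> dvd r - s"
    moreover from this(2) have "teich (r - s) = 0"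
      using K_dvd_iff[OF teich_mem, of "r - s"] teich_cong[of "r - s"] dvd_diff_left_iff by blast
    ultimately show "s \<in> {r. y (teich r) = teich r * y 1}" by (simp add: teich_diff)
  next
    fix t assume t: "t \<in> K"
    then have "t\<^sup>2 \<in> K" by (rule K_power)
    then show "1 * t\<^sup>2 \<in> {r. y (teich r) = teich r * y 1}"
      using weight[OF t _ K_1] y0 by (cases "t = 0") (auto simp: teich_K)
  qed
  then show ?thesis using a by (simp add: teich_K)
qed

end

section \<open>Root elements in a group containing the diagonal torus\<close>

locale torus_extension = scalar_extension \<pi> G for \<pi> :: "'a::idom" and G :: "('a^'n^'n) set" +
  assumes torus_mem: "\<And>t. t \<in> K_tori \<Longrightarrow> diag_matrix t \<in> G"
begin

text \<open>With the entries of B in K, congruences modulo pi between such matrices become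
  equalities. So B is determined by the root element exactly up to a scalar matrix
  (\<open>lift_uniq\<close>).\<close>

definition lift :: "'n \<Rightarrow> 'n \<Rightarrow> 'a \<Rightarrow> 'a^'n^'n \<Rightarrow> bool" where
  "lift i j a B \<longleftrightarrow> over_K B \<and> (mat 1 + smul \<pi> B) ** transvection i j a \<in> G"

lemma lift_ex:
  assumes "i \<noteq> j"
  shows "\<exists>B. lift i j a B"
proof -
  obtain h where h: "h \<in> G" "mcong \<pi> h (transvection i j a)"
    using residual[of "transvection i j a"] assms by (auto simp: det_transvection)
  have "mcong \<pi> (h ** transvection i j (-a)) (transvection i j a ** transvection i j (-a))"
    by (intro mcong_mult h mcong_refl)
  then obtain X where X: "h ** transvection i j (-a) = mat 1 + smul \<pi> X"
    using assms by (auto simp: transvection_add mcong_iff_ex)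
  obtain B where B: "over_K B" "mcong \<pi> X B" using over_K_ex by blast
  have "h = h ** (transvection i j (-a) ** transvection i j a)" using assms by (simp add: transvection_add)
  also have "\<dots> = (mat 1 + smul \<pi> X) ** transvection i j a" by (simp add: matrix_mul_assoc X)
  also have "mcong (\<pi>\<^sup>2) \<dots> ((mat 1 + smul \<pi> B) ** transvection i j a)"
    using mcong_smul_scale[OF B(2), of \<pi>] by (intro mcong_mult mcong_add mcong_refl) (simp add: power2_eq_square)
  finally show ?thesis using sat h(1) B(1) by (auto simp: lift_def)
qed

lemma lift_uniq:
  assumes ij: "i \<noteq> j" and B: "lift i j a B" "lift i j a C"
  shows "\<exists>c. C = B + mat c"
proof -
  have "mcong \<pi> ((mat 1 + smul \<pi> B) ** transvection i j a) ((mat 1 + smul \<pi> C) ** transvection i j a)"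
    by (intro mcong_mult_right mcong_add mcong_refl) (simp add: mcong_def)
  then obtain c where "mcong (\<pi>\<^sup>2) ((mat 1 + smul \<pi> C) ** transvection i j a) (smul (1 + \<pi> * c) ((mat 1 + smul \<pi> B) ** transvection i j a))"
    using uniq B by (auto simp: lift_def)
  then have "mcong (\<pi>\<^sup>2) ((mat 1 + smul \<pi> C) ** transvection i j a ** transvection i j (-a)) (smul (1 + \<pi> * c) ((mat 1 + smul \<pi> B) ** transvection i j a) ** transvection i j (-a))"
    by (rule mcong_mult_right)
  then have m: "mcong (\<pi>\<^sup>2) (mat 1 + smul \<pi> C) (smul (1 + \<pi> * c) (mat 1 + smul \<pi> B))"
    using ij by (simp add: transvection_add smul_mult_left flip: matrix_mul_assoc)
  have "C = B + mat (teich c)"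
  proof (rule over_K_cong)
    show "over_K C" using B by (simp add: lift_def)
    show "over_K (B + mat (teich c))" using B by (auto simp: lift_def over_K_def mat_nth teich_mem intro!: K_intros)
    show "mcong \<pi> C (B + mat (teich c))"
    proof (rule mcongI)
      fix k l
      have "\<pi>\<^sup>2 dvd (mat 1 + smul \<pi> C) $ k $ l - smul (1 + \<pi> * c) (mat 1 + smul \<pi> B) $ k $ l"
        using m by (rule mcongD)
      also have "(mat 1 + smul \<pi> C) $ k $ l - smul (1 + \<pi> * c) (mat 1 + smul \<pi> B) $ k $ l
        = \<pi> * (C $ k $ l - B $ k $ l - (if k = l then c else 0) - \<pi> * (c * B $ k $ l))"
        by (simp add: mat_nth algebra_simps)
      finally have "\<pi> dvd C $ k $ l - B $ k $ l - (if k = l then c else 0) - \<pi> * (c * B $ k $ l)"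
        using pi_nz by (simp add: power2_eq_square)
      then have d: "\<pi> dvd C $ k $ l - B $ k $ l - (if k = l then c else 0)" by (simp add: dvd_diff_left_iff)
      have "\<pi> dvd (if k = l then c - teich c else 0)" using teich_cong dvd_diff_sym by auto
      from dvd_add[OF d this] show "\<pi> dvd C $ k $ l - (B + mat (teich c)) $ k $ l"
        by (auto simp: mat_nth algebra_simps split: if_splits)
    qed
  qed
  then show ?thesis by blast
qed

lemma one_plus_mult_cong: "mcong (\<pi>\<^sup>2) ((mat 1 + smul \<pi> B) ** (mat 1 + smul \<pi> C)) (mat 1 + smul \<pi> (B + C))"
proof -
  have "(mat 1 + smul \<pi> B) ** (mat 1 + smul \<pi> C) = mat 1 + smul \<pi> (B + C) + smul (\<pi>\<^sup>2) (B ** C)"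
    by (simp add: matrix_ring_simps power2_eq_square)
  then show ?thesis by (simp add: mcong_def)
qed

lemma lift_add:
  assumes ij: "i \<noteq> j" and a: "a \<in> K" and B: "lift i j a B" "lift i j b C"
  shows "lift i j (a + b) (B + transvection i j a ** C ** transvection i j (-a))"
proof -
  define x y where "x = transvection i j a" and "y = transvection i j (-a)"
  have yx: "y ** x = mat 1" using ij by (simp add: x_def y_def transvection_add)
  have "(mat 1 + smul \<pi> B) ** x ** ((mat 1 + smul \<pi> C) ** transvection i j b) \<in> G"
    using mult B by (simp add: lift_def x_def)
  also have "(mat 1 + smul \<pi> B) ** x ** ((mat 1 + smul \<pi> C) ** transvection i j b)
    = (mat 1 + smul \<pi> B) ** (x ** (mat 1 + smul \<pi> C) ** (y ** x)) ** transvection i j b"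
    by (simp add: yx matrix_mul_assoc)
  also have "x ** (mat 1 + smul \<pi> C) ** (y ** x) = (mat 1 + smul \<pi> (x ** C ** y)) ** x"
    by (simp add: matrix_ring_simps yx)
  also have "(mat 1 + smul \<pi> B) ** ((mat 1 + smul \<pi> (x ** C ** y)) ** x) ** transvection i j b
    = ((mat 1 + smul \<pi> B) ** (mat 1 + smul \<pi> (x ** C ** y))) ** transvection i j (a + b)"
    using ij by (simp add: x_def transvection_add flip: matrix_mul_assoc)
  finally have "(mat 1 + smul \<pi> (B + x ** C ** y)) ** transvection i j (a + b) \<in> G"
    using sat mcong_mult_right[OF one_plus_mult_cong] by blast
  moreover have "over_K (B + x ** C ** y)"
  proof -
    have "over_K (x ** C ** y)" using B a unfolding x_def y_def
      by (intro over_K_mult over_K_transvection K_uminus) (auto simp: lift_def)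
    then show ?thesis using B by (auto simp: lift_def over_K_def intro!: K_add)
  qed
  ultimately show ?thesis by (simp add: lift_def x_def y_def)
qed

lemma K_tori_inv:
  fixes t :: "'n \<Rightarrow> 'a"
  assumes t: "t \<in> K_tori"
  shows "(\<lambda>i. K_inv (t i)) \<in> K_tori"
proof -
  have "(\<Prod>i\<in>UNIV. t i * K_inv (t i)) = 1"
    using t K_inv_right by (intro prod.neutral) (simp add: K_tori_def)
  then have "prod t UNIV * prod (\<lambda>i. K_inv (t i)) UNIV = 1" by (simp only: prod.distrib)
  then show ?thesis using t by (auto simp: K_tori_def K_inv_mem K_inv_nz)
qed

lemma lift_torus:
  assumes ij: "i \<noteq> j" and t: "t \<in> K_tori" and a: "a \<in> K" and B: "lift i j a B"
  shows "lift i j (t i * K_inv (t j) * a) (diag_matrix t ** B ** diag_matrix (\<lambda>i. K_inv (t i)))"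
proof -
  define x y where "x = diag_matrix t" and "y = diag_matrix (\<lambda>i. K_inv (t i))"
  have tt: "t i \<in> K" "t i * K_inv (t i) = 1" "K_inv (t i) * t i = 1" for i 
    using t K_inv_right by (auto simp: K_tori_def mult.commute)
  have yx: "y ** x = mat 1" "x ** y = mat 1" 
    using tt by (auto simp: x_def y_def diag_matrix_mult intro!: matrix_eqI simp: entry_simps)
  have "x ** ((mat 1 + smul \<pi> B) ** transvection i j a) ** y \<in> G"
    unfolding x_def y_def using B by (intro mult[OF mult] torus_mem K_tori_inv t) (simp add: lift_def)
  also have "x ** ((mat 1 + smul \<pi> B) ** transvection i j a) ** y
    = x ** (mat 1 + smul \<pi> B) ** (y ** x) ** transvection i j a ** y"
    by (simp add: yx matrix_mul_assoc)
  also have "\<dots> = (x ** (mat 1 + smul \<pi> B) ** y) ** (x ** transvection i j a ** y)"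
    by (simp add: matrix_mul_assoc)
  also have "x ** (mat 1 + smul \<pi> B) ** y = mat 1 + smul \<pi> (x ** B ** y)"
    by (simp add: matrix_ring_simps yx)
  also have "x ** transvection i j a ** y = transvection i j (t i * K_inv (t j) * a)"
    using tt ij by (intro matrix_eqI) (auto simp: x_def y_def entry_simps)
  finally show ?thesis using B tt by (auto simp: lift_def x_def y_def over_K_def entry_simps K_inv_mem intro!: K_intros)
qed

lemma torus_K_tori: "(i::'n) \<noteq> j \<Longrightarrow> t \<in> K \<Longrightarrow> t \<noteq> 0 \<Longrightarrow> (\<lambda>k. if k = i then t else if k = j then K_inv t else 1) \<in> K_tori"
  using K_inv_right[of t] by (auto simp: K_tori_def prod_two K_inv_mem K_inv_nz K_1)

text \<open>Equal entries at i and j make this torus element commute with x_ij(a), while it scales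
  every entry that joins m to another index.\<close>

lemma K_tori_three:
  assumes "(i::'n) \<noteq> j" "m \<noteq> i" "m \<noteq> j" "t \<in> K" "t \<noteq> 0"
  shows "(\<lambda>k. if k = i \<or> k = j then t else if k = m then (K_inv t)\<^sup>2 else 1) \<in> K_tori"
proof -
  have "(\<Prod>k\<in>UNIV. if k = i \<or> k = j then t else if k = m then (K_inv t)\<^sup>2 else 1) = t * (t * ((K_inv t)\<^sup>2))"
    using assms
    by (subst prod.remove[of _ i], simp, simp, subst prod.remove[of _ j], simp, simp, subst prod.remove[of _ m])
       (auto intro!: prod.neutral)
  also have "\<dots> = (t * K_inv t)\<^sup>2" by (simp add: power2_eq_square ac_simps)
  finally show ?thesis using assms K_inv_right[of t] K_inv_nz[of t] by (auto simp: K_tori_def K_inv_mem intro!: K_intros)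
qed

text \<open>Equivariance under the torus leaves only the entries (i,j), (j,i) and the diagonal of a lift,
  and additivity then kills everything but a linear term in the entry (i,j).\<close>
lemma root_lift:
  assumes ij: "i \<noteq> j"
  shows "\<exists>y\<in>K. \<forall>a\<in>K. transvection i j ((1 + \<pi> * y) * a) \<in> G"
proof -
  obtain F where F: "\<And>a. lift i j a (F a)" using lift_ex[OF ij] by metis
  have FK: "F a $ k $ l \<in> K" for a k l using F[of a] by (auto simp: lift_def over_K_def)
  have "\<exists>c. F a + transvection i j a ** F b ** transvection i j (-a) = F (a + b) + mat c" if "a \<in> K" for a b
    using lift_uniq[OF ij F lift_add[OF ij that F F]] .
  then obtain c where c: "\<And>a b. a \<in> K \<Longrightarrow> F a + transvection i j a ** F b ** transvection i j (-a) = F (a + b) + mat (c a b)" by metis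
  have add: "F (a + b) $ k $ l + (if k = l then c a b else 0) = F a $ k $ l + F b $ k $ l + (if k = i then a * F b $ j $ l else 0) 
      - (if l = j then F b $ k $ i * a + (if k = i then a * F b $ j $ i * a else 0) else 0)" if "a \<in> K" for a b k l
  proof -
    have "(F a + transvection i j a ** F b ** transvection i j (-a)) $ k $ l = (F (a + b) + mat (c a b)) $ k $ l" using c[OF that] by simp
    then show ?thesis using ij by (auto simp: entry_simps algebra_simps split: if_splits)
  qed
  have "\<exists>d. diag_matrix t ** F a ** diag_matrix (\<lambda>i. K_inv (t i)) = F (t i * K_inv (t j) * a) + mat d" if "t \<in> K_tori" "a \<in> K" for t a
    using lift_uniq[OF ij F lift_torus[OF ij that F]] .
  then obtain d where d: "\<And>t a. t \<in> K_tori \<Longrightarrow> a \<in> K \<Longrightarrow> diag_matrix t ** F a ** diag_matrix (\<lambda>i. K_inv (t i)) = F (t i * K_inv (t j) * a) + mat (d t a)" by metis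
  have tor: "F (t i * K_inv (t j) * a) $ k $ l + (if k = l then d t a else 0) = t k * F a $ k $ l * K_inv (t l)" if "t \<in> K_tori" "a \<in> K" for t a k l
  proof -
    have "(diag_matrix t ** F a ** diag_matrix (\<lambda>i. K_inv (t i))) $ k $ l = (F (t i * K_inv (t j) * a) + mat (d t a)) $ k $ l" using d[OF that] by simp
    then show ?thesis by (simp add: entry_simps split: if_splits)
  qed
  have KK: "K_inv (K_inv t) = t" if "t \<in> K" "t \<noteq> 0" for t
    using K_inv_right[OF that] K_inv_right[OF K_inv_mem[OF that(1)] K_inv_nz[OF that]] that
    by (metis mult.assoc mult.commute mult_1)
  have tor2: "F (t\<^sup>2 * a) $ k $ l + (if k = l then d (\<lambda>k. if k = i then t else if k = j then K_inv t else 1) a else 0)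
      = (if k = i then t else if k = j then K_inv t else 1) * F a $ k $ l * (if l = i then K_inv t else if l = j then t else 1)"
    if "t \<in> K" "t \<noteq> 0" "a \<in> K" for t a k l
    using tor[OF torus_K_tori[OF ij that(1,2)] that(3), of k l] ij KK[OF that(1,2)]
    by (auto simp: power2_eq_square K_inv_1 split: if_splits)
  have z: "F a $ j $ i = 0" if "a \<in> K" for a
  proof (rule inverse_square_weight_zero[OF _ _ that, where z = "\<lambda>a. F a $ j $ i"])
    show "F (a + b) $ j $ i = F a $ j $ i + F b $ j $ i" if "a \<in> K" "b \<in> K" for a b
      using add[OF that(1), of b j i] ij by simp
    show "F (t\<^sup>2 * a) $ j $ i * t\<^sup>2 = F a $ j $ i" if "t \<in> K" "t \<noteq> 0" "a \<in> K" for t a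
    proof -
      have "F (t\<^sup>2 * a) $ j $ i * t\<^sup>2 = F a $ j $ i * (t * K_inv t)\<^sup>2"
        using tor2[OF that, of j i] ij by (simp add: power2_eq_square ac_simps)
      then show ?thesis using K_inv_right that by simp
    qed
  qed
  \<comment> \<open>The torus element s fixes a, so the entry (k,l) equals itself times s_k / s_l,
    which is t^3, t^(-3) or t^(-2).\<close>
  have off: "F a $ k $ l = 0" if a: "a \<in> K" and kl: "k \<noteq> l" "(k, l) \<noteq> (i, j)" "(k, l) \<noteq> (j, i)" for a k l
  proof -
    obtain t where t: "t \<in> K" "t \<noteq> 0" "t ^ 2 \<noteq> 1" "t ^ 3 \<noteq> 1" using K_generic by blast
    define m where "m = (if k \<noteq> i \<and> k \<noteq> j then k else l)"
    have m: "m \<noteq> i" "m \<noteq> j" using kl by (auto simp: m_def split: if_splits)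
    define s where "s = (\<lambda>k. if k = i \<or> k = j then t else if k = m then (K_inv t)\<^sup>2 else 1)"
    have s: "s \<in> K_tori" unfolding s_def by (rule K_tori_three) (use ij m t in auto)
    have sij: "s i * K_inv (s j) * a = a" using t K_inv_right by (simp add: s_def)
    then have "F a $ k $ l = s k * F a $ k $ l * K_inv (s l)" using tor[OF s a, of k l] kl(1) unfolding sij by simp
    moreover have "K_inv (s l) * s l = 1" using K_inv_right s by (simp add: K_tori_def mult.commute)
    ultimately have e: "F a $ k $ l * s l = s k * F a $ k $ l" by (metis mult.assoc mult_1_right)
    have tt: "t * K_inv t = 1" using t K_inv_right by blast
    then have t22: "t\<^sup>2 * (K_inv t)\<^sup>2 = 1" by (simp flip: power_mult_distrib)
    have "F a $ k $ l * (t ^ 3 - 1) = 0 \<or> F a $ k $ l * (t ^ 2 - 1) = 0"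
    proof (cases "k \<noteq> i \<and> k \<noteq> j")
      case True
      then have sk: "s k = (K_inv t)\<^sup>2" by (simp add: s_def m_def)
      have "t\<^sup>2 * (F a $ k $ l * s l) = (t\<^sup>2 * (K_inv t)\<^sup>2) * F a $ k $ l" unfolding e sk by (simp only: ac_simps)
      then have e': "t\<^sup>2 * (F a $ k $ l * s l) = F a $ k $ l" by (simp add: t22)
      show ?thesis
      proof (cases "l = i \<or> l = j")
        case True
        then have "t ^ 3 * F a $ k $ l = F a $ k $ l" using e' by (simp add: s_def power3_eq_cube power2_eq_square ac_simps)
        then show ?thesis by (simp add: algebra_simps)
      next
        case False
        then have "t ^ 2 * F a $ k $ l = F a $ k $ l" using e' True kl by (simp add: s_def m_def)
        then show ?thesis by (simp add: algebra_simps)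
      qed
    next
      case False
      then have "s k = t" "s l = (K_inv t)\<^sup>2" using m by (auto simp: s_def m_def)
      then have "t\<^sup>2 * (F a $ k $ l * (K_inv t)\<^sup>2) = t\<^sup>2 * (t * F a $ k $ l)" using e by simp
      then have "(t\<^sup>2 * (K_inv t)\<^sup>2) * F a $ k $ l = t ^ 3 * F a $ k $ l"
        by (simp only: power3_eq_cube power2_eq_square ac_simps)
      then show ?thesis by (simp add: t22 algebra_simps)
    qed
    then show ?thesis using t by auto
  qed
  \<comment> \<open>Differences of diagonal entries are free of the scalar ambiguities c and d. They
    are additive because the entry (j,i) is already known to vanish.\<close>
  have diag: "F a $ k $ k = F a $ i $ i" if "a \<in> K" for a k
  proof -
    have "F a $ k $ k - F a $ i $ i = 0"
    proof (rule invariant_additive_zero[OF _ _ that, where z = "\<lambda>a. F a $ k $ k - F a $ i $ i"])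
      show "F (a + b) $ k $ k - F (a + b) $ i $ i = (F a $ k $ k - F a $ i $ i) + (F b $ k $ k - F b $ i $ i)" if "a \<in> K" "b \<in> K" for a b
      proof -
        have "F (a + b) $ k $ k = F a $ k $ k + F b $ k $ k - c a b" for k
          using add[OF that(1), of b k k] ij z[OF that(2)] by (auto simp: eq_diff_eq split: if_splits)
        then show ?thesis by simp
      qed
      show "F (t\<^sup>2 * a) $ k $ k - F (t\<^sup>2 * a) $ i $ i = F a $ k $ k - F a $ i $ i" if "t \<in> K" "t \<noteq> 0" "a \<in> K" for t a
      proof -
        have [simp]: "t * K_inv t = 1" "K_inv t * t = 1" using K_inv_right that by (auto simp: mult.commute)
        then have [simp]: "t * x * K_inv t = x" "K_inv t * x * t = x" for x 
          by (metis mult.assoc mult.commute mult_1)+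
        have "F (t\<^sup>2 * a) $ k $ k = F a $ k $ k - d (\<lambda>k. if k = i then t else if k = j then K_inv t else 1) a" for k
          using tor2[OF that, of k k] ij by (auto simp: eq_diff_eq split: if_splits)
        then show ?thesis by simp
      qed
    qed
    then show ?thesis by simp
  qed
  define y where "y = F 1 $ i $ j"
  \<comment> \<open>The cross terms in the entry (i,j) involve the difference of the diagonal
    entries j and i and the entry (j,i) of \<open>F b\<close>, both now known to be 0.\<close>
  have lin: "F a $ i $ j = a * y" if "a \<in> K" for a
    unfolding y_def
  proof (rule square_weight_linear[OF _ _ that, where y = "\<lambda>a. F a $ i $ j"])
    show "F (a + b) $ i $ j = F a $ i $ j + F b $ i $ j" if "a \<in> K" "b \<in> K" for a b
      using add[OF that(1), of b i j] ij z[OF that(2)] diag[OF that(2), of j] by (simp add: algebra_simps)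
    show "F (t\<^sup>2 * a) $ i $ j = t\<^sup>2 * F a $ i $ j" if "t \<in> K" "t \<noteq> 0" "a \<in> K" for t a
      using tor2[OF that, of i j] ij by (simp add: power2_eq_square ac_simps)
  qed
  have "transvection i j ((1 + \<pi> * y) * a) \<in> G" if a: "a \<in> K" for a
  proof -
    define e where "e = F a $ i $ i"
    have Fa: "F a = mat e + smul (a * y) (elem_mat i j)"
      using off[OF a] z[OF a] diag[OF a] lin[OF a] ij
      by (intro matrix_eqI) (auto simp: entry_simps e_def)
    have "mcong (\<pi>\<^sup>2) ((mat 1 + smul \<pi> (F a)) ** transvection i j a) (smul (1 + \<pi> * e) (transvection i j ((1 + \<pi> * y) * a)))"
    proof (rule mcongI)
      fix k l
      have "((mat 1 + smul \<pi> (F a)) ** transvection i j a) $ k $ l - smul (1 + \<pi> * e) (transvection i j ((1 + \<pi> * y) * a)) $ k $ l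
        = (if k = i \<and> l = j then - (\<pi>\<^sup>2 * (e * y * a)) else 0)"
        using ij unfolding Fa by (auto simp: entry_simps algebra_simps power2_eq_square)
      then show "\<pi>\<^sup>2 dvd ((mat 1 + smul \<pi> (F a)) ** transvection i j a) $ k $ l - smul (1 + \<pi> * e) (transvection i j ((1 + \<pi> * y) * a)) $ k $ l"
        by simp
    qed
    moreover have "(mat 1 + smul \<pi> (F a)) ** transvection i j a \<in> G" using F[of a] by (simp add: lift_def)
    ultimately show ?thesis using descale[OF sat] by blast
  qed
  moreover have "y \<in> K" using FK by (simp add: y_def)
  ultimately show ?thesis by blast
qed

end


section \<open>Relations between the lifted root elements\<close>

context torus_extension
begin

text \<open>The scalar that \<open>uniq\<close> leaves open is trivial modulo pi^2, as both matrices
  have the diagonal entry 1.\<close>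

lemma transvection_mem_uniq:
  assumes ij: "i \<noteq> j" and G: "transvection i j a \<in> G" "transvection i j b \<in> G" and ab: "\<pi> dvd a - b"
  shows "\<pi>\<^sup>2 dvd a - b"
proof -
  obtain c where c: "mcong (\<pi>\<^sup>2) (transvection i j b) (smul (1 + \<pi> * c) (transvection i j a))"
    using uniq[OF G transvection_mcong[OF ab]] by blast
  have "\<pi>\<^sup>2 dvd - (\<pi> * c)" using mcongD[OF c, of i i] ij by (simp add: entry_simps)
  then have 1: "\<pi>\<^sup>2 dvd \<pi> * c" by simp
  have "\<pi>\<^sup>2 dvd b - (1 + \<pi> * c) * a" using mcongD[OF c, of i j] ij by (simp add: entry_simps)
  then have "\<pi>\<^sup>2 dvd (b - (1 + \<pi> * c) * a) + \<pi> * c * a" using 1 by (intro dvd_add) auto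
  then have "\<pi>\<^sup>2 dvd b - a" by (simp add: algebra_simps)
  then show ?thesis by (rule dvd_diff_sym)
qed

lemma pi_mult_sq_dvd: "\<pi>\<^sup>2 dvd \<pi> * x \<longleftrightarrow> \<pi> dvd x"
  using pi_nz by (simp add: power2_eq_square)

text \<open>The commutator of x_ij(a) and x_jl(b) is x_il(ab), and (1 + pi y1)(1 + pi y2) has the
  first-order term y1 + y2.\<close>

lemma root_cocycle:
  fixes i j l :: 'n
  assumes ijl: "i \<noteq> j" "j \<noteq> l" "i \<noteq> l" and y: "y1 \<in> K" "y2 \<in> K" "y3 \<in> K"
    and G: "\<And>a. a \<in> K \<Longrightarrow> transvection i j ((1 + \<pi> * y1) * a) \<in> G"
      "\<And>a. a \<in> K \<Longrightarrow> transvection j l ((1 + \<pi> * y2) * a) \<in> G"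
      "\<And>a. a \<in> K \<Longrightarrow> transvection i l ((1 + \<pi> * y3) * a) \<in> G"
  shows "y3 = y1 + y2"
proof -
  define a b where "a = (1 + \<pi> * y1)" and "b = (1 + \<pi> * y2)"
  have "transvection i j a ** transvection j l b ** transvection i j (-a) ** transvection j l (-b) \<in> G"
    using G(1)[OF K_1] G(1)[OF K_uminus[OF K_1]] G(2)[OF K_1] G(2)[OF K_uminus[OF K_1]]
    by (intro mult) (simp_all add: a_def b_def)
  also have "transvection i j a ** transvection j l b ** transvection i j (-a) ** transvection j l (-b) = transvection i l (a * b)"
    using ijl by (intro matrix_eqI) (auto simp: entry_simps)
  finally have 1: "transvection i l (a * b) \<in> G" .
  have e: "a * b - (1 + \<pi> * y3) = \<pi> * (y1 + y2 - y3 + \<pi> * (y1 * y2))"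
    by (simp add: a_def b_def algebra_simps)
  have "\<pi>\<^sup>2 dvd a * b - (1 + \<pi> * y3)"
    using G(3)[OF K_1] ijl by (intro transvection_mem_uniq[OF _ 1]) (auto simp: e)
  then have "\<pi> dvd y1 + y2 - y3" unfolding e pi_mult_sq_dvd by (simp add: dvd_add_left_iff)
  then show ?thesis using K_cong_iff[of "y1 + y2" y3] y K_add by simp
qed

text \<open>Both sides of $x(a)y(b) = y(b/(1+ab))\,\mathrm{diag}(1+ab, (1+ab)^{-1})\,x(a/(1+ab))$ for
  opposite root groups x and y are lifted, with $a = 1$.\<close>
lemma root_opposite:
  fixes i j :: 'n
  assumes ij: "i \<noteq> j" and y: "y1 \<in> K" "y2 \<in> K"
    and G: "\<And>a. a \<in> K \<Longrightarrow> transvection i j ((1 + \<pi> * y1) * a) \<in> G"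
      "\<And>a. a \<in> K \<Longrightarrow> transvection j i ((1 + \<pi> * y2) * a) \<in> G"
  shows "y1 + y2 = 0"
proof -
  \<comment> \<open>Both b and 1 + b have to be units: 1 + b is the torus entry, and b is cancelled
    at the end.\<close>
  obtain b where b: "b \<in> K" "b \<noteq> 0" "1 + b \<noteq> 0"
  proof -
    obtain t where "t \<in> K" "t \<noteq> 0" "t\<^sup>2 \<noteq> 1" using K_generic by blast
    then show ?thesis by (intro that[of t]) (auto simp: add_eq_0_iff power2_eq_square)
  qed
  define d where "d = 1 + b"
  define v where "v = K_inv d"
  have d: "d \<in> K" "d \<noteq> 0" "d * v = 1" "v \<in> K" using b K_inv_right by (auto simp: d_def v_def intro!: K_inv_mem K_intros)
  have vb: "v * b = 1 - v" using d(3) by (simp add: d_def algebra_simps)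
  define \<alpha> \<beta> where "\<alpha> = 1 + \<pi> * y1" and "\<beta> = 1 + \<pi> * y2"
  define M1 where "M1 = transvection i j \<alpha> ** transvection j i (\<beta> * b)"
  define M2 where "M2 = transvection j i (\<beta> * (b * v)) ** torus i j d v ** transvection i j (\<alpha> * v)"
  have "torus i j d v \<in> G" unfolding torus_def v_def by (intro torus_mem torus_K_tori ij d)
  then have M2: "M2 \<in> G" unfolding M2_def \<alpha>_def \<beta>_def using d b by (intro mult G K_mult)
  have M1: "M1 \<in> G" unfolding M1_def using G(1)[OF K_1] G(2)[OF b(1)] by (intro mult) (auto simp: \<alpha>_def \<beta>_def)
  have m1: "M1 $ k $ l = (if k = i \<and> l = i then 1 + \<alpha> * \<beta> * b else if k = i \<and> l = j then \<alpha> else 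
     if k = j \<and> l = i then \<beta> * b else if k = l then 1 else 0)" for k l
    using ij by (auto simp: M1_def entry_simps)
  have vd: "v * d = 1" using d(3) by (simp add: mult.commute)
  have dv: "x * v * d = x" "d * (x * v) = x" "d * (v * x) = x" for x using d(3) by (metis mult.assoc mult.commute mult_1)+
  have m2: "M2 $ k $ l = (if k = i \<and> l = i then d else if k = i \<and> l = j then \<alpha> else 
     if k = j \<and> l = i then \<beta> * b else if k = j \<and> l = j then v + \<alpha> * \<beta> * (b * v) else if k = l then 1 else 0)" for k l
    using ij by (auto simp: M2_def torus_def entry_simps dv d(3) vd mult.assoc)
  have ab: "\<alpha> * \<beta> - 1 = \<pi> * (y1 + y2 + \<pi> * (y1 * y2))" by (simp add: \<alpha>_def \<beta>_def algebra_simps)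
  have "mcong \<pi> M2 M1"
  proof (rule mcongI)
    fix k l
    have e1: "d - (1 + \<alpha> * \<beta> * b) = - ((\<alpha> * \<beta> - 1) * b)" by (simp add: d_def algebra_simps)
    have 1: "\<pi> dvd d - (1 + \<alpha> * \<beta> * b)" unfolding e1 ab by simp
    have e2: "v + \<alpha> * \<beta> * (b * v) - 1 = (\<alpha> * \<beta> - 1) * (b * v)" using vb by (simp add: algebra_simps)
    have 2: "\<pi> dvd v + \<alpha> * \<beta> * (b * v) - 1" unfolding e2 ab by simp
    show "\<pi> dvd M2 $ k $ l - M1 $ k $ l"
      unfolding m1 m2 using ij
      by (cases "k = i"; cases "l = i"; cases "k = j"; cases "l = j") (simp_all only: if_True if_False simp_thms 1 2 diff_self dvd_0_right HOL.refl ij ij[symmetric])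
  qed
  \<comment> \<open>The entry (i,j) is the unit \<alpha> on both sides, so pi divides c. The entry
    (i,i) then compares \<alpha> \<beta> b with b and yields y1 + y2.\<close>
  then obtain c where c: "mcong (\<pi>\<^sup>2) M1 (smul (1 + \<pi> * c) M2)" using uniq[OF M2 M1] by blast
  have "\<pi>\<^sup>2 dvd \<alpha> - (1 + \<pi> * c) * \<alpha>" using mcongD[OF c, of i j] ij by (simp add: m1 m2)
  also have "\<alpha> - (1 + \<pi> * c) * \<alpha> = \<pi> * - (c + \<pi> * (c * y1))" by (simp add: \<alpha>_def algebra_simps)
  finally have "\<pi> dvd c + \<pi> * (c * y1)" unfolding pi_mult_sq_dvd by (simp only: dvd_minus_iff)
  then have \<pi>c: "\<pi> dvd c" by (simp add: dvd_add_left_iff)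
  have "\<pi>\<^sup>2 dvd (1 + \<alpha> * \<beta> * b) - (1 + \<pi> * c) * d" using mcongD[OF c, of i i] ij by (simp add: m1 m2)
  also have "(1 + \<alpha> * \<beta> * b) - (1 + \<pi> * c) * d = \<pi> * ((y1 + y2) * b + \<pi> * (y1 * y2 * b) - c * d)"
    using ab by (simp add: d_def \<alpha>_def \<beta>_def algebra_simps)
  finally have "\<pi> dvd (y1 + y2) * b + \<pi> * (y1 * y2 * b) - c * d" unfolding pi_mult_sq_dvd .
  then have "\<pi> dvd (y1 + y2) * b" using \<pi>c by (simp add: dvd_diff_left_iff dvd_add_left_iff)
  moreover have "\<not> \<pi> dvd b" using b K_dvd_iff by blast
  ultimately have "\<pi> dvd y1 + y2" using pi_prime by blast
  then show ?thesis using K_dvd_iff[OF K_add[OF y]] by simp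
qed

lemma transvection_conjugation:
  "\<exists>P P' :: 'a^'n^'n. mcong (\<pi>\<^sup>2) (P ** P') (mat 1) \<and> mcong (\<pi>\<^sup>2) (P' ** P) (mat 1) \<and>
    (\<forall>i j. \<forall>a\<in>K. i \<noteq> j \<longrightarrow> P ** transvection i j a ** P' \<in> G)"
proof -
  have "\<forall>i j. \<exists>y. i \<noteq> j \<longrightarrow> y \<in> K \<and> (\<forall>a\<in>K. transvection i j ((1 + \<pi> * y) * a) \<in> G)"
    using root_lift by blast
  then obtain y where yK: "\<And>i j. i \<noteq> j \<Longrightarrow> y i j \<in> K" 
    and y: "\<And>i j a. i \<noteq> j \<Longrightarrow> a \<in> K \<Longrightarrow> transvection i j ((1 + \<pi> * y i j) * a) \<in> G" by metis
  obtain o' :: 'n where True by blast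
  \<comment> \<open>The additive cocycle y is the coboundary of its values against a base index o'.
    Modulo pi^2, conjugation by diag(1 + pi g) multiplies the entry (i,j) by 1 + pi (g i - g
    j).\<close>
  define g where "g k = (if k = o' then 0 else y k o')" for k
  have opp: "y i j + y j i = 0" if "i \<noteq> j" for i j
    using that yK y by (intro root_opposite[of i j]) auto
  have coc: "y i l = y i j + y j l" if "i \<noteq> j" "j \<noteq> l" "i \<noteq> l" for i j l
    using that yK y by (intro root_cocycle[of i j l]) auto
  have yg: "y i j = g i - g j" if ij: "i \<noteq> j" for i j
  proof -
    consider "i = o'" | "j = o'" | "i \<noteq> o'" "j \<noteq> o'" by blast
    then show ?thesis
    proof cases
      case 1
      then show ?thesis using opp[OF ij] ij by (simp add: g_def eq_neg_iff_add_eq_0)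
    next
      case 2
      then show ?thesis using ij by (simp add: g_def)
    next
      case 3
      then show ?thesis using coc[of i j o'] ij by (simp add: g_def)
    qed
  qed
  define P P' where "P = diag_matrix (\<lambda>k. 1 + \<pi> * g k)" and "P' = diag_matrix (\<lambda>k. 1 - \<pi> * g k)"
  have pp: "(1 + \<pi> * g k) * (1 - \<pi> * g k) - 1 = \<pi>\<^sup>2 * (- (g k)\<^sup>2)" for k by (simp add: algebra_simps power2_eq_square)
  have "\<pi>\<^sup>2 dvd (1 + \<pi> * g k) * (1 - \<pi> * g k) - 1" for k unfolding pp by (rule dvd_triv_left)
  then have PP: "mcong (\<pi>\<^sup>2) (P ** P') (mat 1)" "mcong (\<pi>\<^sup>2) (P' ** P) (mat 1)"
    by (auto simp: P_def P'_def diag_matrix_mult mcong_def diag_matrix_nth mat_nth mult.commute)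
  have "P ** transvection i j a ** P' \<in> G" if ij: "i \<noteq> j" and a: "a \<in> K" for i j a
  proof (rule sat[OF y[OF ij a]])
    have 1: "\<pi>\<^sup>2 dvd 1 - (1 + \<pi> * g k) * (1 - \<pi> * g k)" for k
      using \<open>\<And>k. \<pi>\<^sup>2 dvd (1 + \<pi> * g k) * (1 - \<pi> * g k) - 1\<close> dvd_diff_sym by blast
    have "(1 + \<pi> * y i j) * a - (1 + \<pi> * g i) * a * (1 - \<pi> * g j) = \<pi>\<^sup>2 * (a * g i * g j)"
      unfolding yg[OF ij] by (simp add: algebra_simps power2_eq_square)
    then have 2: "\<pi>\<^sup>2 dvd (1 + \<pi> * y i j) * a - (1 + \<pi> * g i) * a * (1 - \<pi> * g j)" by simp
    show "mcong (\<pi>\<^sup>2) (transvection i j ((1 + \<pi> * y i j) * a)) (P ** transvection i j a ** P')"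
    proof (rule mcongI)
      fix k l
      show "\<pi>\<^sup>2 dvd transvection i j ((1 + \<pi> * y i j) * a) $ k $ l - (P ** transvection i j a ** P') $ k $ l"
        using ij 1[of k] 2 by (cases "k = l"; cases "k = i \<and> l = j") (simp_all add: P_def P'_def diag_mult_nth mult_diag_nth transvection_nth, auto)
    qed
  qed
  then show ?thesis using PP by blast
qed

end

section \<open>Conjugation of the whole group into matrices over K, up to scalars\<close>

context scalar_extension
begin

lemma conjugate_into_K:
  "\<exists>P P' :: 'a^'n^'n. mcong (\<pi>\<^sup>2) (P ** P') (mat 1) \<and> mcong (\<pi>\<^sup>2) (P' ** P) (mat 1) \<and>
    (\<forall>i j. \<forall>a\<in>K. i \<noteq> j \<longrightarrow> P ** transvection i j a ** P' \<in> G) \<and>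
    (\<forall>M\<in>G. \<exists>g c. over_K g \<and> mcong (\<pi>\<^sup>2) M (smul (1 + \<pi> * c) (P ** g ** P')))"
proof -
  obtain T T' :: "'a^'n^'n" where T: "mcong (\<pi>\<^sup>2) (T ** T') (mat 1)" "mcong (\<pi>\<^sup>2) (T' ** T) (mat 1)"
    "\<And>t. t \<in> K_tori \<Longrightarrow> T ** diag_matrix t ** T' \<in> G" using torus_conjugation by blast
  interpret c: scalar_extension \<pi> "{M. T ** M ** T' \<in> G}" by (rule conj_locale[OF T(1,2)])
  interpret c: torus_extension \<pi> "{M. T ** M ** T' \<in> G}" by unfold_locales (use T(3) in auto)
  obtain U U' :: "'a^'n^'n" where U: "mcong (\<pi>\<^sup>2) (U ** U') (mat 1)" "mcong (\<pi>\<^sup>2) (U' ** U) (mat 1)"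
    "\<And>i j a. a \<in> K \<Longrightarrow> i \<noteq> j \<Longrightarrow> U ** transvection i j a ** U' \<in> {M. T ** M ** T' \<in> G}" using c.transvection_conjugation by blast
  define P P' where "P = T ** U" and "P' = U' ** T'"
  have "mcong (\<pi>\<^sup>2) (T ** (U ** U') ** T') (T ** mat 1 ** T')" by (intro mcong_mult U mcong_refl)
  also have "mcong (\<pi>\<^sup>2) (T ** mat 1 ** T') (mat 1)" using T(1) by simp
  finally have PP: "mcong (\<pi>\<^sup>2) (P ** P') (mat 1)" by (simp add: P_def P'_def matrix_mul_assoc)
  have "mcong (\<pi>\<^sup>2) (U' ** (T' ** T) ** U) (U' ** mat 1 ** U)" by (intro mcong_mult T mcong_refl)
  also have "mcong (\<pi>\<^sup>2) (U' ** mat 1 ** U) (mat 1)" using U(2) by simp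
  finally have PP': "mcong (\<pi>\<^sup>2) (P' ** P) (mat 1)" by (simp add: P_def P'_def matrix_mul_assoc)
  have tv: "P ** transvection i j a ** P' \<in> G" if "a \<in> K" "i \<noteq> j" for i j a
    using U(3)[OF that] by (simp add: P_def P'_def matrix_mul_assoc)
  interpret p: scalar_extension \<pi> "{M. P ** M ** P' \<in> G}" by (rule conj_locale[OF PP PP'])
  \<comment> \<open>Elimination works with matrices over R, so membership is phrased through
    reductions: a matrix belongs to S if its representative over K lies in the conjugated
    group.\<close>
  define S where "S = {M. \<exists>g. over_K g \<and> mcong \<pi> g M \<and> P ** g ** P' \<in> G}"
  have SL: "SL \<subseteq> S"
  proof (rule SL_subset_if_transvections[OF unif _ _ two])
    fix A B assume "A \<in> S" "B \<in> S"
    then obtain g h where "over_K g" "mcong \<pi> g A" "P ** g ** P' \<in> G" "over_K h" "mcong \<pi> h B" "P ** h ** P' \<in> G"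
      by (auto simp: S_def)
    then show "A ** B \<in> S" unfolding S_def using p.mult[of g h] by (auto intro!: exI[of _ "g ** h"] over_K_mult mcong_mult)
  next
    fix i j :: 'n and a assume "i \<noteq> j"
    then show "transvection i j a \<in> S"
      unfolding S_def using tv[OF teich_mem[of a]]
      by (auto intro!: exI[of _ "transvection i j (teich a)"] over_K_transvection teich_mem transvection_mcong teich_cong)
  qed
  have "\<exists>g c. over_K g \<and> mcong (\<pi>\<^sup>2) M (smul (1 + \<pi> * c) (P ** g ** P'))" if M: "M \<in> G" for M
  proof -
    have 1: "mcong (\<pi>\<^sup>2) (P ** (P' ** M ** P) ** P') M"
    proof -
      have "mcong (\<pi>\<^sup>2) ((P ** P') ** M ** (P ** P')) (mat 1 ** M ** mat 1)" by (intro mcong_mult PP mcong_refl)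
      then show ?thesis by (simp add: matrix_mul_assoc)
    qed
    then have "P' ** M ** P \<in> {M. P ** M ** P' \<in> G}" using sat[OF M mcong_sym] by simp
    then have "\<pi> dvd det (P' ** M ** P) - 1" by (rule p.det_cong)
    then obtain N where N: "det N = 1" "mcong \<pi> N (P' ** M ** P)" using normalize_det by blast
    then obtain g where g: "over_K g" "mcong \<pi> g N" "P ** g ** P' \<in> G" using SL by (auto simp: SL_def S_def)
    have "mcong \<pi> (P ** g ** P') (P ** (P' ** M ** P) ** P')"
      by (intro mcong_mult mcong_refl mcong_trans[OF g(2) N(2)])
    then have "mcong \<pi> (P ** g ** P') M" using mcong_sq[OF 1] mcong_trans by blast
    then show ?thesis using uniq[OF g(3) M] g(1) by blast
  qed
  then show ?thesis using PP PP' tv by blast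
qed

end


section \<open>The derived group\<close>

lemma matrix_inv_both:
  assumes "invertible (A :: 'a::comm_ring_1^'n^'n)"
  shows "A ** matrix_inv A = mat 1" "matrix_inv A ** A = mat 1"
proof -
  have "A ** matrix_inv A = mat 1 \<and> matrix_inv A ** A = mat 1"
    unfolding matrix_inv_def by (rule someI_ex) (use assms in \<open>simp add: invertible_def\<close>)
  then show "A ** matrix_inv A = mat 1" "matrix_inv A ** A = mat 1" by auto
qed

text \<open>As a representation, gl_n is the standard representation tensored with its dual. In this
  form scalar factors of h visibly cancel.\<close>

lemma trace_Ad_eq: "trace_Ad h = trace h * trace (matrix_inv h)"
proof -
  have "(h ** elem_mat i j ** matrix_inv h) $ i $ j = h $ i $ i * matrix_inv h $ j $ j" for i j
  proof -
    have "(h ** elem_mat i j ** matrix_inv h) $ i $ j = (\<Sum>k\<in>UNIV. if k = j then h $ i $ i * matrix_inv h $ k $ j else 0)"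
      unfolding matrix_mult_nth[of "h ** elem_mat i j"] by (intro sum.cong) (auto simp: entry_simps)
    then show ?thesis by simp
  qed
  then show ?thesis by (simp add: trace_Ad_def Ad_def trace_def sum_product)
qed

context
  fixes H :: "('a::comm_ring_1^'n^'n) set"
  assumes H_GL: "H \<subseteq> GL"
    and H_mult: "\<And>g h. g \<in> H \<Longrightarrow> h \<in> H \<Longrightarrow> g ** h \<in> H"
    and H_inv: "\<And>h. h \<in> H \<Longrightarrow> matrix_inv h \<in> H"
    and H_one: "mat 1 \<in> H"
begin

lemma H_inverse: "h \<in> H \<Longrightarrow> h ** matrix_inv h = mat 1" "h \<in> H \<Longrightarrow> matrix_inv h ** h = mat 1"
  using H_GL matrix_inv_both by (auto simp: GL_def)

lemma derived_subgroup_subset: "d \<in> derived_subgroup H \<Longrightarrow> d \<in> H"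
  by (induction rule: derived_subgroup.induct) (auto intro: H_mult H_inv H_one)

lemma derived_subgroup_det: "d \<in> derived_subgroup H \<Longrightarrow> det d = 1"
proof (induction rule: derived_subgroup.induct)
  case (comm g h)
  have "det g * det (matrix_inv g) = 1" "det h * det (matrix_inv h) = 1"
    using H_inverse comm by (simp_all flip: det_mul)
  then have "(det g * det (matrix_inv g)) * (det h * det (matrix_inv h)) = 1" by simp
  then show ?case by (simp add: det_mul ac_simps)
next
  case (inv a)
  have "det a * det (matrix_inv a) = 1"
    using H_inverse[OF derived_subgroup_subset[OF inv(1)]] by (simp flip: det_mul)
  then show ?case using inv by simp
qed (auto simp: det_mul)

text \<open>The conjugate is the commutator of h and d times d. This normality later carries the
  normal form from D over to H.\<close>

lemma derived_subgroup_normal: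
  assumes "h \<in> H" "d \<in> derived_subgroup H"
  shows "h ** d ** matrix_inv h \<in> derived_subgroup H"
proof -
  have d: "d \<in> H" using assms derived_subgroup_subset by blast
  have "h ** d ** matrix_inv h ** matrix_inv d ** d \<in> derived_subgroup H"
    using assms d by (intro derived_subgroup.mult derived_subgroup.comm)
  then show ?thesis using H_inverse[OF d] by (simp flip: matrix_mul_assoc)
qed

end

context equichar_cdvr
begin

text \<open>SL_n(k) is perfect: the commutator of a torus element with x_ij(b) is x_ij((t^2 - 1) b),
  and t^2 - 1 is a unit for suitable t. So the derived group still reduces onto SL_n(k).\<close>

lemma derived_subgroup_residual:
  fixes H :: "('a^'n^'n) set"
  assumes H: "H \<subseteq> GL" and img: "image_contains_SL_residue \<pi> H" and two: "CARD('n) \<ge> 2"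
    and M: "det M = 1"
  shows "\<exists>d\<in>derived_subgroup H. mcong \<pi> d M"
proof -
  have res: "\<exists>h\<in>H. mcong \<pi> h M" if "det M = 1" for M
    using img that by (simp add: image_contains_SL_residue_def mcong_def)
  have "SL \<subseteq> {M. \<exists>d\<in>derived_subgroup H. mcong \<pi> d M}"
  proof (rule SL_subset_if_transvections[OF unif _ _ two])
    show "A ** B \<in> {M. \<exists>d\<in>derived_subgroup H. mcong \<pi> d M}"
      if "A \<in> {M. \<exists>d\<in>derived_subgroup H. mcong \<pi> d M}" "B \<in> {M. \<exists>d\<in>derived_subgroup H. mcong \<pi> d M}" for A B
      using that mcong_mult derived_subgroup.mult by blast
  next
    fix i j :: 'n and a assume ij: "i \<noteq> j"
    obtain t where t: "t \<in> K" "t \<noteq> 0" "t\<^sup>2 \<noteq> 1" using K_generic by blast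
    define u where "u = K_inv t"
    have u: "t * u = 1" "u * t = 1" using t K_inv_right by (auto simp: u_def mult.commute)
    have "\<not> \<pi> dvd t\<^sup>2 - 1" using K_cong_iff[of "t\<^sup>2" 1] t by (auto intro: K_intros)
    then obtain w where w: "(t\<^sup>2 - 1) * w = 1" using unit_ex by blast
    define A A' where "A = torus i j t u" and "A' = torus i j u t"
    define B B' where "B = transvection i j (w * a)" and "B' = transvection i j (- (w * a))"
    have AA: "A ** A' = mat 1" "A' ** A = mat 1" "det A = 1" using ij u by (auto simp: A_def A'_def torus_inverse det_torus)
    have BB: "B ** B' = mat 1" "B' ** B = mat 1" "det B = 1" using ij by (auto simp: B_def B'_def transvection_add det_transvection)
    obtain g where g: "g \<in> H" "mcong \<pi> g A" using res AA by blast
    obtain h where h: "h \<in> H" "mcong \<pi> h B" using res BB by blast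
    have gi: "g ** matrix_inv g = mat 1" "h ** matrix_inv h = mat 1"
      using g h H matrix_inv_both by (auto simp: GL_def)
    have "mcong \<pi> (matrix_inv g) A'" by (rule right_inverse_cong[OF AA(2) gi(1) g(2)])
    moreover have "mcong \<pi> (matrix_inv h) B'" by (rule right_inverse_cong[OF BB(2) gi(2) h(2)])
    ultimately have "mcong \<pi> (g ** h ** matrix_inv g ** matrix_inv h) (A ** B ** A' ** B')"
      using g h by (intro mcong_mult)
    also have "A ** B ** A' ** B' = transvection i j a"
    proof -
      have "A ** B ** A' = transvection i j (t\<^sup>2 * (w * a))"
        using ij u by (intro matrix_eqI) (auto simp: A_def A'_def B_def torus_def entry_simps power2_eq_square ac_simps)
      moreover have "t\<^sup>2 * (w * a) - w * a = a"
      proof -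
        have "t\<^sup>2 * (w * a) - w * a = ((t\<^sup>2 - 1) * w) * a" by (simp add: algebra_simps)
        then show ?thesis using w by simp
      qed
      ultimately show ?thesis using ij by (simp add: B'_def transvection_add)
    qed
    finally show "transvection i j a \<in> {M. \<exists>d\<in>derived_subgroup H. mcong \<pi> d M}"
      using derived_subgroup.comm[OF g(1) h(1)] by blast
  qed
  then show ?thesis using M by (auto simp: SL_def)
qed

text \<open>The entries (i,i) and (i,j) of the relation eliminate c and leave x_ii - x_jj + a x_ji =
  0 modulo pi for nonzero a in K; the values a = 1 and a = t separate the two terms.\<close>

lemma scalar_mod_if_commute_transvections:
  fixes X :: "'a^'n^'n"
  assumes "\<And>i j a. i \<noteq> j \<Longrightarrow> a \<in> K \<Longrightarrow> \<exists>c. mcong \<pi> (X ** transvection i j a) (transvection i j a ** X + smul c (transvection i j a))"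
  shows "scalar_mod X"
proof -
  have "\<pi> dvd X $ j $ i \<and> \<pi> dvd X $ i $ i - X $ j $ j" if ij: "i \<noteq> j" for i j
  proof -
    have 1: "\<pi> dvd X $ i $ i - X $ j $ j + a * X $ j $ i" if a: "a \<in> K" "a \<noteq> 0" for a
    proof -
      obtain c where c: "mcong \<pi> (X ** transvection i j a) (transvection i j a ** X + smul c (transvection i j a))"
        using assms ij a by blast
      have "\<pi> dvd - (a * X $ j $ i + c)" using mcongD[OF c, of i i] ij by (simp add: entry_simps)
      then have 1: "\<pi> dvd a * X $ j $ i + c" by (simp only: dvd_minus_iff)
      have "\<pi> dvd X $ i $ i * a - (a * X $ j $ j + c * a)" using mcongD[OF c, of i j] ij by (simp add: entry_simps algebra_simps)
      from dvd_add[OF this dvd_mult[OF 1, of a]] have "\<pi> dvd a * (X $ i $ i - X $ j $ j + a * X $ j $ i)" by (simp add: algebra_simps)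
      then show ?thesis using pi_prime K_dvd_iff a by blast
    qed
    obtain t where t: "t \<in> K" "t \<noteq> 0" "t\<^sup>2 \<noteq> 1" using K_generic by blast
    then have t1: "\<not> \<pi> dvd 1 - t" using K_cong_iff[of 1 t] K_1 by auto
    have "\<pi> dvd (1 - t) * X $ j $ i" using dvd_diff[OF 1[OF K_1 one_neq_zero] 1[OF t(1,2)]] by (simp add: algebra_simps)
    then have "\<pi> dvd X $ j $ i" using t1 pi_prime by blast
    then show ?thesis using 1[OF K_1 one_neq_zero] by (simp add: dvd_add_left_iff)
  qed
  then show ?thesis unfolding scalar_mod_def by metis
qed

lemma scalar_modE:
  assumes "scalar_mod X"
  obtains e where "mcong \<pi> X (mat e)"
proof -
  have "mcong \<pi> X (mat (X $ i $ i))" for i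
    using assms by (auto simp: mcong_def mat_nth scalar_mod_def) (metis diff_self dvd_0_right)
  then show ?thesis using that by blast
qed

section \<open>Density in the case of a full first level\<close>

lemma H_der_eq_SL_if_full:
  fixes H :: "('a^'n^'n) set"
  assumes "residually_full_group \<pi> (derived_subgroup H)"
    and full: "residually_full_group.full_level \<pi> (derived_subgroup H) 1"
  shows "H_der \<pi> H = SL"
proof -
  interpret residually_full_group \<pi> "derived_subgroup H" by fact
  show ?thesis
  proof
    show "H_der \<pi> H \<subseteq> SL"
    proof
      fix L assume "L \<in> H_der \<pi> H"
      then obtain X where X: "\<And>k. X k \<in> derived_subgroup H" "mat_padic_lim \<pi> X L"
        by (auto simp: H_der_def mat_closure_def)
      have "det L - 1 = 0"
      proof (rule separated)
        fix m
        have "\<exists>N. \<forall>k\<ge>N. \<pi> ^ m dvd X k $ i $ j - L $ i $ j" for i j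
          using X(2) by (simp add: mat_padic_lim_def padic_lim_def)
        then obtain N where N: "\<And>i j k. k \<ge> N i j \<Longrightarrow> \<pi> ^ m dvd X k $ i $ j - L $ i $ j" by metis
        \<comment> \<open>The sum bounds all the thresholds N i j, so at k every entry is close to
          its limit.\<close>
        define k where "k = (\<Sum>i\<in>UNIV. \<Sum>j\<in>UNIV. N i j)"
        have "N i j \<le> k" for i j
          unfolding k_def by (rule order_trans[OF member_le_sum[of j UNIV "N i"] member_le_sum[of i UNIV "\<lambda>i. \<Sum>j\<in>UNIV. N i j"]]) auto
        then have "mcong (\<pi> ^ m) (X k) L" using N by (auto simp: mcong_def)
        then show "\<pi> ^ m dvd det L - 1" using mcong_det[of "\<pi> ^ m" "X k" L] det_1[OF X(1)] dvd_diff_sym by metis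
      qed
      then show "L \<in> SL" by (simp add: SL_def)
    qed
    show "SL \<subseteq> H_der \<pi> H"
    proof
      fix M :: "'a^'n^'n" assume "M \<in> SL"
      then have "\<exists>h\<in>derived_subgroup H. mcong (\<pi> ^ Suc m) h M" for m
        using dense_if_full_level[OF full, of M "Suc m"] by (simp add: SL_def)
      then obtain X where X: "\<And>m. X m \<in> derived_subgroup H" "\<And>m. mcong (\<pi> ^ Suc m) (X m) M" by metis
      have "\<pi> ^ m dvd X k $ i $ j - M $ i $ j" if "k \<ge> m" for m k i j
        using mcongD[OF X(2)[of k], of i j] that le_imp_power_dvd[of m "Suc k" \<pi>] dvd_trans by (metis le_SucI)
      then have "mat_padic_lim \<pi> X M" unfolding mat_padic_lim_def padic_lim_def by blast
      then show "M \<in> H_der \<pi> H" using X(1) by (auto simp: H_der_def mat_closure_def)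
    qed
  qed
qed

lemma one_plus_mult: "(1 + \<pi> * a) * (1 + \<pi> * b) = 1 + \<pi> * (a + b + \<pi> * (a * b))"
  by (simp add: algebra_simps)

text \<open>The group is D enlarged by all scalars 1 + pi e, and saturated modulo pi^2. Uniqueness
  of lifts is \<open>full_level_or_scalar\<close>, moved past the scalars of both elements.\<close>

lemma scalar_extension_if_not_full:
  fixes D :: "('a^'n^'n) set"
  assumes "residually_full_group \<pi> D"
    and nfull: "\<not> residually_full_group.full_level \<pi> D 1"
  shows "scalar_extension \<pi> {M. \<exists>d\<in>D. \<exists>e. mcong (\<pi>\<^sup>2) M (smul (1 + \<pi> * e) d)}" (is "scalar_extension \<pi> ?G")
proof -
  interpret residually_full_group \<pi> D by fact
  have sq: "mcong \<pi> A B" if "mcong (\<pi>\<^sup>2) A B" for A B :: "'a^'n^'n"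
    using that mcong_mono by (metis dvd_triv_left power2_eq_square)
  have sc: "mcong \<pi> (smul (1 + \<pi> * e) d) d" for e and d :: "'a^'n^'n"
    by (auto simp: mcong_def algebra_simps)
  show ?thesis
  proof
    show "2 \<le> CARD('n)" by (rule two)
    show "M' \<in> ?G" if "M \<in> ?G" "mcong (\<pi>\<^sup>2) M M'" for M M'
      using that mcong_trans mcong_sym by blast
    show "g ** h \<in> ?G" if gh: "g \<in> ?G" "h \<in> ?G" for g h
    proof -
      obtain d e d' e' where d: "d \<in> D" "mcong (\<pi>\<^sup>2) g (smul (1 + \<pi> * e) d)" "d' \<in> D" "mcong (\<pi>\<^sup>2) h (smul (1 + \<pi> * e') d')"
        using gh by blast
      have "mcong (\<pi>\<^sup>2) (g ** h) (smul (1 + \<pi> * e) d ** smul (1 + \<pi> * e') d')" by (intro mcong_mult d)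
      then have "mcong (\<pi>\<^sup>2) (g ** h) (smul (1 + \<pi> * (e + e' + \<pi> * (e * e'))) (d ** d'))"
        by (simp add: smul_mult_left smul_mult_right smul_smul one_plus_mult ac_simps)
      then show ?thesis using mult d by blast
    qed
    show "smul (1 + \<pi> * e) M \<in> ?G" if M: "M \<in> ?G" for M e
    proof -
      obtain d e' where d: "d \<in> D" "mcong (\<pi>\<^sup>2) M (smul (1 + \<pi> * e') d)" using M by blast
      have "mcong (\<pi>\<^sup>2) (smul (1 + \<pi> * e) M) (smul (1 + \<pi> * (e + e' + \<pi> * (e * e'))) d)"
        using mcong_smul[OF d(2), of "1 + \<pi> * e"] by (simp add: smul_smul one_plus_mult)
      then show ?thesis using d by blast
    qed
    show "\<pi> dvd det M - 1" if M: "M \<in> ?G" for M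
    proof -
      obtain d e where d: "d \<in> D" "mcong (\<pi>\<^sup>2) M (smul (1 + \<pi> * e) d)" using M by blast
      then have "mcong \<pi> M d" using sq sc mcong_trans by blast
      then show ?thesis using mcong_det det_1[OF d(1)] by metis
    qed
    show "\<exists>h\<in>?G. mcong \<pi> h M" if M: "\<pi> dvd det M - 1" for M
    proof -
      obtain N where N: "det N = 1" "mcong \<pi> N M" using normalize_det M by blast
      then obtain h where h: "h \<in> D" "mcong \<pi> h N" using residual by blast
      have "h \<in> ?G" using h by (auto intro!: bexI[of _ h] exI[of _ 0])
      then show ?thesis using h N mcong_trans by blast
    qed
    show "\<exists>c. mcong (\<pi>\<^sup>2) h (smul (1 + \<pi> * c) g)" if gh: "g \<in> ?G" "h \<in> ?G" "mcong \<pi> g h" for g h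
    proof -
      obtain d e d' e' where d: "d \<in> D" "mcong (\<pi>\<^sup>2) g (smul (1 + \<pi> * e) d)" "d' \<in> D" "mcong (\<pi>\<^sup>2) h (smul (1 + \<pi> * e') d')"
        using gh(1,2) by blast
      have "mcong \<pi> g d" "mcong \<pi> h d'" using d sq sc mcong_trans by blast+
      then have "mcong \<pi> d d'" using gh(3) mcong_trans mcong_sym by blast
      then obtain c where c: "mcong (\<pi>\<^sup>2) d' (smul (1 + \<pi> * c) d)" using full_level_or_scalar[OF nfull d(1,3)] by blast
      have "mcong (\<pi>\<^sup>2) (smul (1 - \<pi> * e) g) (smul (1 - \<pi> * e) (smul (1 + \<pi> * e) d))" by (intro mcong_smul d)
      then have dg: "mcong (\<pi>\<^sup>2) d (smul (1 + \<pi> * (- e)) g)" using mcong_trans[OF _ smul_one_plus_inverse] mcong_sym by simp blast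
      have "mcong (\<pi>\<^sup>2) h (smul (1 + \<pi> * e') d')" by (rule d)
      also have "mcong (\<pi>\<^sup>2) (smul (1 + \<pi> * e') d') (smul (1 + \<pi> * e') (smul (1 + \<pi> * c) d))" by (intro mcong_smul c)
      also have "mcong (\<pi>\<^sup>2) (smul (1 + \<pi> * e') (smul (1 + \<pi> * c) d)) (smul (1 + \<pi> * e') (smul (1 + \<pi> * c) (smul (1 + \<pi> * (- e)) g)))"
        by (intro mcong_smul dg)
      finally show ?thesis unfolding smul_smul one_plus_mult by blast
    qed
  qed
qed

text \<open>With m and m' the conjugates of h and h', write $m = k + \pi Y$ with k over K. Modulo $\pi$, the
  matrix $m'Y$ commutes up to scalars with all transvections, hence is scalar.\<close>
lemma normalizer_over_K:
  fixes h h' P P' :: "'a^'n^'n"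
  assumes P: "mcong (\<pi>\<^sup>2) (P ** P') (mat 1)" "mcong (\<pi>\<^sup>2) (P' ** P) (mat 1)"
    and h: "h ** h' = mat 1" "h' ** h = mat 1"
    and norm: "\<And>i j a. i \<noteq> j \<Longrightarrow> a \<in> K \<Longrightarrow> \<exists>g c. over_K g \<and>
      mcong (\<pi>\<^sup>2) (h ** (P ** transvection i j a ** P') ** h') (smul (1 + \<pi> * c) (P ** g ** P'))"
  shows "\<exists>k e. over_K k \<and> mcong (\<pi>\<^sup>2) (P' ** h ** P) (smul (1 + \<pi> * e) k)"
proof -
  define m m' where "m = P' ** h ** P" and "m' = P' ** h' ** P"
  have sq: "mcong \<pi> A B" if "mcong (\<pi>\<^sup>2) A B" for A B :: "'a^'n^'n"
    using that mcong_mono by (metis dvd_triv_left power2_eq_square)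
  have inverse: "mcong (\<pi>\<^sup>2) ((P' ** h ** P) ** (P' ** h' ** P)) (mat 1)" if "h ** h' = mat 1" for h h'
  proof -
    have "mcong (\<pi>\<^sup>2) (P' ** h ** (P ** P') ** h' ** P) (P' ** h ** mat 1 ** h' ** P)" by (intro mcong_mult P mcong_refl)
    also have "P' ** h ** mat 1 ** h' ** P = P' ** (h ** h') ** P" by (simp add: matrix_mul_assoc)
    also have "mcong (\<pi>\<^sup>2) (P' ** (h ** h') ** P) (mat 1)" using that P by simp
    finally show ?thesis by (simp add: matrix_mul_assoc)
  qed
  have mm: "mcong \<pi> (m ** m') (mat 1)" "mcong \<pi> (m' ** m) (mat 1)"
    using inverse[OF h(1)] inverse[OF h(2)] sq by (auto simp: m_def m'_def)
  obtain k where k: "over_K k" "mcong \<pi> m k" using over_K_ex by blast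
  then obtain Y where Y: "m = k + smul \<pi> Y" by (auto simp: mcong_iff_ex)
  have "scalar_mod (m' ** Y)"
  proof (rule scalar_mod_if_commute_transvections)
    fix i j :: 'n and a assume ij: "i \<noteq> j" and a: "a \<in> K"
    define x where "x = transvection i j a"
    obtain g c where g: "over_K g" and c: "mcong (\<pi>\<^sup>2) (h ** (P ** x ** P') ** h') (smul (1 + \<pi> * c) (P ** g ** P'))"
      using norm[OF ij a] by (auto simp: x_def)
    have mx: "mcong (\<pi>\<^sup>2) (m ** x) (smul (1 + \<pi> * c) (g ** m))"
    proof -
      have "mcong (\<pi>\<^sup>2) (m ** x ** mat 1) (P' ** h ** P ** x ** (P' ** P))"
        unfolding m_def by (intro mcong_mult mcong_refl mcong_sym[OF P(2)])
      also have "P' ** h ** P ** x ** (P' ** P) = P' ** h ** P ** x ** P' ** (h' ** h) ** P" by (simp add: h matrix_mul_assoc)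
      also have "\<dots> = P' ** (h ** (P ** x ** P') ** h') ** (h ** P)" by (simp add: matrix_mul_assoc)
      also have "mcong (\<pi>\<^sup>2) \<dots> (P' ** smul (1 + \<pi> * c) (P ** g ** P') ** (h ** P))"
        by (intro mcong_mult mcong_refl c)
      also have "P' ** smul (1 + \<pi> * c) (P ** g ** P') ** (h ** P) = smul (1 + \<pi> * c) ((P' ** P) ** g ** m)"
        by (simp add: m_def smul_mult_left smul_mult_right matrix_mul_assoc)
      also have "mcong (\<pi>\<^sup>2) \<dots> (smul (1 + \<pi> * c) (mat 1 ** g ** m))"
        by (intro mcong_smul mcong_mult mcong_refl P)
      finally show ?thesis by simp
    qed
    have mx1: "mcong \<pi> (m ** x) (g ** m)"
    proof -
      have "mcong \<pi> (smul (1 + \<pi> * c) (g ** m)) (g ** m)" by (auto simp: mcong_def algebra_simps)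
      then show ?thesis using sq[OF mx] mcong_trans by blast
    qed
    \<comment> \<open>Both sides are over K, so their congruence is an equality. Subtracting it from
      \<open>mx\<close> and dividing by pi leaves a relation for Y modulo pi.\<close>
    have kx: "k ** x = g ** k"
    proof (rule over_K_cong)
      show "over_K (k ** x)" "over_K (g ** k)" using k g a by (auto simp: x_def intro: over_K_mult over_K_transvection)
      have "mcong \<pi> (k ** x) (m ** x)" by (intro mcong_mult mcong_refl mcong_sym[OF k(2)])
      also note mx1
      also have "mcong \<pi> (g ** m) (g ** k)" by (intro mcong_mult mcong_refl k)
      finally show "mcong \<pi> (k ** x) (g ** k)" .
    qed
    have Yx: "mcong \<pi> (Y ** x) (g ** Y + smul c (k ** x))"
    proof -
      have "m ** x = k ** x + smul \<pi> (Y ** x)" unfolding Y by (simp add: matrix_ring_simps)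
      moreover have "smul (1 + \<pi> * c) (g ** m) = k ** x + smul \<pi> (g ** Y + smul c (k ** x)) + smul (\<pi>\<^sup>2) (smul c (g ** Y))"
        unfolding Y kx by (rule matrix_eqI) (simp add: matrix_ring_simps algebra_simps power2_eq_square)
      ultimately have "mcong (\<pi>\<^sup>2) (k ** x + smul \<pi> (Y ** x)) (k ** x + smul \<pi> (g ** Y + smul c (k ** x)) + smul (\<pi>\<^sup>2) (smul c (g ** Y)))"
        using mx by simp
      also have "mcong (\<pi>\<^sup>2) \<dots> (k ** x + smul \<pi> (g ** Y + smul c (k ** x)))" by (simp add: mcong_def)
      finally have "mcong (\<pi>\<^sup>2) (k ** x + smul \<pi> (Y ** x) - k ** x) (k ** x + smul \<pi> (g ** Y + smul c (k ** x)) - k ** x)"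
        by (rule mcong_diff) simp
      then have "mcong (\<pi> * \<pi>) (smul \<pi> (Y ** x)) (smul \<pi> (g ** Y + smul c (k ** x)))" by (simp add: power2_eq_square)
      then show ?thesis using mcong_smul_cancel[OF pi_nz] by blast
    qed
    have m'g: "mcong \<pi> (m' ** g) (x ** m')"
    proof -
      have "mcong \<pi> (m' ** g ** mat 1) (m' ** g ** (m ** m'))" by (intro mcong_mult mcong_refl mcong_sym[OF mm(1)])
      also have "m' ** g ** (m ** m') = m' ** (g ** m) ** m'" by (simp add: matrix_mul_assoc)
      also have "mcong \<pi> \<dots> (m' ** (m ** x) ** m')" by (intro mcong_mult mcong_refl mcong_sym[OF mx1])
      also have "m' ** (m ** x) ** m' = (m' ** m) ** x ** m'" by (simp add: matrix_mul_assoc)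
      also have "mcong \<pi> \<dots> (mat 1 ** x ** m')" by (intro mcong_mult mcong_refl mm)
      finally show ?thesis by simp
    qed
    have "mcong \<pi> (m' ** (Y ** x)) (m' ** (g ** Y + smul c (k ** x)))" by (intro mcong_mult mcong_refl Yx)
    also have "m' ** (g ** Y + smul c (k ** x)) = (m' ** g) ** Y + smul c (m' ** k ** x)"
      by (simp add: matrix_ring_simps)
    also have "mcong \<pi> \<dots> ((x ** m') ** Y + smul c (mat 1 ** x))"
    proof (intro mcong_add mcong_mult_right mcong_smul m'g)
      have "mcong \<pi> (m' ** k) (m' ** m)" by (intro mcong_mult mcong_refl mcong_sym[OF k(2)])
      then show "mcong \<pi> (m' ** k) (mat 1)" using mm mcong_trans by blast
    qed
    finally show "\<exists>c. mcong \<pi> (m' ** Y ** transvection i j a) (transvection i j a ** (m' ** Y) + smul c (transvection i j a))"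
      by (auto simp: x_def matrix_mul_assoc)
  qed
  \<comment> \<open>Y is congruent to m times the scalar e, hence to e k, and k + pi e k is a scalar
    multiple of k.\<close>
  then obtain e where e: "mcong \<pi> (m' ** Y) (mat e)" by (rule scalar_modE)
  have "mcong \<pi> (mat 1 ** Y) ((m ** m') ** Y)" by (intro mcong_mult mcong_refl mcong_sym[OF mm(1)])
  also have "(m ** m') ** Y = m ** (m' ** Y)" by (simp add: matrix_mul_assoc)
  also have "mcong \<pi> \<dots> (k ** mat e)" by (intro mcong_mult k e)
  finally have "mcong \<pi> Y (smul e k)" by (simp add: mat_commute)
  then have "mcong (\<pi> * \<pi>) (smul \<pi> Y) (smul \<pi> (smul e k))" by (rule mcong_smul_scale)
  then have "mcong (\<pi>\<^sup>2) m (k + smul \<pi> (smul e k))" unfolding Y power2_eq_square by (intro mcong_add mcong_refl)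
  also have "k + smul \<pi> (smul e k) = smul (1 + \<pi> * e) k" by (simp add: smul_add_left smul_smul)
  finally show ?thesis using k(1) unfolding m_def by blast
qed

text \<open>The scalar factors of h and h' are inverse to each other modulo pi^2, because k k' is
  over K and congruent to 1, hence equal to 1. So the product of the two traces loses them, unlike a
  single trace.\<close>

lemma trace_product_in_K:
  fixes h h' P P' k k' :: "'a^'n^'n"
  assumes P: "mcong (\<pi>\<^sup>2) (P ** P') (mat 1)" "mcong (\<pi>\<^sup>2) (P' ** P) (mat 1)"
    and h: "h ** h' = mat 1"
    and k: "over_K k" "mcong (\<pi>\<^sup>2) (P' ** h ** P) (smul (1 + \<pi> * e) k)"
    and k': "over_K k'" "mcong (\<pi>\<^sup>2) (P' ** h' ** P) (smul (1 + \<pi> * e') k')"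
  shows "\<exists>a\<in>K. \<pi>\<^sup>2 dvd trace h * trace h' - a"
proof -
  have sq: "mcong \<pi> A B" if "mcong (\<pi>\<^sup>2) A B" for A B :: "'a^'n^'n"
    using that mcong_mono by (metis dvd_triv_left power2_eq_square)
  define s where "s = (1 + \<pi> * e) * (1 + \<pi> * e')"
  have s1: "\<pi> dvd s - 1" by (simp add: s_def algebra_simps)
  have "mcong (\<pi>\<^sup>2) ((P' ** h ** P) ** (P' ** h' ** P)) (mat 1)"
  proof -
    have "mcong (\<pi>\<^sup>2) (P' ** h ** (P ** P') ** h' ** P) (P' ** h ** mat 1 ** h' ** P)" by (intro mcong_mult P mcong_refl)
    also have "P' ** h ** mat 1 ** h' ** P = P' ** (h ** h') ** P" by (simp add: matrix_mul_assoc)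
    also have "mcong (\<pi>\<^sup>2) (P' ** (h ** h') ** P) (mat 1)" using h P by simp
    finally show ?thesis by (simp add: matrix_mul_assoc)
  qed
  moreover have "mcong (\<pi>\<^sup>2) ((P' ** h ** P) ** (P' ** h' ** P)) (smul (1 + \<pi> * e) k ** smul (1 + \<pi> * e') k')"
    by (intro mcong_mult k k')
  ultimately have "mcong (\<pi>\<^sup>2) (smul (1 + \<pi> * e) k ** smul (1 + \<pi> * e') k') (mat 1)"
    using mcong_trans mcong_sym by blast
  then have kk: "mcong (\<pi>\<^sup>2) (smul s (k ** k')) (mat 1)"
    by (simp add: s_def smul_mult_left smul_mult_right smul_smul mult.commute)
  have "k ** k' = mat 1"
  proof (rule over_K_cong)
    show "over_K (k ** k')" using k k' over_K_mult by blast
    show "over_K (mat 1 :: 'a^'n^'n)" by (simp add: over_K_def mat_nth K_0 K_1)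
    have "mcong \<pi> (smul 1 (k ** k')) (smul s (k ** k'))" using s1 dvd_diff_sym by (intro mcong_smul_left) blast
    then show "mcong \<pi> (k ** k') (mat 1)" using sq[OF kk] mcong_trans by simp blast
  qed
  then have s2: "\<pi>\<^sup>2 dvd s - 1" using mcongD[OF kk, of i i for i] by (simp add: mat_nth)
  have tr: "\<pi>\<^sup>2 dvd trace h - c * trace k" if "mcong (\<pi>\<^sup>2) (P' ** h ** P) (smul c k)" for h k :: "'a^'n^'n" and c
  proof -
    have "mcong (\<pi>\<^sup>2) (h ** mat 1) (h ** (P ** P'))" by (intro mcong_mult mcong_refl mcong_sym[OF P(1)])
    then have "\<pi>\<^sup>2 dvd trace h - trace (h ** (P ** P'))" using mcong_trace by fastforce
    also have "trace (h ** (P ** P')) = trace (P' ** h ** P)"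
      by (metis matrix_mul_assoc trace_mul_sym)
    finally have "\<pi>\<^sup>2 dvd trace h - trace (P' ** h ** P)" .
    moreover have "\<pi>\<^sup>2 dvd trace (P' ** h ** P) - trace (smul c k)" using mcong_trace that by blast
    ultimately have "\<pi>\<^sup>2 dvd trace h - trace (smul c k)" by (rule dvd_diff_trans)
    then show ?thesis by (simp add: trace_def sum_distrib_left)
  qed
  have "\<pi>\<^sup>2 dvd (trace h - (1 + \<pi> * e) * trace k) * trace h' + (1 + \<pi> * e) * trace k * (trace h' - (1 + \<pi> * e') * trace k')
    + (s - 1) * (trace k * trace k')"
    using tr[OF k(2)] tr[OF k'(2)] s2 by (intro dvd_add) (auto intro: dvd_mult dvd_mult2)
  then have "\<pi>\<^sup>2 dvd trace h * trace h' - trace k * trace k'"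
    by (simp add: s_def algebra_simps)
  moreover have "trace k * trace k' \<in> K" using k k' by (auto simp: trace_def over_K_def intro!: K_mult K_sum)
  ultimately show ?thesis by blast
qed

text \<open>K + pi^2 R is a subring because K is one, closed because it is a union of classes modulo
  pi^2, and proper because it omits pi.\<close>

lemma not_top_generates:
  assumes "\<And>r. r \<in> S \<Longrightarrow> \<exists>a\<in>K. \<pi>\<^sup>2 dvd r - a"
  shows "\<not> top_generates \<pi> S"
proof
  assume "top_generates \<pi> S"
  define T where "T = {r. \<exists>a\<in>K. \<pi>\<^sup>2 dvd r - a}"
  have "closed_subring \<pi> T"
    unfolding closed_subring_def
  proof (intro conjI ballI allI impI)
    show "0 \<in> T" "1 \<in> T" using K_0 K_1 by (auto simp: T_def intro: bexI[of _ 0] bexI[of _ 1])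
    fix x y assume "x \<in> T" "y \<in> T"
    then obtain a b where ab: "a \<in> K" "b \<in> K" "\<pi>\<^sup>2 dvd x - a" "\<pi>\<^sup>2 dvd y - b" by (auto simp: T_def)
    have "\<pi>\<^sup>2 dvd (x + y) - (a + b)" using dvd_add[OF ab(3,4)] by (simp add: algebra_simps)
    then show "x + y \<in> T" using ab K_add by (auto simp: T_def)
    have "\<pi>\<^sup>2 dvd (x - y) - (a - b)" using dvd_diff[OF ab(3,4)] by (simp add: algebra_simps)
    then show "x - y \<in> T" using ab K_diff by (auto simp: T_def)
    have "\<pi>\<^sup>2 dvd (x - a) * y + a * (y - b)" using ab by (intro dvd_add dvd_mult dvd_mult2)
    then have "\<pi>\<^sup>2 dvd x * y - a * b" by (simp add: algebra_simps)
    then show "x * y \<in> T" using ab K_mult by (auto simp: T_def)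
  next
    fix x L assume x: "\<forall>k. x k \<in> T" and "padic_lim \<pi> x L"
    then obtain N where "\<pi>\<^sup>2 dvd x N - L" unfolding padic_lim_def by blast
    moreover obtain a where "a \<in> K" "\<pi>\<^sup>2 dvd x N - a" using x by (auto simp: T_def)
    ultimately have "a \<in> K \<and> \<pi>\<^sup>2 dvd L - a" using dvd_diff_trans[OF dvd_diff_sym] by blast
    then show "L \<in> T" unfolding T_def by blast
  qed
  moreover have "S \<subseteq> T" using assms by (auto simp: T_def)
  ultimately have "\<pi> \<in> T" using \<open>top_generates \<pi> S\<close> by (auto simp: top_generates_def)
  then obtain a where a: "a \<in> K" "\<pi>\<^sup>2 dvd \<pi> - a" by (auto simp: T_def)
  then have "\<pi> dvd \<pi> - a" using dvd_trans[of \<pi> "\<pi>\<^sup>2"] by (simp add: power2_eq_square)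
  then have "\<pi> dvd a" by (simp add: dvd_diff_right_iff)
  then have "a = 0" using a K_dvd_iff by blast
  then have "\<pi> * \<pi> dvd \<pi> * 1" using a(2) by (simp add: power2_eq_square)
  then show False using pi_nz pi_ndvd_1 by (simp only: dvd_mult_cancel_left) simp
qed

end

theorem mainTheorem16:
  fixes \<pi> :: "'a::idom"
    and H :: "('a^'n^'n) set"
  assumes "complete_dvr \<pi>"
    and "equal_characteristic \<pi>"
    and "finite (residue_field \<pi>)"
    and "card (residue_field \<pi>) > 9"
    and "CARD('n) \<ge> 2"
    and "closed_subgroup_GL \<pi> H"
    and "image_contains_SL_residue \<pi> H"
    and "top_generates \<pi> (trace_Ad ` H)"
  shows "H_der \<pi> H = SL"
proof -
  interpret equichar_cdvr \<pi> by unfold_locales fact+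
  define D where "D = derived_subgroup H"
  have H: "H \<subseteq> GL" "\<And>g h. g \<in> H \<Longrightarrow> h \<in> H \<Longrightarrow> g ** h \<in> H" "\<And>h. h \<in> H \<Longrightarrow> matrix_inv h \<in> H" "mat 1 \<in> H"
    using assms(6) by (auto simp: closed_subgroup_GL_def)
  have D_H: "D \<subseteq> H" using derived_subgroup_subset[OF H] by (auto simp: D_def)
  have inverse: "h ** matrix_inv h = mat 1" "matrix_inv h ** h = mat 1" if "h \<in> H" for h
    using H_inverse[OF H] that by auto
  have D: "residually_full_group \<pi> D"
  proof
    show "\<exists>g'\<in>D. g ** g' = mat 1 \<and> g' ** g = mat 1" if "g \<in> D" for g
      using that inverse D_H derived_subgroup.inv by (auto simp: D_def intro!: bexI[of _ "matrix_inv g"])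
  qed (use assms(5) derived_subgroup.mult derived_subgroup_det[OF H] derived_subgroup_residual[OF H(1) assms(7,5)] in \<open>auto simp: D_def\<close>)
  show ?thesis
  proof (cases "residually_full_group.full_level \<pi> D 1")
    case True
    then show ?thesis using H_der_eq_SL_if_full D by (simp add: D_def)
  next
    case False
    define G where "G = {M. \<exists>d\<in>D. \<exists>e. mcong (\<pi>\<^sup>2) M (smul (1 + \<pi> * e) d)}"
    interpret scalar_extension \<pi> G unfolding G_def using D False by (rule scalar_extension_if_not_full)
    obtain P P' :: "'a^'n^'n" where PP: "mcong (\<pi>\<^sup>2) (P ** P') (mat 1) \<and> mcong (\<pi>\<^sup>2) (P' ** P) (mat 1) \<and>
        (\<forall>i j. \<forall>a\<in>K. i \<noteq> j \<longrightarrow> P ** transvection i j a ** P' \<in> G) \<and>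
        (\<forall>M\<in>G. \<exists>g c. over_K g \<and> mcong (\<pi>\<^sup>2) M (smul (1 + \<pi> * c) (P ** g ** P')))"
      using conjugate_into_K by (elim exE)
    then have P: "mcong (\<pi>\<^sup>2) (P ** P') (mat 1)" "mcong (\<pi>\<^sup>2) (P' ** P) (mat 1)"
      and tv: "\<And>i j a. i \<noteq> j \<Longrightarrow> a \<in> K \<Longrightarrow> P ** transvection i j a ** P' \<in> G"
      and GK: "\<And>M. M \<in> G \<Longrightarrow> \<exists>g c. over_K g \<and> mcong (\<pi>\<^sup>2) M (smul (1 + \<pi> * c) (P ** g ** P'))"
      by simp_all
    \<comment> \<open>D is normal in H and scalars are central, so H normalizes G even where it is
      not contained in G.\<close>
    have normal: "h ** M ** matrix_inv h \<in> G" if h: "h \<in> H" and M: "M \<in> G" for h M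
    proof -
      obtain d e where d: "d \<in> D" "mcong (\<pi>\<^sup>2) M (smul (1 + \<pi> * e) d)" using M by (auto simp: G_def)
      have "mcong (\<pi>\<^sup>2) (h ** M ** matrix_inv h) (h ** smul (1 + \<pi> * e) d ** matrix_inv h)"
        by (intro mcong_mult mcong_refl d)
      moreover have "h ** d ** matrix_inv h \<in> D" using derived_subgroup_normal[OF H h] d by (simp add: D_def)
      ultimately show ?thesis unfolding G_def by (auto simp: smul_mult_left smul_mult_right)
    qed
    have HK: "\<exists>k e. over_K k \<and> mcong (\<pi>\<^sup>2) (P' ** h ** P) (smul (1 + \<pi> * e) k)" if h: "h \<in> H" for h
      by (rule normalizer_over_K[OF P inverse[OF h]]) (use GK normal[OF h] tv in blast)
    have "\<exists>a\<in>K. \<pi>\<^sup>2 dvd trace_Ad h - a" if h: "h \<in> H" for h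
      unfolding trace_Ad_eq using HK[OF h] HK[OF H(3)[OF h]] trace_product_in_K[OF P inverse(1)[OF h]] by blast
    then have "\<not> top_generates \<pi> (trace_Ad ` H)" by (intro not_top_generates) auto
    then show ?thesis using assms(8) by simp
  qed
qed

end
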